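(* For every integer $n\geq 2$, the Houghton group $H_n$ has finite twin-width and $\operatorname{utww}(H_n)=\infty$ (infinite uniform twin-width).
   Context: Twin-width of matrices. A matrix (of any cardinality, with totally ordered rows and columns) is binary if its entries are $0$ or $1$; it is a bijection matrix if each row and each column contains exactly one $1$. A row/column identification replaces two consecutive rows (or two consecutive columns) by a single row (column) each of whose entries is the maximum of the two corresponding entries. For a finite $m\times n$ binary matrix $M$, consider sequences $M=M_{m+n},M_{m+n-1},\dots,M_2$, each term obtained from the previous one by one row/column identification, ending in a $1\times1$ matrix. The width of the sequence is the maximum number of $1$'s in a single row or column of any matrix of the sequence. The strict twin-width $\operatorname{stww}(M)$ is the minimum width over all such sequences. For an infinite matrix, $\operatorname{stww}$ is the supremum of $\operatorname{stww}$ over its finite submatrices (with the induced orders). For a permutation $\sigma$ of a totally ordered set $(X,<)$, $M_\sigma$ is the $X\times X$ matrix with $M_\sigma(x,y)=1$ iff $\sigma(x)=y$ (and $0$ otherwise), rows and columns ordered by $<$. Twin-width of groups. For a group $G$ and $g\in G$ let $R_g\colon G\to G$, $R_g(x)=xg$. $G$ has finite twin-width if there is a total order on $G$ such that $\operatorname{stww}(M_{R_g})<\infty$ for every $g\in G$. The uniform twin-width is $\operatorname{utww}(G)=\min_{<}\sup_{g\in G}\operatorname{stww}(M_{R_g})\in\mathbb N\cup\{\infty\}$, the minimum over all total orders $<$ on $G$. Houghton groups. For $n=2$, $H_2=\operatorname{FSym}(\mathbb Z)\rtimes\langle t\rangle$ is the group of permutations of $\mathbb Z$ generated by all finitely supported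 permutations $\operatorname{FSym}(\mathbb Z)$ and the translation $t(\ell)=\ell+1$ (the lampshuffler group). For $n\geq3$, let $V(S_n)=\{0\}\cup\{(i,m): 1\le i\le n,\ m\in\mathbb N_{\geq1}\}$; $H_n$ is the group of permutations of $V(S_n)$ generated by $g_2,\dots,g_n$, where $g_k(1,m)=(1,m+1)$, $g_k(0)=(1,1)$, $g_k(k,1)=0$, $g_k(k,m)=(k,m-1)$ for $m\geq2$, and $g_k(i,m)=(i,m)$ for $i\neq1,k$. *)

theory Defs
  imports
    "HOL-Library.Extended_Nat"
    "HOL-Algebra.Bij"
    "HOL-Algebra.Generated_Groups"
    "Jordan_Normal_Form.Matrix"
begin

section \<open>Strict twin-width of finite matrices\<close>

definition identify_rows :: "nat \<Rightarrow> nat mat \<Rightarrow> nat mat" where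
  "identify_rows i A = mat (dim_row A - 1) (dim_col A)
     (\<lambda>(k, j). if k < i then A $$ (k, j)
               else if k = i then max (A $$ (i, j)) (A $$ (Suc i, j))
               else A $$ (Suc k, j))"

definition identify_cols :: "nat \<Rightarrow> nat mat \<Rightarrow> nat mat" where
  "identify_cols j A = mat (dim_row A) (dim_col A - 1)
     (\<lambda>(i, k). if k < j then A $$ (i, k)
               else if k = j then max (A $$ (i, j)) (A $$ (i, Suc j))
               else A $$ (i, Suc k))"

definition identification :: "nat mat \<Rightarrow> nat mat \<Rightarrow> bool" where
  "identification A B \<longleftrightarrow>
     (\<exists>i. Suc i < dim_row A \<and> B = identify_rows i A) \<or>
     (\<exists>j. Suc j < dim_col A \<and> B = identify_cols j A)"

text \<open>The length of a sequence is not prescribed: as every identification lowers the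
  number of rows plus the number of columns by one, it is forced by the two end terms.\<close>

definition contraction_sequence :: "nat mat \<Rightarrow> nat mat list \<Rightarrow> bool" where
  "contraction_sequence A As \<longleftrightarrow>
     As \<noteq> [] \<and> hd As = A \<and> successively identification As \<and> last As \<in> carrier_mat 1 1"

definition row_ones :: "nat mat \<Rightarrow> nat \<Rightarrow> nat" where
  "row_ones A i = card {j. j < dim_col A \<and> A $$ (i, j) = 1}"

definition col_ones :: "nat mat \<Rightarrow> nat \<Rightarrow> nat" where
  "col_ones A j = card {i. i < dim_row A \<and> A $$ (i, j) = 1}"

definition width :: "nat mat list \<Rightarrow> nat" where
  "width As = Max (\<Union>A\<in>set As. row_ones A ` {..<dim_row A} \<union> col_ones A ` {..<dim_col A})"

definition stww_mat :: "nat mat \<Rightarrow> enat" where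
  "stww_mat A = (INF As\<in>{As. contraction_sequence A As}. enat (width As))"


section \<open>Strict twin-width of matrices indexed by ordered sets\<close>

text \<open>A matrix with row set \<open>R\<close> ordered by \<open>r\<close> and column set \<open>C\<close> ordered by \<open>c\<close> is given by
  its entry function \<open>M\<close>. Orders are reflexive relations, as in \<^const>\<open>linear_order_on\<close>.\<close>

definition ordered_list :: "'a rel \<Rightarrow> 'a set \<Rightarrow> 'a list" where
  "ordered_list r A = (THE xs. set xs = A \<and> sorted_wrt (\<lambda>x y. (x, y) \<in> r \<and> x \<noteq> y) xs)"

definition finite_mat ::
    "'a rel \<Rightarrow> 'a set \<Rightarrow> 'b rel \<Rightarrow> 'b set \<Rightarrow> ('a \<Rightarrow> 'b \<Rightarrow> nat) \<Rightarrow> nat mat" where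
  "finite_mat r R c C M = mat (card R) (card C)
     (\<lambda>(i, j). M (ordered_list r R ! i) (ordered_list c C ! j))"

text \<open>Only nonempty finite submatrices are taken into account: a matrix without rows or
  without columns cannot be contracted to a \<open>1 \<times> 1\<close> matrix.\<close>

definition stww ::
    "'a rel \<Rightarrow> 'a set \<Rightarrow> 'b rel \<Rightarrow> 'b set \<Rightarrow> ('a \<Rightarrow> 'b \<Rightarrow> nat) \<Rightarrow> enat" where
  "stww r R c C M =
     (if finite R \<and> finite C then stww_mat (finite_mat r R c C M)
      else (SUP (R', C')\<in>{(R', C'). finite R' \<and> R' \<noteq> {} \<and> R' \<subseteq> R \<and>
                                      finite C' \<and> C' \<noteq> {} \<and> C' \<subseteq> C}.
              stww_mat (finite_mat r R' c C' M)))"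

definition perm_mat :: "('a \<Rightarrow> 'a) \<Rightarrow> 'a \<Rightarrow> 'a \<Rightarrow> nat" where
  "perm_mat \<sigma> x y = (if \<sigma> x = y then 1 else 0)"


section \<open>Twin-width of groups\<close>

definition right_translation :: "('a, 'b) monoid_scheme \<Rightarrow> 'a \<Rightarrow> 'a \<Rightarrow> 'a" where
  "right_translation G g x = x \<otimes>\<^bsub>G\<^esub> g"

definition translation_stww :: "('a, 'b) monoid_scheme \<Rightarrow> 'a rel \<Rightarrow> 'a \<Rightarrow> enat" where
  "translation_stww G r g =
     stww r (carrier G) r (carrier G) (perm_mat (right_translation G g))"

definition finite_twin_width :: "('a, 'b) monoid_scheme \<Rightarrow> bool" where
  "finite_twin_width G \<longleftrightarrow>
     (\<exists>r. linear_order_on (carrier G) r \<and> (\<forall>g\<in>carrier G. translation_stww G r g < \<infinity>))"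

text \<open>The infimum is a minimum, since \<^typ>\<open>enat\<close> is well-ordered and every set has a
  linear order.\<close>

definition utww :: "('a, 'b) monoid_scheme \<Rightarrow> enat" where
  "utww G = (INF r\<in>{r. linear_order_on (carrier G) r}. SUP g\<in>carrier G. translation_stww G r g)"


section \<open>Houghton groups\<close>

text \<open>A single type contains the sets on which all Houghton groups act: the integers \<open>Line l\<close>
  for \<open>n = 2\<close>, and for \<open>n \<ge> 3\<close> the union of \<open>n\<close> rays \<open>Ray i m\<close> (\<open>m \<ge> 1\<close>) and a point \<open>Centre\<close>,
  where \<open>Ray i m\<close> stands for \<open>(i, m)\<close> and \<open>Centre\<close> for \<open>0\<close>.\<close>

datatype point = Line int | Centre | Ray nat nat

definition houghton_points :: "nat \<Rightarrow> point set" where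
  "houghton_points n =
     (if n = 2 then range Line else insert Centre {Ray i m |i m. 1 \<le> i \<and> i \<le> n \<and> 1 \<le> m})"

definition finitely_supported_perms :: "'a set \<Rightarrow> ('a \<Rightarrow> 'a) set" where
  "finitely_supported_perms S = {f \<in> Bij S. finite {x \<in> S. f x \<noteq> x}}"

text \<open>The values at points outside \<^term>\<open>houghton_points n\<close> are irrelevant: the functions
  below are restricted to this set when they are taken as generators.\<close>

definition line_shift :: "point \<Rightarrow> point" where
  "line_shift p = (case p of Line l \<Rightarrow> Line (l + 1) | _ \<Rightarrow> p)"

definition ray_shift :: "nat \<Rightarrow> point \<Rightarrow> point" where
  "ray_shift k p =
     (case p of
        Line l \<Rightarrow> Line l
      | Centre \<Rightarrow> Ray 1 1
      | Ray i m \<Rightarrow>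
          if i = 1 then Ray 1 (m + 1)
          else if i = k then (if m = 1 then Centre else Ray k (m - 1))
          else Ray i m)"

definition houghton_generators :: "nat \<Rightarrow> (point \<Rightarrow> point) set" where
  "houghton_generators n =
     (if n = 2
      then insert (restrict line_shift (houghton_points n))
             (finitely_supported_perms (houghton_points n))
      else {restrict (ray_shift k) (houghton_points n) |k. 2 \<le> k \<and> k \<le> n})"

definition houghton :: "nat \<Rightarrow> (point \<Rightarrow> point) monoid" where
  "houghton n = subgroup_generated (BijGroup (houghton_points n)) (houghton_generators n)"

text \<open>The intersection with the carrier in \<^const>\<open>subgroup_generated\<close> discards no generator.\<close>

lemma houghton_generators_Bij: "houghton_generators n \<subseteq> Bij (houghton_points n)"
proof (cases "n = 2")
  case True
  have "bij_betw line_shift (range Line) (range Line)"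
    by (rule bij_betw_byWitness[where f' = "\<lambda>p. case p of Line l \<Rightarrow> Line (l - 1) | _ \<Rightarrow> p"])
       (auto simp: line_shift_def)
  then have "restrict line_shift (houghton_points n) \<in> Bij (houghton_points n)"
    using True by (simp add: Bij_def houghton_points_def)
  then show ?thesis
    using True by (auto simp: houghton_generators_def finitely_supported_perms_def)
next
  case False
  let ?V = "houghton_points n"
  have "restrict (ray_shift k) ?V \<in> Bij ?V" if "2 \<le> k" "k \<le> n" for k
  proof -
    let ?h = "\<lambda>p. case p of Line l \<Rightarrow> Line l | Centre \<Rightarrow> Ray k 1
       | Ray i m \<Rightarrow> if i = 1 then (if m = 1 then Centre else Ray 1 (m - 1))
           else if i = k then Ray k (m + 1) else Ray i m"
    have "bij_betw (ray_shift k) ?V ?V"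
      using False that
      by (intro bij_betw_byWitness[where f' = ?h])
         (auto simp: houghton_points_def ray_shift_def)
    then show ?thesis
      by (simp add: Bij_def)
  qed
  with False show ?thesis
    by (auto simp: houghton_generators_def)
qed

lemma group_houghton: "group (houghton n)"
  by (simp add: houghton_def group.group_subgroup_generated group_BijGroup)

end

theory Submission
  imports
    Defs
    Complex_Main
    "HOL-Computational_Algebra.Primes"
    "HOL-Combinatorics.Permutations"
    "HOL-Library.Countable_Set"
begin

text \<open>Both halves of the theorem compare a right translation of the group with an order of its elements.

\<^bold>\<open>Infinite uniform twin-width.\<close> Suppose that the rows and the columns of a matrix are cut into
\<open>t\<close> consecutive blocks each, and that every one of the \<open>t\<^sup>2\<close> cells contains a \<open>1\<close>. Then every
contraction sequence has width at least \<open>t / 2\<close>: as soon as a part of the current partition, say of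
the rows, meets three blocks, it contains the middle one, hence sees a \<open>1\<close> in all blocks of columns,
and these are spread over at least \<open>t / 2\<close> parts because no part of the columns meets three of them
(\<open>fuzzy_grid_identify_rows\<close>). So it suffices to find, for every order of \<open>H\<^sub>n\<close> and every \<open>t\<close>, an
element \<open>g\<close> and a finite set of elements such that \<open>R\<^sub>g\<close> maps some element of the \<open>i\<close>-th block into
the \<open>j\<close>-th block, for all \<open>i\<close> and \<open>j\<close>. The group \<open>H\<^sub>n\<close> contains all finitely supported permutations,
and therefore a copy of \<open>SL(2, p)\<close> for every prime \<open>p\<close>. These finite groups are quasirandom: if
\<open>A\<close> and \<open>B\<close> have density about \<open>1 / t\<close> and \<open>p\<close> is large compared with \<open>t\<^sup>4\<close>, then \<open>A g\<close> meets \<open>B\<close>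
for so many elements \<open>g\<close> that a single \<open>g\<close> serves all pairs of blocks
(\<open>translate_meets_all\<close>). This works for every order, since nothing but the size of the blocks
enters.

Quasirandomness is proved by Fourier analysis on the unipotent subgroups, which are isomorphic to
\<open>\<int> / p\<close>, without representation theory. Let \<open>\<Lambda> g\<close> be the number of \<open>x \<in> A\<close> with \<open>x g \<in> B\<close>.
A component of the indicator of \<open>A\<close> for a nontrivial character of a unipotent subgroup is moved by
the diagonal matrices to \<open>(p - 1) / 2\<close> pairwise orthogonal functions with the same mean square
correlation with the translates of \<open>B\<close>. By Bessel's inequality this correlation is small
(\<open>correlation_eigenfunction\<close>), so replacing \<open>A\<close> by \<open>A u\<close> with \<open>u\<close> unipotent changes \<open>\<Lambda>\<close> little
(\<open>correlation_almost_invariant\<close>). Every element of \<open>SL(2, p)\<close> is a product of four unipotents, hence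
\<open>\<Lambda>\<close> is nearly constant, and it has few zeros because its mean is \<open>\<bar>A\<bar> \<bar>B\<bar> / \<bar>SL(2, p)\<bar>\<close>
(\<open>card_missing_translates\<close>).

\<^bold>\<open>Finite twin-width.\<close> For \<open>n = 2\<close> the points are the integers in their natural
order; for \<open>n \<ge> 3\<close> order them ray after ray, each ray outwards. Every element of \<open>H\<^sub>n\<close> is
increasing outside a finite set of points. List the points in a sequence, regard \<open>x \<in> H\<^sub>n\<close> as the
infinite word of the preimages under \<open>x\<close> of the listed points, and order the words
lexicographically. Right translation by \<open>g\<close> applies \<open>g\<close> inverse to every letter, and this map can be
contracted letter by letter, from the last relevant letter to the first. Words with a common prefix
are merged by a sweep through their next letter which advances simultaneously for the rows and for
the columns; only the finitely many letters at which \<open>g\<close> inverse is not increasing get out of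
step. So the width is bounded in terms of their number, whatever the finite
submatrix (\<open>stww_mat_submatrix\<close>).\<close>


section \<open>Large grids force large width\<close>

text \<open>The number of predecessors in a finite set turns an arbitrary linear order into the order of the natural
numbers, so that sorted lists over \<open>nat\<close> can be used.\<close>

lemma rank_less_iff:
  assumes r: "linear_order_on X r" and A: "finite A" "A \<subseteq> X" and xy: "x \<in> A" "y \<in> A"
  shows "card {z \<in> A. (z, x) \<in> r} < card {z \<in> A. (z, y) \<in> r} \<longleftrightarrow> (x, y) \<in> r \<and> x \<noteq> y"
proof -
  have r': "refl_on X r" "trans r" "antisym r" "total_on X r"
    using r by (auto simp: linear_order_on_def partial_order_on_def preorder_on_def)
  have less: "card {z \<in> A. (z, x) \<in> r} < card {z \<in> A. (z, y) \<in> r}"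
    if "x \<in> A" "y \<in> A" "(x, y) \<in> r" "x \<noteq> y" for x y
  proof (rule psubset_card_mono)
    have "y \<in> {z \<in> A. (z, y) \<in> r}" "y \<notin> {z \<in> A. (z, x) \<in> r}"
      using that r' A by (auto dest: refl_onD antisymD)
    moreover have "{z \<in> A. (z, x) \<in> r} \<subseteq> {z \<in> A. (z, y) \<in> r}"
      using that r' by (auto dest: transD)
    ultimately show "{z \<in> A. (z, x) \<in> r} \<subset> {z \<in> A. (z, y) \<in> r}"
      by blast
  qed (use A in simp)
  show ?thesis
  proof (cases "x = y \<or> (x, y) \<in> r")
    case True
    then show ?thesis
      using less[OF xy] by auto
  next
    case False
    then have "(y, x) \<in> r" "(x, y) \<notin> r" "y \<noteq> x"
      using r'(4) xy A by (auto simp: total_on_def)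
    then show ?thesis
      using less[of y x] xy by auto
  qed
qed

lemma ex1_ordered_list:
  assumes r: "linear_order_on X r" and A: "finite A" "A \<subseteq> X"
  shows "\<exists>!xs. set xs = A \<and> sorted_wrt (\<lambda>x y. (x, y) \<in> r \<and> x \<noteq> y) xs"
proof -
  define f where "f x = card {z \<in> A. (z, x) \<in> r}" for x
  have f_less: "f x < f y \<longleftrightarrow> (x, y) \<in> r \<and> x \<noteq> y" if "x \<in> A" "y \<in> A" for x y
    unfolding f_def using rank_less_iff[OF r A that] .
  have inj: "inj_on f A"
  proof (rule inj_onI)
    fix x y assume xy: "x \<in> A" "y \<in> A" "f x = f y"
    then have "\<not> ((x, y) \<in> r \<and> x \<noteq> y)" "\<not> ((y, x) \<in> r \<and> y \<noteq> x)"
      using f_less[of x y] f_less[of y x] by auto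
    then show "x = y"
      using r xy A by (auto simp: linear_order_on_def total_on_def)
  qed
  have sorted_iff: "sorted_wrt (\<lambda>x y. (x, y) \<in> r \<and> x \<noteq> y) xs \<longleftrightarrow> sorted_wrt (<) (map f xs)"
    if "set xs = A" for xs
  proof -
    have "f (xs ! i) < f (xs ! j) \<longleftrightarrow> (xs ! i, xs ! j) \<in> r \<and> xs ! i \<noteq> xs ! j"
      if "i < j" "j < length xs" for i j
    proof -
      have "xs ! i \<in> set xs" "xs ! j \<in> set xs"
        using that by simp_all
      then show ?thesis
        using f_less \<open>set xs = A\<close> by blast
    qed
    then show ?thesis
      unfolding sorted_wrt_map sorted_wrt_iff_nth_less by (simp del: not_less)
  qed
  show ?thesis
  proof (rule ex_ex1I)
    let ?g = "inv_into A f"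
    let ?xs = "map ?g (sorted_list_of_set (f ` A))"
    have set: "set ?xs = A"
      using A inj by (simp add: image_image)
    have "map f ?xs = sorted_list_of_set (f ` A)"
    proof -
      have "f (?g y) = y" if "y \<in> set (sorted_list_of_set (f ` A))" for y
        using that A by (simp add: f_inv_into_f)
      then show ?thesis
        unfolding map_map o_def by (rule map_idI)
    qed
    then have "sorted_wrt (<) (map f ?xs)"
      by (simp only: strict_sorted_list_of_set)
    then have "sorted_wrt (\<lambda>x y. (x, y) \<in> r \<and> x \<noteq> y) ?xs"
      by (rule iffD2[OF sorted_iff[OF set]])
    with set show "\<exists>xs. set xs = A \<and> sorted_wrt (\<lambda>x y. (x, y) \<in> r \<and> x \<noteq> y) xs"
      by (intro exI[of _ ?xs] conjI)
  next
    let ?P = "sorted_wrt (\<lambda>x y. (x, y) \<in> r \<and> x \<noteq> y)"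
    fix xs ys
    assume xs: "set xs = A \<and> ?P xs" and ys: "set ys = A \<and> ?P ys"
    have "sorted_wrt (<) (map f xs)"
      using sorted_iff[OF conjunct1[OF xs]] conjunct2[OF xs] by (rule iffD1)
    moreover have "sorted_wrt (<) (map f ys)"
      using sorted_iff[OF conjunct1[OF ys]] conjunct2[OF ys] by (rule iffD1)
    moreover have "set (map f ys) = set (map f xs)"
      by (simp only: set_map conjunct1[OF xs] conjunct1[OF ys])
    ultimately have "map f ys = map f xs"
      by (rule strict_sorted_equal)
    moreover have "inj_on f (set ys \<union> set xs)"
      by (simp only: conjunct1[OF xs] conjunct1[OF ys] Un_absorb inj)
    ultimately have "ys = xs"
      by (rule map_inj_on)
    then show "xs = ys" ..
  qed
qed

lemma ordered_list:
  assumes r: "linear_order_on X r" and A: "finite A" "A \<subseteq> X"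
  shows "set (ordered_list r A) = A"
    and "sorted_wrt (\<lambda>x y. (x, y) \<in> r \<and> x \<noteq> y) (ordered_list r A)"
    and "distinct (ordered_list r A)" and "length (ordered_list r A) = card A"
proof -
  show *: "set (ordered_list r A) = A"
    "sorted_wrt (\<lambda>x y. (x, y) \<in> r \<and> x \<noteq> y) (ordered_list r A)"
    using theI'[OF ex1_ordered_list[OF assms]] by (auto simp: ordered_list_def)
  show "distinct (ordered_list r A)"
    using *(2) unfolding distinct_conv_nth sorted_wrt_iff_nth_less by (metis nat_neq_iff)
  then show "length (ordered_list r A) = card A"
    using distinct_card[of "ordered_list r A"] *(1) by simp
qed

text \<open>After some identifications a row stands for an interval of original rows and may meet several blocks of the
original grid; \<open>\<rho> i\<close> is the set of blocks met by row \<open>i\<close>. The monotonicity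
condition is what remains of the fact that blocks and rows are intervals: a block that lies strictly between
two blocks met by row \<open>i\<close> is met by no other row.\<close>

definition fuzzy_blocks :: "nat \<Rightarrow> nat \<Rightarrow> (nat \<Rightarrow> nat set) \<Rightarrow> bool" where
  "fuzzy_blocks t n \<rho> \<longleftrightarrow> (\<forall>i<n. \<rho> i \<subseteq> {..<t} \<and> card (\<rho> i) \<le> 2) \<and>
     (\<forall>i i'. i < i' \<longrightarrow> i' < n \<longrightarrow> (\<forall>a\<in>\<rho> i. \<forall>a'\<in>\<rho> i'. a \<le> a'))"

definition fuzzy_grid :: "nat \<Rightarrow> nat mat \<Rightarrow> (nat \<Rightarrow> nat set) \<Rightarrow> (nat \<Rightarrow> nat set) \<Rightarrow> bool" where
  "fuzzy_grid t A \<rho> \<gamma> \<longleftrightarrow>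
     (\<forall>i<dim_row A. \<forall>j<dim_col A. A $$ (i, j) \<le> 1) \<and>
     fuzzy_blocks t (dim_row A) \<rho> \<and> fuzzy_blocks t (dim_col A) \<gamma> \<and>
     (\<forall>a<t. \<forall>b<t. \<exists>i<dim_row A. \<exists>j<dim_col A. a \<in> \<rho> i \<and> b \<in> \<gamma> j \<and> A $$ (i, j) = 1)"

lemma fuzzy_grid_transposeI:
  assumes "fuzzy_grid t A \<rho> \<gamma>"
  shows "fuzzy_grid t (transpose_mat A) \<gamma> \<rho>"
  unfolding fuzzy_grid_def index_transpose_mat
proof (intro conjI allI impI)
  fix a b assume "a < t" "b < t"
  then obtain i j where "i < dim_row A" "j < dim_col A" "b \<in> \<rho> i" "a \<in> \<gamma> j" "A $$ (i, j) = 1"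
    using assms unfolding fuzzy_grid_def by blast
  then show "\<exists>i<dim_col A. \<exists>j<dim_row A. a \<in> \<gamma> i \<and> b \<in> \<rho> j \<and> transpose_mat A $$ (i, j) = 1"
    by (intro exI[of _ j] conjI exI[of _ i]) auto
next
  show "transpose_mat A $$ (i, j) \<le> 1" if "i < dim_col A" "j < dim_row A" for i j
    using assms that by (simp add: fuzzy_grid_def)
  show "fuzzy_blocks t (dim_col A) \<gamma>" "fuzzy_blocks t (dim_row A) \<rho>"
    using assms by (simp_all add: fuzzy_grid_def)
qed

lemma fuzzy_grid_transpose: "fuzzy_grid t (transpose_mat A) \<gamma> \<rho> \<longleftrightarrow> fuzzy_grid t A \<rho> \<gamma>"
  using fuzzy_grid_transposeI[of t A \<rho> \<gamma>] fuzzy_grid_transposeI[of t "transpose_mat A" \<gamma> \<rho>]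
  by (simp only: transpose_transpose) blast

lemma identify_cols_transpose:
  "identify_cols j A = transpose_mat (identify_rows j (transpose_mat A))"
  by (rule eq_matI) (auto simp: identify_cols_def identify_rows_def)

lemma row_ones_transpose: "i < dim_col A \<Longrightarrow> row_ones (transpose_mat A) i = col_ones A i"
  unfolding row_ones_def col_ones_def by (auto intro!: arg_cong[of _ _ card])

definition merged :: "nat \<Rightarrow> (nat \<Rightarrow> 'b set) \<Rightarrow> nat \<Rightarrow> 'b set" where
  "merged i \<rho> k = (if k < i then \<rho> k else if k = i then \<rho> i \<union> \<rho> (Suc i) else \<rho> (Suc k))"

lemma merged_sorted:
  fixes \<rho> :: "nat \<Rightarrow> nat set"
  assumes "fuzzy_blocks t n \<rho>" "Suc i < n" "k < k'" "k' < n - 1" "a \<in> merged i \<rho> k" "a' \<in> merged i \<rho> k'"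
  shows "a \<le> a'"
proof -
  have *: "b \<le> b'" if "l < l'" "l' < n" "b \<in> \<rho> l" "b' \<in> \<rho> l'" for l l' b b'
    using assms(1) that by (auto simp: fuzzy_blocks_def)
  obtain l where l: "a \<in> \<rho> l" "l = k \<or> l = Suc k" "k < i \<Longrightarrow> l = k" "i < k \<Longrightarrow> l = Suc k"
    using assms(5) by (auto simp: merged_def split: if_splits)
  obtain l' where l': "a' \<in> \<rho> l'" "l' = k' \<or> l' = Suc k'" "k' < i \<Longrightarrow> l' = k'" "i < k' \<Longrightarrow> l' = Suc k'"
    using assms(6) by (auto simp: merged_def split: if_splits)
  have "l < l'" "l' < n"
    using l(2-4) l'(2-4) assms(2-4) by (cases "k < i"; cases "k' > i"; auto)+
  then show ?thesis
    using * l(1) l'(1) by blast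
qed

lemma three_elements:
  fixes S :: "nat set"
  assumes "finite S" "2 < card S"
  obtains a b c where "a < b" "b < c" "a \<in> S" "b \<in> S" "c \<in> S"
proof -
  have "S \<noteq> {}"
    using assms by auto
  let ?a = "Min S" and ?c = "Max S"
  have "card {?a, ?c} \<le> 2"
    by (simp add: card_insert_if)
  then have "\<not> S \<subseteq> {?a, ?c}"
    using assms(2) card_mono[of "{?a, ?c}" S] by auto
  then obtain b where b: "b \<in> S" "b \<noteq> ?a" "b \<noteq> ?c"
    by blast
  show thesis
  proof (rule that[of ?a b ?c])
    show "?a < b" "b < ?c"
      using b assms(1) by (simp_all add: order.not_eq_order_implies_strict)
  qed (use b assms(1) \<open>S \<noteq> {}\<close> in auto)
qed

text \<open>The heart of the lower bound. If the new row still meets at most two blocks, the grid persists. Otherwise it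
meets blocks \<open>a < b < c\<close>, and no other row meets \<open>b\<close>. Each of the
\<open>t\<close> cells in row block \<open>b\<close> then has its \<open>1\<close> in the new row, and a
column serves at most two of these cells.\<close>

lemma fuzzy_grid_identify_rows:
  assumes grid: "fuzzy_grid t A \<rho> \<gamma>" and i: "Suc i < dim_row A"
  defines "B \<equiv> identify_rows i A"
  shows "fuzzy_grid t B (merged i \<rho>) \<gamma> \<or> t \<le> 2 * row_ones B i"
proof -
  have dims: "dim_row B = dim_row A - 1" "dim_col B = dim_col A"
    by (simp_all add: B_def identify_rows_def)
  have bin: "A $$ (k, j) \<le> 1" if "k < dim_row A" "j < dim_col A" for k j
    using grid that by (simp add: fuzzy_grid_def)
  have \<rho>: "fuzzy_blocks t (dim_row A) \<rho>" and \<gamma>: "fuzzy_blocks t (dim_col A) \<gamma>"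
    using grid by (auto simp: fuzzy_grid_def)
  have cover: "\<exists>k<dim_row B. \<exists>j<dim_col B. a \<in> merged i \<rho> k \<and> b \<in> \<gamma> j \<and> B $$ (k, j) = 1"
    if "a < t" "b < t" for a b
  proof -
    from grid that obtain k j where kj: "k < dim_row A" "j < dim_col A" "a \<in> \<rho> k" "b \<in> \<gamma> j" "A $$ (k, j) = 1"
      unfolding fuzzy_grid_def by blast
    \<comment> \<open>Row \<open>k\<close> of \<open>A\<close> becomes row \<open>k'\<close> of \<open>B\<close>.\<close>
    define k' where "k' = (if k \<le> i then k else k - 1)"
    have "k' < dim_row B" "a \<in> merged i \<rho> k'"
      using kj i by (auto simp: k'_def dims merged_def)
    moreover have "B $$ (k', j) = 1"
    proof (cases "k \<le> i")
      case True
      then show ?thesis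
        using kj i bin[of i j] bin[of "Suc i" j]
        by (cases "k = i") (auto simp: B_def identify_rows_def k'_def)
    next
      case False
      then show ?thesis
        using kj i bin[of i j] bin[of "Suc i" j]
        by (cases "k = Suc i") (auto simp: B_def identify_rows_def k'_def)
    qed
    ultimately show ?thesis
      using kj dims by auto
  qed
  have sub: "merged i \<rho> k \<subseteq> {..<t}" if "k < dim_row B" for k
  proof -
    have "\<rho> l \<subseteq> {..<t}" if "l < dim_row A" for l
      using \<rho> that by (simp add: fuzzy_blocks_def)
    from this[of k] this[of i] this[of "Suc k"] this[of "Suc i"] that i show ?thesis
      by (simp add: merged_def dims)
  qed
  show ?thesis
  proof (cases "card (merged i \<rho> i) \<le> 2")
    case True
    have "card (merged i \<rho> k) \<le> 2" if "k < dim_row B" for k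
    proof -
      have "card (\<rho> l) \<le> 2" if "l < dim_row A" for l
        using \<rho> that by (simp add: fuzzy_blocks_def)
      from this[of k] this[of "Suc k"] that True show ?thesis
        by (cases k i rule: linorder_cases) (simp_all add: merged_def dims)
    qed
    moreover have "a \<le> a'" if "k < k'" "k' < dim_row B" "a \<in> merged i \<rho> k" "a' \<in> merged i \<rho> k'" for k k' a a'
      using merged_sorted[OF \<rho> i] that dims by metis
    ultimately have "fuzzy_blocks t (dim_row B) (merged i \<rho>)"
      using sub unfolding fuzzy_blocks_def[of t "dim_row B"] by blast
    moreover have "B $$ (k, j) \<le> 1" if "k < dim_row B" "j < dim_col B" for k j
    proof -
      have "B $$ (k, j) \<le> max (A $$ (k, j)) (A $$ (Suc k, j))"
        using that by (simp add: B_def identify_rows_def)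
      also have "\<dots> \<le> 1"
        using bin[of k j] bin[of "Suc k" j] that dims by simp
      finally show ?thesis .
    qed
    ultimately have "fuzzy_grid t B (merged i \<rho>) \<gamma>"
      using \<gamma> cover unfolding fuzzy_grid_def dims(2) by blast
    then show ?thesis ..
  next
    case False
    have iB: "i < dim_row B"
      using i dims by simp
    then have "finite (merged i \<rho> i)"
      using sub[OF iB] finite_subset by blast
    with False obtain a b c where abc: "a < b" "b < c" "a \<in> merged i \<rho> i" "b \<in> merged i \<rho> i" "c \<in> merged i \<rho> i"
      using three_elements by (metis not_le)
    let ?J = "{j. j < dim_col B \<and> B $$ (i, j) = 1}"
    have "{..<t} \<subseteq> (\<Union>j\<in>?J. \<gamma> j)"
    proof
      fix d assume "d \<in> {..<t}"
      then obtain k j where kj: "k < dim_row B" "j < dim_col B" "b \<in> merged i \<rho> k" "d \<in> \<gamma> j" "B $$ (k, j) = 1"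
        using cover[of b d] abc sub[OF iB] by auto
      have "\<not> k < i"
        using merged_sorted[OF \<rho> i, of k i b a] kj(3) abc iB by (auto simp: dims)
      moreover have "\<not> i < k"
        using merged_sorted[OF \<rho> i, of i k c b] kj(1,3) abc by (auto simp: dims)
      ultimately have "k = i"
        by simp
      then show "d \<in> (\<Union>j\<in>?J. \<gamma> j)"
        using kj by auto
    qed
    moreover have "\<gamma> j \<subseteq> {..<t}" "card (\<gamma> j) \<le> 2" if "j \<in> ?J" for j
      using \<gamma> that by (auto simp: fuzzy_blocks_def dims)
    moreover from this have "finite (\<Union>j\<in>?J. \<gamma> j)"
      by (meson finite_lessThan finite_subset UN_least)
    ultimately have "t \<le> card (\<Union>j\<in>?J. \<gamma> j)"
      using card_mono[of "\<Union>j\<in>?J. \<gamma> j" "{..<t}"] by simp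
    also have "\<dots> \<le> (\<Sum>j\<in>?J. card (\<gamma> j))"
      by (rule card_UN_le) simp
    also have "\<dots> \<le> (\<Sum>j\<in>?J. 2)"
      by (intro sum_mono) (use \<gamma> dims in \<open>auto simp: fuzzy_blocks_def\<close>)
    finally show ?thesis
      by (simp add: row_ones_def)
  qed
qed

lemma fuzzy_grid_identification:
  assumes grid: "fuzzy_grid t A \<rho> \<gamma>" and step: "identification A B"
  shows "(\<exists>\<rho>' \<gamma>'. fuzzy_grid t B \<rho>' \<gamma>') \<or> (\<exists>i<dim_row B. t \<le> 2 * row_ones B i)
    \<or> (\<exists>j<dim_col B. t \<le> 2 * col_ones B j)"
  using step unfolding identification_def
proof (elim disjE exE conjE)
  fix i assume "Suc i < dim_row A" "B = identify_rows i A"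
  moreover from this have "i < dim_row B"
    by (simp add: identify_rows_def)
  ultimately show ?thesis
    using fuzzy_grid_identify_rows[OF grid, of i] by blast
next
  fix j assume j: "Suc j < dim_col A" and B: "B = identify_cols j A"
  let ?B = "identify_rows j (transpose_mat A)"
  have "j < dim_row ?B"
    using j by (simp add: identify_rows_def)
  moreover have "fuzzy_grid t ?B (merged j \<gamma>) \<rho> \<or> t \<le> 2 * row_ones ?B j"
    using grid j by (intro fuzzy_grid_identify_rows) (auto simp: fuzzy_grid_transpose)
  moreover have "B = transpose_mat ?B"
    using B identify_cols_transpose by simp
  ultimately show ?thesis
    by (metis fuzzy_grid_transpose index_transpose_mat(3) row_ones_transpose transpose_transpose)
qed

text \<open>The grid cannot persist up to the end of the sequence, because the single row of the last matrix would meet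
all \<open>t \<ge> 3\<close> blocks.\<close>

lemma fuzzy_grid_wide_term:
  assumes "As \<noteq> []" "successively identification As" "last As \<in> carrier_mat 1 1"
    "fuzzy_grid t (hd As) \<rho> \<gamma>" "3 \<le> t"
  shows "\<exists>B\<in>set As. (\<exists>i<dim_row B. t \<le> 2 * row_ones B i) \<or> (\<exists>j<dim_col B. t \<le> 2 * col_ones B j)"
  using assms
proof (induction As arbitrary: \<rho> \<gamma> rule: list_nonempty_induct)
  case (single A)
  then have A: "dim_row A = 1" "dim_col A = 1"
    by auto
  have "{..<t} \<subseteq> \<rho> 0"
    using single(3) A by (auto simp: fuzzy_grid_def)
  moreover have "finite (\<rho> 0)" "card (\<rho> 0) \<le> 2"
    using single(3) A by (auto simp: fuzzy_grid_def fuzzy_blocks_def intro: finite_subset)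
  ultimately show ?case
    using card_mono[of "\<rho> 0" "{..<t}"] single(4) by simp
next
  case (cons A As)
  then have step: "identification A (hd As)" "successively identification As"
    by (cases As; simp)+
  have "hd As \<in> set As"
    using cons(1) by simp
  consider \<rho>' \<gamma>' where "fuzzy_grid t (hd As) \<rho>' \<gamma>'" | "\<exists>i<dim_row (hd As). t \<le> 2 * row_ones (hd As) i"
    | "\<exists>j<dim_col (hd As). t \<le> 2 * col_ones (hd As) j"
    using fuzzy_grid_identification[OF _ step(1)] cons.prems by (metis list.sel(1))
  then show ?case
  proof cases
    case 1
    then show ?thesis
      using cons step by (metis last_ConsR list.set_intros(2))
  qed (use \<open>hd As \<in> set As\<close> in auto)
qed

lemma fuzzy_grid_stww_mat:
  assumes "fuzzy_grid (2 * k) A \<rho> \<gamma>" "2 \<le> k"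
  shows "enat k \<le> stww_mat A"
  unfolding stww_mat_def
proof (rule INF_greatest)
  fix As assume "As \<in> {As. contraction_sequence A As}"
  then obtain B where B: "B \<in> set As"
    "(\<exists>i<dim_row B. 2 * k \<le> 2 * row_ones B i) \<or> (\<exists>j<dim_col B. 2 * k \<le> 2 * col_ones B j)"
    using fuzzy_grid_wide_term[of As "2 * k" \<rho> \<gamma>] assms by (auto simp: contraction_sequence_def)
  let ?W = "\<Union>A\<in>set As. row_ones A ` {..<dim_row A} \<union> col_ones A ` {..<dim_col A}"
  obtain w where "w \<in> ?W" "2 * k \<le> 2 * w"
    using B by fastforce
  moreover have "finite ?W"
    by auto
  ultimately have "w \<le> width As"
    unfolding width_def by (rule_tac Max_ge)
  with \<open>2 * k \<le> 2 * w\<close> show "enat k \<le> enat (width As)"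
    using assms by simp
qed

lemma div_blocks_fuzzy: "fuzzy_blocks t n (\<lambda>i. {i div s} \<inter> {..<t})"
proof -
  have "card ({i div s} \<inter> {..<t}) \<le> 2" for i
    by (rule order_trans[OF card_mono[of "{i div s}"]]) auto
  then show ?thesis
    by (auto simp: fuzzy_blocks_def div_le_mono)
qed

text \<open>The grid criterion for a permutation and an arbitrary order on a finite set: the blocks depend on the order
only, and any map that sends some element of each block into each block has large strict twin-width. Blocks
have equal size, and the elements left over after division by the number of blocks belong to none.\<close>

theorem stww_mat_grid:
  assumes r: "linear_order_on X r" and S: "finite S" "S \<subseteq> X" and k: "2 \<le> k" "2 * k \<le> card S"
  obtains I :: "nat \<Rightarrow> 'a set" and s where
    "\<And>i. i < 2 * k \<Longrightarrow> I i \<subseteq> S" "\<And>i. i < 2 * k \<Longrightarrow> card (I i) = s"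
    "0 < s" "card S \<le> 2 * (2 * k) * s"
    "\<And>\<sigma>. (\<And>i j. i < 2 * k \<Longrightarrow> j < 2 * k \<Longrightarrow> \<exists>x\<in>I i. \<sigma> x \<in> I j)
       \<Longrightarrow> enat k \<le> stww_mat (finite_mat r S r S (perm_mat \<sigma>))"
proof -
  define t where "t = 2 * k"
  define s where "s = card S div t"
  define xs where "xs = ordered_list r S"
  define I where "I i = (!) xs ` {i * s..<Suc i * s}" for i
  have t: "0 < t" "t \<le> card S"
    using k by (auto simp: t_def)
  have s: "0 < s"
    using t by (simp add: s_def div_greater_zero_iff)
  have "card S < t * Suc s"
    using dividend_less_times_div[OF t(1), of "card S"] by (simp add: s_def)
  \<comment> \<open>The number of elements outside all blocks is less than \<open>t\<close>, hence at most \<open>t * s\<close>.\<close>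
  then have size: "card S \<le> 2 * t * s"
    using s by (cases s) auto
  have xs: "set xs = S" "distinct xs" "length xs = card S"
    using ordered_list[OF r S] by (simp_all add: xs_def)
  have bound: "Suc i * s \<le> length xs" if "i < t" for i
  proof -
    have "Suc i * s \<le> t * s"
      using that by (intro mult_le_mono1) simp
    also have "\<dots> \<le> card S"
      by (simp add: s_def)
    finally show ?thesis
      by (simp add: xs)
  qed
  have I: "I i \<subseteq> S" "card (I i) = s" if "i < t" for i
  proof -
    show "I i \<subseteq> S"
      using bound[OF that] xs(1) by (force simp: I_def)
    have "inj_on ((!) xs) {i * s..<Suc i * s}"
      using bound[OF that] xs(2) by (intro inj_on_nth) auto
    then show "card (I i) = s"
      by (simp add: I_def card_image)
  qed
  have block: "i * s \<le> k \<and> k < Suc i * s \<Longrightarrow> k div s = i" for i k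
    using s by (metis div_nat_eqI mult.commute)
  show thesis
  proof (rule that[of I s])
    fix \<sigma> assume *: "\<And>i j. i < 2 * k \<Longrightarrow> j < 2 * k \<Longrightarrow> \<exists>x\<in>I i. \<sigma> x \<in> I j"
    let ?A = "finite_mat r S r S (perm_mat \<sigma>)" and ?\<rho> = "\<lambda>i. {i div s} \<inter> {..<t}"
    have dims: "dim_row ?A = card S" "dim_col ?A = card S"
      by (simp_all add: finite_mat_def)
    have entry: "?A $$ (i, j) = perm_mat \<sigma> (xs ! i) (xs ! j)" if "i < card S" "j < card S" for i j
      using that by (simp add: finite_mat_def xs_def)
    have cover: "\<exists>i<card S. \<exists>j<card S. a \<in> ?\<rho> i \<and> b \<in> ?\<rho> j \<and> ?A $$ (i, j) = 1" if "a < t" "b < t" for a b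
    proof -
      from * that obtain x where x: "x \<in> I a" "\<sigma> x \<in> I b"
        unfolding t_def by blast
      then obtain i j where ij: "a * s \<le> i \<and> i < Suc a * s" "x = xs ! i" "b * s \<le> j \<and> j < Suc b * s" "\<sigma> x = xs ! j"
        unfolding I_def by auto
      moreover have "i < card S" "j < card S"
        using ij bound[OF that(1)] bound[OF that(2)] xs(3) by auto
      moreover have "i div s = a" "j div s = b"
        using ij block by auto
      ultimately show ?thesis
        using that entry by (intro exI[of _ i] exI[of _ j] conjI) (auto simp: perm_mat_def)
    qed
    have "fuzzy_grid t ?A ?\<rho> ?\<rho>"
      unfolding fuzzy_grid_def dims
      using cover by (auto simp: entry perm_mat_def div_blocks_fuzzy)
    then show "enat k \<le> stww_mat ?A"
      unfolding t_def using k(1) by (rule fuzzy_grid_stww_mat)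
  qed (use I s size in \<open>auto simp: t_def\<close>)
qed


section \<open>Quasirandomness of groups with unipotents and a torus\<close>

definition add_char :: "nat \<Rightarrow> int \<Rightarrow> complex" where
  "add_char p x = cis (2 * pi * of_int x / of_nat p)"

lemma add_char_add: "add_char p (x + y) = add_char p x * add_char p y"
  by (simp add: add_char_def cis_mult add_divide_distrib ring_distribs)

lemma add_char_0 [simp]: "add_char p 0 = 1"
  by (simp add: add_char_def)

lemma cnj_add_char: "cnj (add_char p x) = add_char p (- x)"
  by (simp add: add_char_def cis_cnj)

lemma norm_add_char [simp]: "cmod (add_char p x) = 1"
  by (simp add: add_char_def)

lemma add_char_eq_1_iff:
  assumes "p > 0"
  shows "add_char p x = 1 \<longleftrightarrow> int p dvd x"
proof
  assume "add_char p x = 1"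
  then have "cos (2 * pi * of_int x / of_nat p) = 1"
    by (simp add: add_char_def complex_eq_iff)
  then obtain n :: int where "2 * pi * of_int x / of_nat p = of_int n * 2 * pi"
    unfolding cos_one_2pi_int ..
  then have "2 * pi * (of_int x - of_int n * of_nat p) = 0"
    using assms by (simp add: divide_eq_eq algebra_simps)
  then have "(of_int x :: real) = of_int (n * int p)"
    by simp
  then have "x = n * int p"
    by (simp only: of_int_eq_iff)
  then show "int p dvd x"
    by simp
next
  assume "int p dvd x"
  then obtain n where "x = int p * n" ..
  then have "2 * pi * of_int x / of_nat p = 2 * pi * (of_int n :: real)"
    using assms by simp
  then show "add_char p x = 1"
    by (simp add: add_char_def cis_multiple_2pi)
qed

text \<open>Sums over \<open>\<int> / p\<close> are written as sums of periodic functions over the representatives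
\<open>{0..<p}\<close>.\<close>

lemma sum_periodic_shift:
  fixes F :: "int \<Rightarrow> 'b::comm_monoid_add"
  assumes "p > 0" and per: "\<And>a. F (a mod int p) = F a"
  shows "(\<Sum>a\<in>{0..<int p}. F (a + b)) = (\<Sum>a\<in>{0..<int p}. F a)"
proof (rule sum.reindex_bij_witness[of _ "\<lambda>a. (a - b) mod int p" "\<lambda>a. (a + b) mod int p"])
  show "((a + b) mod int p - b) mod int p = a" if "a \<in> {0..<int p}" for a
    using that by (simp add: mod_diff_left_eq)
  show "((a - b) mod int p + b) mod int p = a" if "a \<in> {0..<int p}" for a
    using that by (simp add: mod_add_left_eq)
qed (use assms in auto)

lemma sum_add_char:
  assumes "p > 0"
  shows "(\<Sum>k\<in>{0..<int p}. add_char p (k * b)) = (if int p dvd b then of_nat p else 0)"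
proof (cases "int p dvd b")
  case True
  then have "add_char p (k * b) = 1" for k
    by (simp add: add_char_eq_1_iff[OF assms])
  with True show ?thesis
    by simp
next
  case False
  let ?S = "\<Sum>k\<in>{0..<int p}. add_char p (k * b)"
  have per: "add_char p (a mod int p * b) = add_char p (a * b)" for a
  proof -
    have "add_char p ((a div int p * b) * int p) = 1"
      using assms by (simp add: add_char_eq_1_iff)
    moreover have "a * b = (a div int p * b) * int p + a mod int p * b"
      by (metis div_mult_mod_eq distrib_right mult.assoc mult.commute)
    ultimately show ?thesis
      by (simp add: add_char_add)
  qed
  have "add_char p b * ?S = (\<Sum>k\<in>{0..<int p}. add_char p ((k + 1) * b))"
    by (simp add: sum_distrib_left ring_distribs add_char_add mult.commute)
  also have "\<dots> = ?S"
    by (rule sum_periodic_shift[OF assms, where F = "\<lambda>a. add_char p (a * b)"]) (rule per)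
  finally have "(add_char p b - 1) * ?S = 0"
    by (simp add: algebra_simps)
  with False assms show ?thesis
    by (simp add: add_char_eq_1_iff)
qed

lemma norm_square_complex: "(complex_of_real (cmod z))\<^sup>2 = z * cnj z"
  by (metis complex_norm_square of_real_power)

lemma parseval:
  assumes "p > 0"
  shows "(\<Sum>k\<in>{0..<int p}. (cmod (\<Sum>a\<in>{0..<int p}. add_char p (- (k * a)) * F a))\<^sup>2)
       = p * (\<Sum>a\<in>{0..<int p}. (cmod (F a))\<^sup>2)" (is "?L = ?R")
proof -
  let ?P = "{0..<int p}"
  have "complex_of_real ?L = (\<Sum>k\<in>?P. (\<Sum>a\<in>?P. add_char p (- (k * a)) * F a)
           * (\<Sum>b\<in>?P. add_char p (k * b) * cnj (F b)))"
  proof -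
    have "cnj (\<Sum>a\<in>?P. add_char p (- (k * a)) * F a)
        = (\<Sum>b\<in>?P. add_char p (k * b) * cnj (F b))" for k
      by (simp only: cnj_sum complex_cnj_mult cnj_add_char minus_minus)
    then show ?thesis
      by (simp only: of_real_sum complex_norm_square)
  qed
  also have "\<dots> = (\<Sum>k\<in>?P. \<Sum>a\<in>?P. \<Sum>b\<in>?P. add_char p (k * (b - a)) * (F a * cnj (F b)))"
  proof -
    have "add_char p (k * (b - a)) = add_char p (- (k * a)) * add_char p (k * b)" for k a b
      by (simp flip: add_char_add add: algebra_simps)
    then show ?thesis
      by (simp add: sum_product mult_ac)
  qed
  also have "\<dots> = (\<Sum>a\<in>?P. \<Sum>b\<in>?P. \<Sum>k\<in>?P. add_char p (k * (b - a)) * (F a * cnj (F b)))"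
    by (subst sum.swap, rule sum.cong[OF refl], subst sum.swap) (rule refl)
  also have "\<dots> = (\<Sum>a\<in>?P. \<Sum>b\<in>?P. if a = b then of_nat p * (F a * cnj (F b)) else 0)"
  proof (intro sum.cong refl)
    fix a b assume "a \<in> ?P" "b \<in> ?P"
    then have "\<bar>b - a\<bar> < int p"
      by auto
    then have "int p dvd b - a \<longleftrightarrow> a = b"
      using dvd_imp_le_int[of "b - a" "int p"] by auto
    then show "(\<Sum>k\<in>?P. add_char p (k * (b - a)) * (F a * cnj (F b)))
        = (if a = b then of_nat p * (F a * cnj (F b)) else 0)"
      by (simp flip: sum_distrib_right add: sum_add_char[OF assms])
  qed
  also have "\<dots> = of_real ?R"
    by (simp add: sum_distrib_left norm_square_complex)
  finally show ?thesis
    by (simp only: of_real_eq_iff)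
qed

lemma bessel_orthogonal:
  fixes e :: "'i \<Rightarrow> 'b \<Rightarrow> complex" and h :: "'b \<Rightarrow> real"
  assumes fin: "finite I" "finite X" and "M \<ge> 0"
    and orth: "\<And>i j. i \<in> I \<Longrightarrow> j \<in> I \<Longrightarrow> i \<noteq> j \<Longrightarrow> (\<Sum>x\<in>X. e i x * cnj (e j x)) = 0"
    and norm: "\<And>i. i \<in> I \<Longrightarrow> (\<Sum>x\<in>X. (cmod (e i x))\<^sup>2) = M"
  shows "(\<Sum>i\<in>I. (cmod (\<Sum>x\<in>X. e i x * h x))\<^sup>2) \<le> M * (\<Sum>x\<in>X. (h x)\<^sup>2)"
proof (cases "I = {} \<or> M = 0")
  case True
  have "e i x = 0" if "i \<in> I" "M = 0" "x \<in> X" for i x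
  proof -
    have "\<forall>x\<in>X. (cmod (e i x))\<^sup>2 = 0"
      using norm[OF that(1)] that(2) fin by (subst sum_nonneg_eq_0_iff[symmetric]) auto
    with that show ?thesis
      by simp
  qed
  then have "(\<Sum>i\<in>I. (cmod (\<Sum>x\<in>X. e i x * h x))\<^sup>2) = 0" if "I \<noteq> {}"
    using that True by (intro sum.neutral ballI) simp
  with True \<open>M \<ge> 0\<close> show ?thesis
    by (cases "I = {}") (auto simp: sum_nonneg)
next
  case False
  with \<open>M \<ge> 0\<close> have M: "M > 0" by simp
  define c where "c i = (\<Sum>x\<in>X. e i x * h x)" for i
  define r where "r x = h x - (\<Sum>i\<in>I. cnj (c i) * e i x) / M" for x
  have ee: "(\<Sum>x\<in>X. e i x * cnj (e j x)) = (if i = j then of_real M else 0)" if "i \<in> I" "j \<in> I" for i j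
  proof (cases "i = j")
    case True
    then show ?thesis
      using norm[OF that(1)] by (simp add: complex_norm_square[symmetric] flip: of_real_sum of_real_power)
  qed (use orth that in auto)
  have "0 \<le> (\<Sum>x\<in>X. (cmod (r x))\<^sup>2)"
    by (simp add: sum_nonneg)
  also have "(\<Sum>x\<in>X. (cmod (r x))\<^sup>2) = (\<Sum>x\<in>X. (h x)\<^sup>2) - (\<Sum>i\<in>I. (cmod (c i))\<^sup>2) / M" 
  proof -
    let ?q = "\<lambda>x. \<Sum>i\<in>I. cnj (c i) * e i x"
    have 1: "(\<Sum>x\<in>X. h x * ?q x) = (\<Sum>i\<in>I. (cmod (c i))\<^sup>2)"
    proof -
      have "(\<Sum>x\<in>X. h x * ?q x) = (\<Sum>i\<in>I. \<Sum>x\<in>X. cnj (c i) * (e i x * h x))"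
        by (subst sum.swap) (simp add: sum_distrib_left mult_ac)
      also have "\<dots> = (\<Sum>i\<in>I. cnj (c i) * c i)"
        by (simp add: sum_distrib_left c_def)
      finally show ?thesis
        by (simp add: norm_square_complex mult.commute)
    qed
    have 2: "(\<Sum>x\<in>X. h x * cnj (?q x)) = (\<Sum>i\<in>I. (cmod (c i))\<^sup>2)"
    proof -
      have "(\<Sum>x\<in>X. h x * cnj (?q x)) = cnj (\<Sum>x\<in>X. h x * ?q x)"
        by simp
      also have "\<dots> = cnj (complex_of_real (\<Sum>i\<in>I. (cmod (c i))\<^sup>2))"
        by (simp only: 1)
      finally show ?thesis
        by (simp only: complex_cnj_complex_of_real)
    qed
    have 3: "(\<Sum>x\<in>X. ?q x * cnj (?q x)) = M * (\<Sum>i\<in>I. (cmod (c i))\<^sup>2)"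
    proof -
      have "(\<Sum>x\<in>X. ?q x * cnj (?q x))
          = (\<Sum>x\<in>X. \<Sum>i\<in>I. \<Sum>j\<in>I. cnj (c i) * c j * (e i x * cnj (e j x)))"
        unfolding cnj_sum sum_product by (simp add: mult_ac)
      also have "\<dots> = (\<Sum>i\<in>I. \<Sum>j\<in>I. \<Sum>x\<in>X. cnj (c i) * c j * (e i x * cnj (e j x)))"
        by (subst sum.swap, rule sum.cong[OF refl], subst sum.swap) (rule refl)
      also have "\<dots> = (\<Sum>i\<in>I. \<Sum>j\<in>I. if i = j then M * (cnj (c i) * c j) else 0)"
        by (intro sum.cong refl) (simp flip: sum_distrib_left add: ee)
      also have "\<dots> = M * (\<Sum>i\<in>I. (cmod (c i))\<^sup>2)"
        using fin by (simp add: sum_distrib_left norm_square_complex mult_ac)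
      finally show ?thesis .
    qed
    have "complex_of_real (\<Sum>x\<in>X. (cmod (r x))\<^sup>2) = (\<Sum>x\<in>X. (h x)\<^sup>2 - h x * ?q x / M
        - h x * cnj (?q x) / M + ?q x * cnj (?q x) / (M * M))"
      unfolding of_real_sum complex_norm_square
      by (intro sum.cong refl) (simp add: r_def algebra_simps power2_eq_square)
    also have "\<dots> = (\<Sum>x\<in>X. (h x)\<^sup>2) - (\<Sum>i\<in>I. (cmod (c i))\<^sup>2) / M"
      unfolding sum.distrib sum_subtractf sum_divide_distrib[symmetric] 1 2 3
      using M by (simp add: field_simps)
    finally show ?thesis
      by (simp only: of_real_eq_iff flip: of_real_divide of_real_diff)
  qed
  finally show ?thesis
    using M by (simp add: c_def field_simps)
qed

context group
begin

lemma sum_translate: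
  assumes "y \<in> carrier G"
  shows "(\<Sum>x\<in>carrier G. f (x \<otimes> y)) = (\<Sum>x\<in>carrier G. f x)"
  by (rule sum.reindex_bij_witness[of _ "\<lambda>x. x \<otimes> inv y" "\<lambda>x. x \<otimes> y"])
     (use assms in \<open>auto simp: m_assoc\<close>)

lemma sum_left_translate:
  assumes "y \<in> carrier G"
  shows "(\<Sum>x\<in>carrier G. f (y \<otimes> x)) = (\<Sum>x\<in>carrier G. f x)"
  by (rule sum.reindex_bij_witness[of _ "\<lambda>x. inv y \<otimes> x" "\<lambda>x. y \<otimes> x"])
     (use assms in \<open>auto simp: m_assoc[symmetric]\<close>)

text \<open>\<open>correlation B f g\<close> is the scalar product of \<open>f\<close> with the indicator of the right
translate of \<open>B\<close> by the inverse of \<open>g\<close>. For the indicator of a set \<open>A\<close>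
it counts the \<open>x \<in> A\<close> with \<open>x g \<in> B\<close>.\<close>

definition correlation :: "'a set \<Rightarrow> ('a \<Rightarrow> complex) \<Rightarrow> 'a \<Rightarrow> complex" where
  "correlation B f g = (\<Sum>x\<in>carrier G. f x * complex_of_real (of_bool (x \<otimes> g \<in> B)))"

text \<open>Translating the function permutes the values of its correlation, so all translates of \<open>f\<close> have
the same mean square correlation with \<open>B\<close>.\<close>

lemma correlation_translate:
  assumes "y \<in> carrier G" "g \<in> carrier G"
  shows "correlation B (\<lambda>x. f (x \<otimes> y)) g = correlation B f (inv y \<otimes> g)"
proof -
  let ?b = "\<lambda>x. complex_of_real (of_bool (x \<in> B))"
  have "(x \<otimes> y) \<otimes> (inv y \<otimes> g) = x \<otimes> g" if "x \<in> carrier G" for x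
  proof -
    have "y \<otimes> (inv y \<otimes> g) = g"
      using assms by (simp flip: m_assoc)
    with that show ?thesis
      using assms by (simp add: m_assoc)
  qed
  then have "correlation B (\<lambda>x. f (x \<otimes> y)) g
      = (\<Sum>x\<in>carrier G. f (x \<otimes> y) * ?b ((x \<otimes> y) \<otimes> (inv y \<otimes> g)))"
    unfolding correlation_def by (intro sum.cong refl) simp
  also have "\<dots> = correlation B f (inv y \<otimes> g)"
    unfolding correlation_def
    by (rule sum_translate[OF assms(1), where f = "\<lambda>x. f x * ?b (x \<otimes> (inv y \<otimes> g))"])
  finally show ?thesis .
qed

lemma card_translate_mem:
  assumes "finite (carrier G)" "B \<subseteq> carrier G" "g \<in> carrier G"
  shows "(\<Sum>x\<in>carrier G. (of_bool (x \<otimes> g \<in> B) :: real)\<^sup>2) = card B"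
proof -
  have "(\<Sum>x\<in>carrier G. (of_bool (x \<otimes> g \<in> B) :: real)\<^sup>2) = (\<Sum>x\<in>carrier G. (of_bool (x \<in> B))\<^sup>2)"
    by (rule sum_translate[OF assms(3)])
  also have "\<dots> = (\<Sum>x\<in>carrier G. of_bool (x \<in> B))"
    by (intro sum.cong refl) (simp add: of_bool_def)
  also have "\<dots> = card B"
    using assms by (simp add: sum.If_cases of_bool_def Int_absorb1)
  finally show ?thesis .
qed

end

text \<open>A one-parameter subgroup \<open>u\<close> and part of a torus that normalises it, as the unipotent upper
triangular and the diagonal matrices in \<open>SL(2, p)\<close>. Only half of the torus is listed, since
\<open>t s\<close> acts on \<open>u\<close> through the square of \<open>s\<close>; this keeps the squares
distinct modulo \<open>p\<close>.\<close>

locale one_parameter_torus = group +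
  fixes p D :: nat and u :: "int \<Rightarrow> 'a" and t :: "nat \<Rightarrow> 'a"
  assumes finite_carrier: "finite (carrier G)"
    and prime_p: "prime p" and D_less: "2 * D < p"
    and u_closed [simp]: "u a \<in> carrier G"
    and u_add: "u (a + b) = u a \<otimes> u b"
    and u_mod: "u (a mod int p) = u a"
    and t_closed [simp]: "s \<in> {1..D} \<Longrightarrow> t s \<in> carrier G"
    and t_u: "s \<in> {1..D} \<Longrightarrow> t s \<otimes> u a = u (int s ^ 2 * a) \<otimes> t s"
begin

lemma p_pos: "p > 0"
  using prime_p prime_gt_0_nat by blast

lemma squares_distinct:
  assumes "s \<in> {1..D}" "s' \<in> {1..D}" "s \<noteq> s'" "\<not> int p dvd k"
  shows "\<not> int p dvd k * (int s' ^ 2 - int s ^ 2)"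
proof
  assume "int p dvd k * (int s' ^ 2 - int s ^ 2)"
  moreover have "int s' ^ 2 - int s ^ 2 = (int s' - int s) * (int s' + int s)"
    by (simp add: power2_eq_square algebra_simps)
  moreover have "prime (int p)"
    using prime_p by simp
  ultimately have "int p dvd int s' - int s \<or> int p dvd int s' + int s"
    using assms(4) by (simp add: prime_dvd_mult_iff)
  then show False
    using assms(1-3) D_less
      dvd_imp_le_int[of "int s' - int s" "int p"] dvd_imp_le_int[of "int s' + int s" "int p"]
    by auto
qed

text \<open>The functions \<open>x \<mapsto> f (x (t s))\<close> are eigenfunctions of \<open>u\<close> for distinct
characters, hence pairwise orthogonal, and they all have the norm and the mean square correlation of
\<open>f\<close>. Bessel's inequality controls the sum of these \<open>D\<close> equal terms.\<close>

lemma correlation_eigenfunction: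
  assumes B: "B \<subseteq> carrier G" and k: "\<not> int p dvd k"
    and eigen: "\<And>x a. x \<in> carrier G \<Longrightarrow> f (x \<otimes> u a) = add_char p (k * a) * f x"
  shows "D * (\<Sum>g\<in>carrier G. (cmod (correlation B f g))\<^sup>2)
       \<le> card (carrier G) * card B * (\<Sum>x\<in>carrier G. (cmod (f x))\<^sup>2)"
proof -
  let ?C = "carrier G" and ?M = "\<Sum>x\<in>carrier G. (cmod (f x))\<^sup>2"
  let ?\<Phi> = "\<lambda>f. \<Sum>g\<in>?C. (cmod (correlation B f g))\<^sup>2"
  define e where "e s x = f (x \<otimes> t s)" for s x
  have e_eigen: "e s (x \<otimes> u (int s ^ 2 * a)) = add_char p (k * a) * e s x"
    if "s \<in> {1..D}" "x \<in> ?C" for s x a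
  proof -
    have "x \<otimes> u (int s ^ 2 * a) \<otimes> t s = x \<otimes> t s \<otimes> u a"
      using that by (simp add: m_assoc flip: t_u)
    with that show ?thesis
      by (simp add: e_def eigen)
  qed
  have orth: "(\<Sum>x\<in>?C. e s x * cnj (e s' x)) = 0"
    if "s \<in> {1..D}" "s' \<in> {1..D}" "s \<noteq> s'" for s s'
  proof -
    let ?S = "\<Sum>x\<in>?C. e s x * cnj (e s' x)" and ?y = "u (int s ^ 2 * int s' ^ 2)"
    \<comment> \<open>Translation by \<open>u (s\<^sup>2 s'\<^sup>2)\<close> multiplies the two functions by known, different characters without dividing by a square.\<close>
    have "?S = (\<Sum>x\<in>?C. e s (x \<otimes> ?y) * cnj (e s' (x \<otimes> ?y)))"
      by (rule sum_translate[symmetric, of _ "\<lambda>x. e s x * cnj (e s' x)"]) simp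
    also have "\<dots> = (\<Sum>x\<in>?C. add_char p (k * (int s' ^ 2 - int s ^ 2)) * (e s x * cnj (e s' x)))"
    proof (intro sum.cong refl)
      fix x assume "x \<in> ?C"
      have "e s' (x \<otimes> ?y) = add_char p (k * int s ^ 2) * e s' x"
        using e_eigen[OF that(2) \<open>x \<in> ?C\<close>, of "int s ^ 2"] by (simp add: mult.commute)
      moreover have "add_char p (k * int s' ^ 2) * cnj (add_char p (k * int s ^ 2))
          = add_char p (k * (int s' ^ 2 - int s ^ 2))"
        by (simp add: cnj_add_char right_diff_distrib flip: add_char_add)
      ultimately show "e s (x \<otimes> ?y) * cnj (e s' (x \<otimes> ?y))
          = add_char p (k * (int s' ^ 2 - int s ^ 2)) * (e s x * cnj (e s' x))"
        using e_eigen[OF that(1) \<open>x \<in> ?C\<close>, of "int s' ^ 2"] by (simp add: mult_ac)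
    qed
    also have "\<dots> = add_char p (k * (int s' ^ 2 - int s ^ 2)) * ?S"
      by (simp only: sum_distrib_left)
    finally have "(add_char p (k * (int s' ^ 2 - int s ^ 2)) - 1) * ?S = 0"
      by (simp only: left_diff_distrib) simp
    then show ?thesis
      using squares_distinct[OF that k] by (simp add: add_char_eq_1_iff[OF p_pos])
  qed
  have norm: "(\<Sum>x\<in>?C. (cmod (e s x))\<^sup>2) = ?M" if "s \<in> {1..D}" for s
    unfolding e_def using that by (intro sum_translate) simp
  have "?\<Phi> (e s) = ?\<Phi> f"
    if "s \<in> {1..D}" for s
  proof -
    have "?\<Phi> (e s)
        = (\<Sum>g\<in>?C. (cmod (correlation B f (inv (t s) \<otimes> g)))\<^sup>2)"
      unfolding e_def using that by (intro sum.cong refl) (simp add: correlation_translate)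
    also have "\<dots> = ?\<Phi> f"
      using that by (intro sum_left_translate) simp
    finally show ?thesis .
  qed
  then have "D * ?\<Phi> f
      = (\<Sum>s\<in>{1..D}. \<Sum>g\<in>?C. (cmod (correlation B (e s) g))\<^sup>2)"
    by simp
  also have "\<dots> = (\<Sum>g\<in>?C. \<Sum>s\<in>{1..D}. (cmod (correlation B (e s) g))\<^sup>2)"
    by (rule sum.swap)
  also have "\<dots> \<le> (\<Sum>g\<in>?C. ?M * card B)"
  proof (rule sum_mono)
    fix g assume "g \<in> ?C"
    have "(\<Sum>s\<in>{1..D}. (cmod (correlation B (e s) g))\<^sup>2)
        \<le> ?M * (\<Sum>x\<in>?C. (of_bool (x \<otimes> g \<in> B))\<^sup>2)"
      unfolding correlation_def
      by (rule bessel_orthogonal) (use finite_carrier orth norm in \<open>auto simp: sum_nonneg\<close>)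
    also have "\<dots> = ?M * card B"
      using card_translate_mem[OF finite_carrier B \<open>g \<in> ?C\<close>] by simp
    finally show "(\<Sum>s\<in>{1..D}. (cmod (correlation B (e s) g))\<^sup>2) \<le> ?M * card B" .
  qed
  finally show ?thesis
    by (simp add: mult_ac)
qed

text \<open>Decompose \<open>f\<close> into eigenfunctions \<open>f\<^sub>k\<close> of \<open>u\<close>. The difference of
\<open>f\<close> and its translate by \<open>u b\<close> has no component for the trivial character
\<open>k = 0\<close>, and the other components have small correlation by
\<open>correlation_eigenfunction\<close>. Parseval's identity is used twice: along the orbits of
\<open>u\<close> on the translating elements for the correlations, and on the cosets of \<open>u\<close> for
the norm of \<open>f\<close>.\<close>

lemma correlation_almost_invariant:
  assumes B: "B \<subseteq> carrier G"
  shows "D * (\<Sum>g\<in>carrier G. (cmod (correlation B f g - correlation B f (inv (u b) \<otimes> g)))\<^sup>2)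
       \<le> 4 * card (carrier G) * card B * (\<Sum>x\<in>carrier G. (cmod (f x))\<^sup>2)"
proof -
  let ?C = "carrier G" and ?P = "{0..<int p}" and ?\<chi> = "add_char p"
  let ?M = "\<Sum>x\<in>carrier G. (cmod (f x))\<^sup>2"
  \<comment> \<open>\<open>fk k\<close> is \<open>p\<close> times the component for the character \<open>k\<close>; \<open>F g\<close> has the correlations of the \<open>fk k\<close> as Fourier coefficients.\<close>
  define fk where "fk k x = (\<Sum>a\<in>?P. ?\<chi> (- (k * a)) * f (x \<otimes> u a))" for k x
  let ?\<Phi> = "\<lambda>k. \<Sum>g\<in>?C. (cmod (correlation B (fk k) g))\<^sup>2" and ?M' = "\<lambda>k. \<Sum>x\<in>?C. (cmod (fk k x))\<^sup>2"
  define F where "F g a = correlation B f (inv (u a) \<otimes> g)" for g a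
  have per: "?\<chi> (k * (a mod int p)) = ?\<chi> (k * a)" for k a
  proof -
    have "k * a = int p * (k * (a div int p)) + k * (a mod int p)"
      using mult_div_mod_eq[of "int p" a] by (metis distrib_left mult.left_commute)
    moreover have "?\<chi> (int p * (k * (a div int p))) = 1"
      using p_pos by (simp add: add_char_eq_1_iff)
    ultimately show ?thesis
      by (simp add: add_char_add)
  qed
  have dft_shift: "(\<Sum>a\<in>?P. ?\<chi> (- (k * a)) * H (a + b)) = ?\<chi> (k * b) * (\<Sum>a\<in>?P. ?\<chi> (- (k * a)) * H a)"
    if "\<And>a. H (a mod int p) = H a" for H :: "int \<Rightarrow> complex" and k b
  proof -
    have "- (k * a) = k * b + - (k * (a + b))" for a
      by (simp add: algebra_simps)
    then have "?\<chi> (- (k * a)) * H (a + b) = ?\<chi> (k * b) * (?\<chi> (- (k * (a + b))) * H (a + b))" for a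
      by (metis add_char_add mult.assoc)
    then have "(\<Sum>a\<in>?P. ?\<chi> (- (k * a)) * H (a + b))
        = ?\<chi> (k * b) * (\<Sum>a\<in>?P. ?\<chi> (- (k * (a + b))) * H (a + b))"
      unfolding sum_distrib_left by (rule sum.cong[OF refl])
    also have "(\<Sum>a\<in>?P. ?\<chi> (- (k * (a + b))) * H (a + b)) = (\<Sum>a\<in>?P. ?\<chi> (- (k * a)) * H a)"
      using per[of "-k"] that
      by (intro sum_periodic_shift[OF p_pos, where F = "\<lambda>a. ?\<chi> (- (k * a)) * H a"]) simp
    finally show ?thesis .
  qed
  have fk_eigen: "fk k (x \<otimes> u b) = ?\<chi> (k * b) * fk k x" if "x \<in> ?C" for k x b
  proof -
    have "fk k (x \<otimes> u b) = (\<Sum>a\<in>?P. ?\<chi> (- (k * a)) * f (x \<otimes> u (a + b)))"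
      unfolding fk_def using that by (simp add: m_assoc add.commute flip: u_add)
    also have "\<dots> = ?\<chi> (k * b) * fk k x"
      unfolding fk_def by (rule dft_shift) (simp add: u_mod)
    finally show ?thesis .
  qed
  have F_mod: "F g (a mod int p) = F g a" for g a
    by (simp add: F_def u_mod)
  have F_dft: "(\<Sum>a\<in>?P. ?\<chi> (- (k * a)) * F g a) = correlation B (fk k) g" if "g \<in> ?C" for k g
  proof -
    have "F g a = (\<Sum>x\<in>?C. f (x \<otimes> u a) * complex_of_real (of_bool (x \<otimes> g \<in> B)))" for a
      using correlation_translate[of "u a" g B f] that by (simp add: F_def correlation_def)
    then have "(\<Sum>a\<in>?P. ?\<chi> (- (k * a)) * F g a)
        = (\<Sum>a\<in>?P. \<Sum>x\<in>?C. ?\<chi> (- (k * a)) * f (x \<otimes> u a) * complex_of_real (of_bool (x \<otimes> g \<in> B)))"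
      by (simp add: sum_distrib_left mult.assoc)
    also have "\<dots> = correlation B (fk k) g"
      by (subst sum.swap) (simp add: correlation_def fk_def sum_distrib_right)
    finally show ?thesis .
  qed
  have diff_dft: "(\<Sum>a\<in>?P. ?\<chi> (- (k * a)) * (F g a - F g (a + b)))
      = (1 - ?\<chi> (k * b)) * correlation B (fk k) g" if "g \<in> ?C" for g k
  proof -
    have "(\<Sum>a\<in>?P. ?\<chi> (- (k * a)) * (F g a - F g (a + b)))
       = (\<Sum>a\<in>?P. ?\<chi> (- (k * a)) * F g a) - (\<Sum>a\<in>?P. ?\<chi> (- (k * a)) * F g (a + b))"
      by (simp add: right_diff_distrib sum_subtractf)
    then show ?thesis
      using dft_shift[of "F g" k b] by (simp add: F_mod F_dft[OF that] left_diff_distrib)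
  qed
  have diff_parseval: "p * (\<Sum>a\<in>?P. (cmod (F g a - F g (a + b)))\<^sup>2)
      = (\<Sum>k\<in>?P. (cmod ((1 - ?\<chi> (k * b)) * correlation B (fk k) g))\<^sup>2)" if "g \<in> ?C" for g
    using parseval[OF p_pos, of "\<lambda>a. F g a - F g (a + b)"] by (simp only: diff_dft[OF that])
  have "p * (D * (\<Sum>g\<in>?C. \<Sum>a\<in>?P. (cmod (F g a - F g (a + b)))\<^sup>2))
      = D * (\<Sum>g\<in>?C. p * (\<Sum>a\<in>?P. (cmod (F g a - F g (a + b)))\<^sup>2))"
    by (simp only: sum_distrib_left mult.left_commute)
  also have "\<dots> = D * (\<Sum>g\<in>?C. \<Sum>k\<in>?P. (cmod ((1 - ?\<chi> (k * b)) * correlation B (fk k) g))\<^sup>2)"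
    by (simp only: diff_parseval cong: sum.cong)
  also have "\<dots> = (\<Sum>k\<in>?P. (cmod (1 - ?\<chi> (k * b)))\<^sup>2 * (D * ?\<Phi> k))"
    by (subst sum.swap) (simp add: norm_mult power_mult_distrib sum_distrib_left mult_ac)
  also have "\<dots> \<le> (\<Sum>k\<in>?P. 4 * (card ?C * card B * ?M' k))"
  proof (rule sum_mono)
    fix k assume k: "k \<in> ?P"
    show "(cmod (1 - ?\<chi> (k * b)))\<^sup>2 * (D * ?\<Phi> k)
        \<le> 4 * (card ?C * card B * ?M' k)"
    proof (cases "k = 0")
      case True
      then show ?thesis
        by (simp add: sum_nonneg)
    next
      case False
      with k have "\<not> int p dvd k"
        using zdvd_not_zless by auto
      then have "D * ?\<Phi> k
          \<le> card ?C * card B * ?M' k"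
        by (rule correlation_eigenfunction[OF B _ fk_eigen])
      moreover have "(cmod (1 - ?\<chi> (k * b)))\<^sup>2 \<le> 2\<^sup>2"
        using norm_triangle_ineq4[of 1 "?\<chi> (k * b)"] by (intro power_mono) auto
      ultimately have "(cmod (1 - ?\<chi> (k * b)))\<^sup>2 * (D * ?\<Phi> k)
          \<le> 2\<^sup>2 * (card ?C * card B * ?M' k)"
        by - (rule mult_mono, simp_all add: sum_nonneg)
      then show ?thesis
        by simp
    qed
  qed
  also have "\<dots> = 4 * card ?C * card B * (\<Sum>k\<in>?P. \<Sum>x\<in>?C. (cmod (fk k x))\<^sup>2)"
    by (simp add: sum_distrib_left mult_ac)
  also have "(\<Sum>k\<in>?P. \<Sum>x\<in>?C. (cmod (fk k x))\<^sup>2) = (\<Sum>x\<in>?C. \<Sum>k\<in>?P. (cmod (fk k x))\<^sup>2)"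
    by (rule sum.swap)
  also have "(\<Sum>x\<in>?C. \<Sum>k\<in>?P. (cmod (fk k x))\<^sup>2) = (\<Sum>x\<in>?C. p * (\<Sum>a\<in>?P. (cmod (f (x \<otimes> u a)))\<^sup>2))"
    unfolding fk_def by (simp add: parseval[OF p_pos])
  also have "\<dots> = p * (\<Sum>x\<in>?C. \<Sum>a\<in>?P. (cmod (f (x \<otimes> u a)))\<^sup>2)"
    by (simp only: sum_distrib_left)
  also have "(\<Sum>x\<in>?C. \<Sum>a\<in>?P. (cmod (f (x \<otimes> u a)))\<^sup>2) = (\<Sum>a\<in>?P. \<Sum>x\<in>?C. (cmod (f (x \<otimes> u a)))\<^sup>2)"
    by (rule sum.swap)
  also have "\<dots> = p * ?M"
    by (simp add: sum_translate[of _ "\<lambda>x. (cmod (f x))\<^sup>2"])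
  also have "(\<Sum>g\<in>?C. \<Sum>a\<in>?P. (cmod (F g a - F g (a + b)))\<^sup>2)
      = p * (\<Sum>g\<in>?C. (cmod (correlation B f g - correlation B f (inv (u b) \<otimes> g)))\<^sup>2)"
  proof -
    have "(\<Sum>g\<in>?C. (cmod (F g a - F g (a + b)))\<^sup>2)
        = (\<Sum>g\<in>?C. (cmod (correlation B f g - correlation B f (inv (u b) \<otimes> g)))\<^sup>2)" for a
    proof -
      have "F g (a + b) = correlation B f (inv (u b) \<otimes> (inv (u a) \<otimes> g))" if "g \<in> ?C" for g
        using that by (simp add: F_def u_add inv_mult_group m_assoc)
      then have "(\<Sum>g\<in>?C. (cmod (F g a - F g (a + b)))\<^sup>2) = (\<Sum>g\<in>?C. (cmod
          (correlation B f (inv (u a) \<otimes> g) - correlation B f (inv (u b) \<otimes> (inv (u a) \<otimes> g))))\<^sup>2)"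
        by (simp add: F_def)
      then show ?thesis
        by (simp add: sum_left_translate[of "inv (u a)" "\<lambda>g. (cmod (correlation B f g
          - correlation B f (inv (u b) \<otimes> g)))\<^sup>2"])
    qed
    then show ?thesis
      by (subst sum.swap) simp
  qed
  finally show ?thesis
    using p_pos by (simp add: mult_ac)
qed

end

lemma sum_indicator:
  "finite X \<Longrightarrow> A \<subseteq> X \<Longrightarrow> (\<Sum>x\<in>X. of_bool (x \<in> A)) = of_nat (card A)"
  by (simp add: Int_absorb1)

lemma square_sum_le_card_times_sum_squares:
  fixes v :: "'b \<Rightarrow> real"
  assumes "finite X" "X \<noteq> {}"
  shows "(\<Sum>x\<in>X. v x)\<^sup>2 \<le> card X * (\<Sum>x\<in>X. (v x)\<^sup>2)"
proof -
  let ?n = "real (card X)" and ?s = "\<Sum>x\<in>X. v x"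
  have "0 \<le> (\<Sum>x\<in>X. (?n * v x - ?s)\<^sup>2)"
    by (simp add: sum_nonneg)
  also have "\<dots> = (\<Sum>x\<in>X. ?n * ?n * (v x)\<^sup>2 - 2 * ?n * ?s * v x + ?s\<^sup>2)"
    by (intro sum.cong refl) (simp add: power2_eq_square algebra_simps)
  also have "\<dots> = ?n * (?n * (\<Sum>x\<in>X. (v x)\<^sup>2) - ?s\<^sup>2)"
    unfolding sum.distrib sum_subtractf sum_distrib_left[symmetric]
    by (simp add: power2_eq_square algebra_simps)
  finally show ?thesis
    using assms by (simp add: zero_le_mult_iff card_gt_0_iff)
qed

context group
begin

lemma sum_correlation_indicator:
  assumes fin: "finite (carrier G)" and A: "A \<subseteq> carrier G" and B: "B \<subseteq> carrier G"
  shows "(\<Sum>g\<in>carrier G. correlation B (\<lambda>x. of_bool (x \<in> A)) g) = card A * card B"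
proof -
  have "(\<Sum>g\<in>carrier G. correlation B (\<lambda>x. of_bool (x \<in> A)) g)
      = (\<Sum>x\<in>carrier G. \<Sum>g\<in>carrier G. of_bool (x \<in> A) * complex_of_real (of_bool (x \<otimes> g \<in> B)))"
    unfolding correlation_def by (rule sum.swap)
  also have "\<dots> = (\<Sum>x\<in>carrier G. of_bool (x \<in> A) * of_nat (card B))"
  proof (intro sum.cong refl)
    fix x assume "x \<in> carrier G"
    then have "(\<Sum>g\<in>carrier G. complex_of_real (of_bool (x \<otimes> g \<in> B)))
        = (\<Sum>g\<in>carrier G. complex_of_real (of_bool (g \<in> B)))"
      by (rule sum_left_translate)
    also have "\<dots> = of_nat (card B)"
      by (simp only: of_real_sum[symmetric] sum_indicator[OF fin B] of_real_of_nat_eq)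
    finally show "(\<Sum>g\<in>carrier G. of_bool (x \<in> A) * complex_of_real (of_bool (x \<otimes> g \<in> B)))
        = of_bool (x \<in> A) * of_nat (card B)"
      by (simp only: sum_distrib_left[symmetric])
  qed
  also have "\<dots> = card A * card B"
    unfolding sum_distrib_right[symmetric] sum_indicator[OF fin A] by simp
  finally show ?thesis .
qed

text \<open>Small changes along four generators add up to a small change along any element, so the correlation
\<open>L\<close> is close to constant in mean square. Its zeros are far from the average
\<open>card A * card B / card (carrier G)\<close>, so there are few of them.\<close>

lemma card_missing_translates:
  fixes D :: real and S :: "'a set"
  assumes fin: "finite (carrier G)" and A: "A \<subseteq> carrier G" and B: "B \<subseteq> carrier G"
    and S: "S \<subseteq> carrier G" and "D \<ge> 0"
    and generate: "\<And>y. y \<in> carrier G \<Longrightarrow> \<exists>a\<in>S. \<exists>b\<in>S. \<exists>c\<in>S. \<exists>d\<in>S. y = a \<otimes> b \<otimes> c \<otimes> d"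
    and inv_S: "\<And>y. y \<in> S \<Longrightarrow>
      D * (\<Sum>g\<in>carrier G. (cmod (correlation B (\<lambda>x. of_bool (x \<in> A)) g
             - correlation B (\<lambda>x. of_bool (x \<in> A)) (inv y \<otimes> g)))\<^sup>2)
        \<le> 4 * card (carrier G) * card B * card A"
    and "A \<noteq> {}" "B \<noteq> {}"
  shows "D * card A * card B * card {g \<in> carrier G. \<forall>x\<in>A. x \<otimes> g \<notin> B} \<le> 64 * real (card (carrier G)) ^ 3"
proof -
  let ?C = "carrier G" and ?f = "\<lambda>x. of_bool (x \<in> A)"
  let ?N = "real (card ?C)" and ?a = "real (card A)" and ?b = "real (card B)"
  define L where "L = correlation B ?f"
  let ?m = "\<Sum>g\<in>?C. (cmod (L g))\<^sup>2"
  define \<delta> where "\<delta> y = (\<Sum>g\<in>?C. (cmod (L g - L (inv y \<otimes> g)))\<^sup>2)" for y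
  let ?bad = "{g \<in> ?C. \<forall>x\<in>A. x \<otimes> g \<notin> B}"
  have pos: "?a > 0" "?b > 0" "?N > 0"
    using assms finite_subset[OF A fin] finite_subset[OF B fin] by (auto simp: card_gt_0_iff)
  have \<delta>_shift: "(\<Sum>g\<in>?C. (cmod (L (z \<otimes> g) - L (inv y \<otimes> (z \<otimes> g))))\<^sup>2) = \<delta> y"
    if "z \<in> ?C" for y z
    unfolding \<delta>_def by (rule sum_left_translate[OF that])
  have \<delta>_S: "D * \<delta> y \<le> 4 * ?N * ?a * ?b" if "y \<in> S" for y
    using inv_S[OF that] by (simp add: \<delta>_def L_def mult_ac)
  have \<delta>_all: "D * \<delta> y \<le> 64 * ?N * ?a * ?b" if "y \<in> ?C" for y
  proof -
    from generate[OF that] obtain a b c d where y: "y = a \<otimes> b \<otimes> c \<otimes> d"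
      and abcd: "a \<in> S" "b \<in> S" "c \<in> S" "d \<in> S" by blast
    have C: "a \<in> ?C" "b \<in> ?C" "c \<in> ?C" "d \<in> ?C"
      using abcd S by auto
    have four: "(cmod (w1 - w5))\<^sup>2 \<le> 4 * ((cmod (w1 - w2))\<^sup>2 + (cmod (w2 - w3))\<^sup>2 + (cmod (w3 - w4))\<^sup>2 + (cmod (w4 - w5))\<^sup>2)"
      for w1 w2 w3 w4 w5
    proof -
      let ?p = "cmod (w1 - w2)" and ?q = "cmod (w2 - w3)" and ?r = "cmod (w3 - w4)" and ?s = "cmod (w4 - w5)"
      have "cmod (w1 - w5) \<le> ?p + ?q + ?r + ?s"
        using norm_triangle_ineq[of "w1 - w2" "w2 - w3"] norm_triangle_ineq[of "w1 - w3" "w3 - w4"]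
          norm_triangle_ineq[of "w1 - w4" "w4 - w5"] by simp
      then have "(cmod (w1 - w5))\<^sup>2 \<le> (?p + ?q + ?r + ?s)\<^sup>2"
        by (intro power_mono) auto
      also have "\<dots> \<le> 4 * (?p\<^sup>2 + ?q\<^sup>2 + ?r\<^sup>2 + ?s\<^sup>2)"
      proof -
        have "0 \<le> (?p - ?q)\<^sup>2 + (?p - ?r)\<^sup>2 + (?p - ?s)\<^sup>2 + (?q - ?r)\<^sup>2 + (?q - ?s)\<^sup>2 + (?r - ?s)\<^sup>2"
          by simp
        then show ?thesis
          by (simp add: power2_eq_square algebra_simps)
      qed
      finally show ?thesis .
    qed
    let ?S = "\<lambda>g. 4 * ((cmod (L g - L (inv a \<otimes> g)))\<^sup>2
        + (cmod (L (inv a \<otimes> g) - L (inv b \<otimes> (inv a \<otimes> g))))\<^sup>2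
        + (cmod (L (inv (a \<otimes> b) \<otimes> g) - L (inv c \<otimes> (inv (a \<otimes> b) \<otimes> g))))\<^sup>2
        + (cmod (L (inv (a \<otimes> b \<otimes> c) \<otimes> g) - L (inv d \<otimes> (inv (a \<otimes> b \<otimes> c) \<otimes> g))))\<^sup>2)"
    have "\<delta> y \<le> (\<Sum>g\<in>?C. ?S g)"
      unfolding \<delta>_def
    proof (rule sum_mono)
      fix g assume g: "g \<in> ?C"
      have "inv b \<otimes> (inv a \<otimes> g) = inv (a \<otimes> b) \<otimes> g"
        "inv c \<otimes> (inv (a \<otimes> b) \<otimes> g) = inv (a \<otimes> b \<otimes> c) \<otimes> g"
        "inv d \<otimes> (inv (a \<otimes> b \<otimes> c) \<otimes> g) = inv y \<otimes> g"
        using C g by (simp_all add: y inv_mult_group m_assoc)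
      then show "(cmod (L g - L (inv y \<otimes> g)))\<^sup>2 \<le> ?S g"
        by (simp only: four)
    qed
    also have "\<dots> = 4 * (\<delta> a + \<delta> b + \<delta> c + \<delta> d)"
      using C by (simp add: sum.distrib \<delta>_shift flip: sum_distrib_left) (simp add: \<delta>_def)
    finally have "D * \<delta> y \<le> D * (4 * (\<delta> a + \<delta> b + \<delta> c + \<delta> d))"
      using \<open>D \<ge> 0\<close> by (rule mult_left_mono)
    also have "\<dots> = 4 * (D * \<delta> a + D * \<delta> b + D * \<delta> c + D * \<delta> d)"
      by (simp add: algebra_simps)
    also have "\<dots> \<le> 64 * ?N * ?a * ?b"
      using abcd[THEN \<delta>_S] by simp
    finally show ?thesis .
  qed
  have "?a * ?b = cmod (\<Sum>g\<in>?C. L g)"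
    using sum_correlation_indicator[OF fin A B] by (simp add: L_def norm_mult)
  also have "\<dots> \<le> (\<Sum>g\<in>?C. cmod (L g))"
    by (rule norm_sum)
  finally have "(?a * ?b)\<^sup>2 \<le> (\<Sum>g\<in>?C. cmod (L g))\<^sup>2"
    by (intro power_mono) auto
  also have "\<dots> \<le> ?N * ?m"
    by (rule square_sum_le_card_times_sum_squares[OF fin]) auto
  finally have mass: "(?a * ?b)\<^sup>2 \<le> ?N * ?m" .
  \<comment> \<open>A zero \<open>g\<close> contributes the full norm of \<open>L\<close> to the mean square of \<open>L g - L h\<close>.\<close>
  have "card ?bad * ?m = (\<Sum>g\<in>?bad. \<Sum>h\<in>?C. (cmod (L g - L h))\<^sup>2)"
  proof -
    have "L g = 0" if "g \<in> ?bad" for g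
      unfolding L_def correlation_def using that by (intro sum.neutral) auto
    then show ?thesis
      by simp
  qed
  also have "\<dots> \<le> (\<Sum>g\<in>?C. \<Sum>h\<in>?C. (cmod (L g - L h))\<^sup>2)"
    using fin by (intro sum_mono2) (auto simp: sum_nonneg)
  also have "\<dots> = (\<Sum>g\<in>?C. \<Sum>y\<in>?C. (cmod (L g - L (inv y \<otimes> g)))\<^sup>2)"
  proof (rule sum.cong[OF refl])
    fix g assume g: "g \<in> ?C"
    have *: "g \<otimes> inv (inv y \<otimes> g) = y" "inv (g \<otimes> inv y) \<otimes> g = y" if "y \<in> ?C" for y
      using g that by (simp add: inv_mult_group m_assoc[symmetric], simp add: inv_mult_group m_assoc)
    show "(\<Sum>h\<in>?C. (cmod (L g - L h))\<^sup>2) = (\<Sum>y\<in>?C. (cmod (L g - L (inv y \<otimes> g)))\<^sup>2)"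
      by (rule sum.reindex_bij_witness[of _ "\<lambda>y. inv y \<otimes> g" "\<lambda>h. g \<otimes> inv h"])
         (use g in \<open>auto simp: *\<close>)
  qed
  also have "\<dots> = (\<Sum>y\<in>?C. \<delta> y)"
    unfolding \<delta>_def by (rule sum.swap)
  finally have "D * (card ?bad * ?m) \<le> D * (\<Sum>y\<in>?C. \<delta> y)"
    using \<open>D \<ge> 0\<close> by (rule mult_left_mono)
  also have "\<dots> = (\<Sum>y\<in>?C. D * \<delta> y)"
    by (rule sum_distrib_left)
  also have "\<dots> \<le> (\<Sum>y\<in>?C. 64 * ?N * ?a * ?b)"
    by (intro sum_mono \<delta>_all)
  finally have "D * (card ?bad * ?m) \<le> 64 * ?N ^ 2 * ?a * ?b"
    by (simp add: power2_eq_square mult_ac)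
  then have "?N * (D * (card ?bad * ?m)) \<le> ?N * (64 * ?N ^ 2 * ?a * ?b)"
    by (intro mult_left_mono) auto
  moreover have "D * card ?bad * (?a * ?b)\<^sup>2 \<le> D * card ?bad * (?N * ?m)"
    using \<open>D \<ge> 0\<close> mass by (intro mult_left_mono) auto
  ultimately have "(?a * ?b) * (D * ?a * ?b * card ?bad) \<le> (?a * ?b) * (64 * ?N ^ 3)"
    by (simp add: power2_eq_square power3_eq_cube mult_ac)
  then show ?thesis
    using pos by (simp add: mult_le_cancel_left_pos)
qed

text \<open>A union bound over the \<open>m\<^sup>2\<close> pairs of sets. Each pair excludes at most a fraction
\<open>256 m\<^sup>2 / D\<close> of the group, where \<open>256 = 64 * 4\<close> and the factor
\<open>4 m\<^sup>2\<close> is the square of the bound on \<open>card (carrier G) / s\<close>.\<close>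

theorem translate_meets_all:
  fixes I :: "nat \<Rightarrow> 'a set"
  assumes u: "one_parameter_torus G p D u t" and l: "one_parameter_torus G p D l t'"
    and generate: "\<And>y. y \<in> carrier G \<Longrightarrow> \<exists>a b c d. y = l a \<otimes> u b \<otimes> l c \<otimes> u d"
    and I: "\<And>i. i < m \<Longrightarrow> I i \<subseteq> carrier G" "\<And>i. i < m \<Longrightarrow> card (I i) = s"
    and size: "s > 0" "card (carrier G) \<le> 2 * m * s" and D: "256 * m ^ 4 < D"
  shows "\<exists>g\<in>carrier G. \<forall>i<m. \<forall>j<m. \<exists>x\<in>I i. x \<otimes> g \<in> I j"
proof (rule ccontr)
  interpret u: one_parameter_torus G p D u t by fact
  interpret l: one_parameter_torus G p D l t' by fact
  let ?C = "carrier G" and ?N = "real (card (carrier G))"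
  define bad where "bad i j = {g \<in> ?C. \<forall>x\<in>I i. x \<otimes> g \<notin> I j}" for i j
  have fin: "finite ?C" by (rule u.finite_carrier)
  have N: "?N > 0"
    using fin by (simp add: card_gt_0_iff) blast
  have "real D * card (bad i j) \<le> 256 * real m ^ 2 * ?N" if "i < m" "j < m" for i j
  proof -
    have "(cmod (of_bool P))\<^sup>2 = of_bool P" for P
      by simp
    then have norm: "(\<Sum>x\<in>?C. (cmod (of_bool (x \<in> I i)))\<^sup>2) = card (I i)"
      by (simp only: norm_of_real sum_indicator[OF fin I(1)[OF that(1)]])
    have "real D * card (I i) * card (I j) * card (bad i j) \<le> 64 * ?N ^ 3"
      unfolding bad_def
    proof (rule card_missing_translates[where S = "range l \<union> range u"])
      show "real D * (\<Sum>g\<in>?C. (cmod (correlation (I j) (\<lambda>x. of_bool (x \<in> I i)) g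
             - correlation (I j) (\<lambda>x. of_bool (x \<in> I i)) (inv y \<otimes> g)))\<^sup>2)
        \<le> real (4 * card ?C * card (I j) * card (I i))" if "y \<in> range l \<union> range u" for y
        using that u.correlation_almost_invariant[of "I j" "\<lambda>x. of_bool (x \<in> I i)"]
          l.correlation_almost_invariant[of "I j" "\<lambda>x. of_bool (x \<in> I i)"] I[OF \<open>j < m\<close>] norm
        by auto
      show "\<exists>a\<in>range l \<union> range u. \<exists>b\<in>range l \<union> range u. \<exists>c\<in>range l \<union> range u. \<exists>d\<in>range l \<union> range u.
          y = a \<otimes> b \<otimes> c \<otimes> d" if "y \<in> ?C" for y
        using generate[OF that] by blast
      show "I i \<noteq> {}" "I j \<noteq> {}"
        using I(2) \<open>i < m\<close> \<open>j < m\<close> size(1) by fastforce+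
    qed (use fin I that in auto)
    also have "\<dots> \<le> 64 * (?N * (2 * m * s) ^ 2)"
    proof -
      have "?N ^ 2 \<le> real (2 * m * s) ^ 2"
        using size(2) by (intro power_mono) linarith+
      then have "?N * ?N ^ 2 \<le> ?N * real (2 * m * s) ^ 2"
        by (intro mult_left_mono) auto
      then show ?thesis
        by (simp add: power3_eq_cube power2_eq_square mult_ac)
    qed
    finally have "(real s) ^ 2 * (real D * card (bad i j)) \<le> (real s) ^ 2 * (256 * real m ^ 2 * ?N)"
      using I(2) that by (simp add: power2_eq_square mult_ac)
    then show ?thesis
      using size(1) by (simp add: mult_le_cancel_left_pos)
  qed
  then have bound: "(\<Sum>i<m. \<Sum>j<m. real D * card (bad i j)) \<le> (\<Sum>i<m. \<Sum>j<m. 256 * real m ^ 2 * ?N)"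
    by (intro sum_mono) auto
  assume "\<not> ?thesis"
  then have "?C \<subseteq> (\<Union>i<m. \<Union>j<m. bad i j)"
    by (fastforce simp: bad_def)
  then have "card ?C \<le> card (\<Union>i<m. \<Union>j<m. bad i j)"
    using fin by (intro card_mono) (auto simp: bad_def)
  also have "\<dots> \<le> (\<Sum>i<m. card (\<Union>j<m. bad i j))"
    by (rule card_UN_le) simp
  also have "\<dots> \<le> (\<Sum>i<m. \<Sum>j<m. card (bad i j))"
    by (intro sum_mono card_UN_le) simp
  finally have "real D * ?N \<le> real D * real (\<Sum>i<m. \<Sum>j<m. card (bad i j))"
    by (intro mult_left_mono) linarith+
  also have "\<dots> = (\<Sum>i<m. \<Sum>j<m. real D * card (bad i j))"
    by (simp add: sum_distrib_left)
  also have "\<dots> \<le> (256 * m ^ 4) * ?N"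
    using bound by (simp add: power2_eq_square power4_eq_xxxx mult_ac)
  finally have "real D \<le> real (256 * m ^ 4)"
    using N by (simp add: mult_le_cancel_right)
  with D show False
    by linarith
qed

end


section \<open>Finitely supported permutations in Houghton groups\<close>

lemma houghton_carrier_Bij: "f \<in> carrier (houghton n) \<Longrightarrow> f \<in> Bij (houghton_points n)"
  using group.carrier_subgroup_generated_subset[OF group_BijGroup]
  by (fastforce simp: houghton_def BijGroup_def)

lemma houghton_mult:
  assumes "f \<in> Bij (houghton_points n)" "g \<in> Bij (houghton_points n)"
  shows "f \<otimes>\<^bsub>houghton n\<^esub> g = compose (houghton_points n) f g"
  using assms by (simp add: houghton_def BijGroup_def)

lemma houghton_one: "\<one>\<^bsub>houghton n\<^esub> = (\<lambda>x\<in>houghton_points n. x)"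
  by (simp add: houghton_def BijGroup_def)

lemma houghton_generator: "f \<in> houghton_generators n \<Longrightarrow> f \<in> carrier (houghton n)"
  using houghton_generators_Bij[of n]
  by (auto simp: houghton_def carrier_subgroup_generated BijGroup_def intro!: generate.incl)

lemma restrict_permutes_Bij:
  assumes "\<pi> permutes S" "S \<subseteq> V"
  shows "restrict \<pi> V \<in> Bij V"
proof -
  have "\<pi> permutes V"
    using assms by (rule permutes_subset)
  then show ?thesis
    by (simp add: Bij_def permutes_imp_bij)
qed

lemma houghton_mult_restrict:
  assumes "\<pi> permutes S" "\<rho> permutes T" "S \<subseteq> houghton_points n" "T \<subseteq> houghton_points n"
  shows "restrict \<pi> (houghton_points n) \<otimes>\<^bsub>houghton n\<^esub> restrict \<rho> (houghton_points n)
       = restrict (\<pi> \<circ> \<rho>) (houghton_points n)"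
proof -
  let ?V = "houghton_points n"
  have "\<rho> x \<in> ?V" if "x \<in> ?V" for x
    using permutes_in_image[OF permutes_subset[OF assms(2,4)]] that by simp
  then show ?thesis
    using assms by (auto simp: houghton_mult restrict_permutes_Bij compose_def)
qed

lemma (in group) conjugate_mem_subgroup_iff:
  assumes H: "subgroup H G" and h: "h \<in> H" and ab: "a \<in> carrier G" "b \<in> carrier G"
    and comm: "a \<otimes> h = h \<otimes> b"
  shows "a \<in> H \<longleftrightarrow> b \<in> H"
proof -
  have hG: "h \<in> carrier G"
    using H h by (rule subgroup.mem_carrier)
  have "a = (a \<otimes> h) \<otimes> inv h" "b = inv h \<otimes> (h \<otimes> b)"
    using ab hG by (simp add: m_assoc, simp flip: m_assoc)
  then have "a = (h \<otimes> b) \<otimes> inv h" "b = inv h \<otimes> (a \<otimes> h)"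
    using comm by simp_all
  then show ?thesis
    using subgroup.m_closed[OF H] subgroup.m_inv_closed[OF H] h by metis
qed

lemma (in group) mem_subgroup_if_product:
  assumes H: "subgroup H G" and h: "h \<in> H" and a: "a \<in> carrier G" "a \<otimes> h \<in> H"
  shows "a \<in> H"
proof -
  have "a = (a \<otimes> h) \<otimes> inv h"
    using a subgroup.mem_carrier[OF H h] by (simp add: m_assoc)
  then show ?thesis
    using subgroup.m_closed[OF H a(2)] subgroup.m_inv_closed[OF H h] by metis
qed

lemma subgroup_houghton: "subgroup (carrier (houghton n)) (BijGroup (houghton_points n))"
  unfolding houghton_def by (rule group.subgroup_subgroup_generated[OF group_BijGroup])

lemma BijGroup_simps: "carrier (BijGroup V) = Bij V"
  "f \<in> Bij V \<Longrightarrow> g \<in> Bij V \<Longrightarrow> f \<otimes>\<^bsub>BijGroup V\<^esub> g = compose V f g"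
  by (simp_all add: BijGroup_def)

definition swap_points :: "nat \<Rightarrow> point \<Rightarrow> point \<Rightarrow> point \<Rightarrow> point" where
  "swap_points n v w = restrict (Transposition.transpose v w) (houghton_points n)"

lemma swap_points_apply:
  "x \<in> houghton_points n \<Longrightarrow> swap_points n v w x = Transposition.transpose v w x"
  by (simp add: swap_points_def)

lemma swap_points_commute: "swap_points n v w = swap_points n w v"
  by (simp add: swap_points_def transpose_commute)

lemma swap_points_same: "swap_points n v v = \<one>\<^bsub>houghton n\<^esub>"
  by (auto simp: swap_points_def houghton_one restrict_def)

lemma swap_points_Bij:
  assumes "v \<in> houghton_points n" "w \<in> houghton_points n"
  shows "swap_points n v w \<in> Bij (houghton_points n)"
  unfolding swap_points_def
  using assms by (intro restrict_permutes_Bij[where S = "{v, w}"] permutes_swap_id) auto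

lemma one_in_houghton: "\<one>\<^bsub>houghton n\<^esub> \<in> carrier (houghton n)"
  by (rule monoid.one_closed[OF group.is_monoid[OF group_houghton]])

text \<open>Conjugating the transposition of \<open>v\<close> and \<open>w\<close> by \<open>h\<close> gives the
transposition of \<open>h v\<close> and \<open>h w\<close>. Used in both directions, this also yields
conjugation by inverses of generators.\<close>

lemma houghton_swap_conjugate:
  assumes h: "h \<in> carrier (houghton n)" and vw: "v \<in> houghton_points n" "w \<in> houghton_points n"
  shows "swap_points n (h v) (h w) \<in> carrier (houghton n) \<longleftrightarrow> swap_points n v w \<in> carrier (houghton n)"
proof -
  let ?V = "houghton_points n"
  have hB: "h \<in> Bij ?V"
    using h by (rule houghton_carrier_Bij)
  then have inj: "inj_on h ?V" and into: "\<And>x. x \<in> ?V \<Longrightarrow> h x \<in> ?V"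
    by (auto simp: Bij_def bij_betw_def)
  have "compose ?V (swap_points n (h v) (h w)) h = compose ?V h (swap_points n v w)"
  proof (rule extensionalityI[of _ ?V])
    fix x assume x: "x \<in> ?V"
    then have "Transposition.transpose v w x \<in> ?V"
      using vw by (auto simp: Transposition.transpose_def)
    moreover have "Transposition.transpose (h v) (h w) (h x) = h (Transposition.transpose v w x)"
      using inj x vw by (auto simp: Transposition.transpose_def inj_on_eq_iff)
    ultimately show "compose ?V (swap_points n (h v) (h w)) h x = compose ?V h (swap_points n v w) x"
      using x into by (simp add: compose_def swap_points_apply)
  qed (auto simp: compose_def)
  then show ?thesis
    using hB swap_points_Bij into vw h
    by (intro group.conjugate_mem_subgroup_iff[OF group_BijGroup subgroup_houghton h])
       (simp_all add: BijGroup_simps)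
qed

lemma houghton_swap_trans:
  assumes "u \<in> houghton_points n" "v \<in> houghton_points n" "w \<in> houghton_points n"
    and "swap_points n u v \<in> carrier (houghton n)" "swap_points n v w \<in> carrier (houghton n)"
  shows "swap_points n u w \<in> carrier (houghton n)"
proof (cases "u = v \<or> u = w")
  case True
  have "swap_points n u u \<in> carrier (houghton n)"
    by (simp add: swap_points_same one_in_houghton)
  with True assms show ?thesis
    by auto
next
  case False
  then have "swap_points n v w u = u" "swap_points n v w v = w"
    using assms(1-3) by (auto simp: swap_points_apply Transposition.transpose_def)
  with houghton_swap_conjugate[OF assms(5) assms(1,2)] assms(4) show ?thesis
    by simp
qed

text \<open>The commutator of \<open>g\<^sub>2\<close> and \<open>g\<^sub>3\<close> is the transposition of the centre and
the first point of ray \<open>1\<close>: both products of the two generators push the centre and ray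
\<open>1\<close> outwards by two steps, but the two points that become free are filled from rays
\<open>2\<close> and \<open>3\<close> in opposite ways. Pushing this transposition along the rays connects
every point to the centre by transpositions in the group.\<close>

lemma houghton_swap:
  assumes n: "3 \<le> n" and vw: "v \<in> houghton_points n" "w \<in> houghton_points n"
  shows "swap_points n v w \<in> carrier (houghton n)"
proof -
  let ?V = "houghton_points n" and ?H = "carrier (houghton n)"
  define g where "g k = restrict (ray_shift k) ?V" for k
  have V: "?V = insert Centre {Ray i m |i m. 1 \<le> i \<and> i \<le> n \<and> 1 \<le> m}"
    using n by (simp add: houghton_points_def)
  have g: "g k \<in> ?H" if "2 \<le> k" "k \<le> n" for k
    using n that by (intro houghton_generator) (auto simp: houghton_generators_def g_def)
  have pts: "Centre \<in> ?V" "1 \<le> i \<Longrightarrow> i \<le> n \<Longrightarrow> 1 \<le> m \<Longrightarrow> Ray i m \<in> ?V" for i m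
    by (auto simp: V)
  have gB: "g 2 \<in> Bij ?V" "g 3 \<in> Bij ?V"
    using g n by (auto intro: houghton_carrier_Bij)
  have centre1: "swap_points n Centre (Ray 1 1) \<in> ?H"
  proof -
    let ?s = "swap_points n Centre (Ray 1 1)"
    have sB: "?s \<in> Bij ?V"
      using pts n by (intro swap_points_Bij) auto
    have "compose ?V (g 2) (g 3) = compose ?V ?s (compose ?V (g 3) (g 2))"
    proof (rule extensionalityI[of _ ?V])
      fix x assume x: "x \<in> ?V"
      show "compose ?V (g 2) (g 3) x = compose ?V ?s (compose ?V (g 3) (g 2)) x"
      proof (cases x)
        case (Line l)
        with x show ?thesis by (simp add: V)
      next
        case Centre
        then show ?thesis
          using n pts by (simp add: compose_def g_def ray_shift_def swap_points_apply Transposition.transpose_def)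
      next
        case (Ray i m)
        with x have im: "1 \<le> i" "i \<le> n" "1 \<le> m"
          by (auto simp: V)
        consider "i = 1" | "i = 2" | "i = 3" | "i > 3"
          using im by linarith
        then show ?thesis
        proof cases
          case 1
          then show ?thesis
            using n pts im Ray by (simp add: compose_def g_def ray_shift_def swap_points_apply Transposition.transpose_def)
        next
          case 2
          then show ?thesis
            using n pts im Ray by (cases "m = 1") (simp_all add: compose_def g_def ray_shift_def swap_points_apply Transposition.transpose_def)
        next
          case 3
          then show ?thesis
            using n pts im Ray by (cases "m = 1") (simp_all add: compose_def g_def ray_shift_def swap_points_apply Transposition.transpose_def)
        next
          case 4
          then show ?thesis
            using n pts im Ray by (simp add: compose_def g_def ray_shift_def swap_points_apply Transposition.transpose_def)
        qed
      qed
    qed (auto simp: compose_def)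
    moreover have "compose ?V (g 2) (g 3) \<in> ?H" "compose ?V (g 3) (g 2) \<in> ?H"
      using subgroup.m_closed[OF subgroup_houghton g[of 2] g[of 3]]
        subgroup.m_closed[OF subgroup_houghton g[of 3] g[of 2]] n gB by (simp_all add: BijGroup_simps)
    ultimately show ?thesis
      using group.mem_subgroup_if_product[OF group_BijGroup subgroup_houghton, of "compose ?V (g 3) (g 2)" n ?s] sB gB
      by (simp add: BijGroup_simps compose_Bij)
  qed
  have ray1: "swap_points n Centre (Ray 1 m) \<in> ?H" if "1 \<le> m" for m
    using that
  proof (induction m rule: nat_induct_at_least)
    case (Suc m)
    have "g 2 Centre = Ray 1 1" "g 2 (Ray 1 m) = Ray 1 (Suc m)"
      using n pts Suc.hyps by (simp_all add: g_def ray_shift_def)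
    then have "swap_points n (Ray 1 1) (Ray 1 (Suc m)) \<in> ?H"
      using houghton_swap_conjugate[OF g[of 2], of Centre "Ray 1 m"] Suc n pts by simp
    then show ?case
      using centre1 n pts by (intro houghton_swap_trans[of Centre n "Ray 1 1" "Ray 1 (Suc m)"]) auto
  qed (use centre1 in simp)
  have ray: "swap_points n Centre (Ray k m) \<in> ?H" if "1 \<le> m" "2 \<le> k" "k \<le> n" for k m
    using that(1)
  proof (induction m rule: nat_induct_at_least)
    case base
    have "g k Centre = Ray 1 1" "g k (Ray k 1) = Centre"
      using n pts that by (simp_all add: g_def ray_shift_def)
    then show ?case
      using houghton_swap_conjugate[OF g[of k], of "Ray k 1" Centre] ray1[of 1] that n pts
      by (simp add: swap_points_commute)
  next
    case (Suc m)
    have "g k (Ray k 1) = Centre" "g k (Ray k (Suc m)) = Ray k m"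
      using n pts that Suc.hyps by (simp_all add: g_def ray_shift_def)
    then have "swap_points n (Ray k 1) (Ray k (Suc m)) \<in> ?H"
      using houghton_swap_conjugate[OF g[of k], of "Ray k 1" "Ray k (Suc m)"] Suc that n pts by simp
    moreover have "swap_points n Centre (Ray k 1) \<in> ?H"
    proof -
      have "g k Centre = Ray 1 1" "g k (Ray k 1) = Centre"
        using n pts that by (simp_all add: g_def ray_shift_def)
      then show ?thesis
        using houghton_swap_conjugate[OF g[of k], of "Ray k 1" Centre] ray1[of 1] that n pts
        by (simp add: swap_points_commute)
    qed
    ultimately show ?case
      using that n pts by (intro houghton_swap_trans[of Centre n "Ray k 1" "Ray k (Suc m)"]) auto
  qed
  have centre: "swap_points n Centre x \<in> ?H" if "x \<in> ?V" for x
  proof (cases x)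
    case Centre
    then show ?thesis
      by (simp add: swap_points_same one_in_houghton)
  next
    case (Ray i m)
    then show ?thesis
      using that ray1[of m] ray[of m i] by (cases "i = 1") (auto simp: V)
  qed (use that in \<open>simp add: V\<close>)
  show ?thesis
    using vw pts centre[OF vw(1)] centre[OF vw(2)]
    by (intro houghton_swap_trans[of v n Centre w]) (auto simp: swap_points_commute)
qed

text \<open>For \<open>n = 2\<close> these permutations are generators; for \<open>n \<ge> 3\<close> they are products
of transpositions.\<close>

lemma finitely_supported_in_houghton:
  assumes n: "2 \<le> n" and \<pi>: "\<pi> permutes S" and S: "finite S" "S \<subseteq> houghton_points n"
  shows "restrict \<pi> (houghton_points n) \<in> carrier (houghton n)"
proof (cases "n = 2")
  case True
  have "{x \<in> houghton_points n. restrict \<pi> (houghton_points n) x \<noteq> x} \<subseteq> S"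
    using permutes_not_in[OF \<pi>] by auto
  then have "finite {x \<in> houghton_points n. restrict \<pi> (houghton_points n) x \<noteq> x}"
    using S(1) by (rule finite_subset)
  then have "restrict \<pi> (houghton_points n) \<in> houghton_generators n"
    using True restrict_permutes_Bij[OF \<pi> S(2)]
    unfolding houghton_generators_def finitely_supported_perms_def by simp
  then show ?thesis
    by (rule houghton_generator)
next
  case False
  show ?thesis
    using \<pi> S(1)
  proof (induction rule: permutes_induct)
    case id
    have "restrict id (houghton_points n) = \<one>\<^bsub>houghton n\<^esub>"
      by (auto simp: houghton_one restrict_def)
    then show ?case
      by (simp only: one_in_houghton)
  next
    case (swap a b \<pi>)
    have "restrict (Transposition.transpose a b \<circ> \<pi>) (houghton_points n)
        = swap_points n a b \<otimes>\<^bsub>houghton n\<^esub> restrict \<pi> (houghton_points n)"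
      unfolding swap_points_def
      using swap S(2) by (intro houghton_mult_restrict[symmetric, of _ S _ S] permutes_swap_id) auto
    moreover have "swap_points n a b \<in> carrier (houghton n)"
      using swap S(2) n False by (intro houghton_swap) auto
    ultimately show ?case
      using swap.IH monoid.m_closed[OF group.is_monoid[OF group_houghton]] by metis
  qed
qed


section \<open>Special linear groups in Houghton groups and infinite uniform twin-width\<close>

text \<open>Matrices with integer entries are used as names for elements of \<open>SL(2, p)\<close>: only their action on
\<open>(\<int> / p)\<^sup>2\<close>, on representatives \<open>{0..<p}\<close>, enters the group. In this
way products of several matrices are reduced modulo \<open>p\<close> only once.\<close>

type_synonym matrix2 = "int \<times> int \<times> int \<times> int"

definition mult2 :: "matrix2 \<Rightarrow> matrix2 \<Rightarrow> matrix2" where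
  "mult2 M N = (case M of (a, b, c, d) \<Rightarrow> case N of (a', b', c', d') \<Rightarrow>
     (a * a' + b * c', a * b' + b * d', c * a' + d * c', c * b' + d * d'))"

definition det2 :: "matrix2 \<Rightarrow> int" where
  "det2 M = (case M of (a, b, c, d) \<Rightarrow> a * d - b * c)"

definition act2 :: "nat \<Rightarrow> matrix2 \<Rightarrow> int \<times> int \<Rightarrow> int \<times> int" where
  "act2 p M v = (case M of (a, b, c, d) \<Rightarrow> case v of (x, y) \<Rightarrow>
     ((a * x + b * y) mod int p, (c * x + d * y) mod int p))"

definition plane :: "nat \<Rightarrow> (int \<times> int) set" where
  "plane p = {0..<int p} \<times> {0..<int p}"

lemma det2_mult2: "det2 (mult2 M N) = det2 M * det2 N"
  by (cases M; cases N) (simp add: det2_def mult2_def algebra_simps)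

lemma act2_mult2: "act2 p M (act2 p N v) = act2 p (mult2 M N) v"
proof -
  have *: "(a * (x mod q) + b * (y mod q)) mod q = (a * x + b * y) mod q" for a b x y q :: int
    by (metis mod_add_eq mod_mult_right_eq)
  show ?thesis
    by (cases M; cases N; cases v) (simp add: act2_def mult2_def * algebra_simps)
qed

lemma act2_plane: "p > 0 \<Longrightarrow> act2 p M v \<in> plane p"
  by (cases M; cases v) (simp add: act2_def plane_def)

lemma act2_cong:
  assumes "a mod int p = a' mod int p" "b mod int p = b' mod int p"
    "c mod int p = c' mod int p" "d mod int p = d' mod int p"
  shows "act2 p (a, b, c, d) = act2 p (a', b', c', d')"
proof
  have *: "(a * x + b * y) mod q = (a' * x + b' * y) mod q"
    if "a mod q = a' mod q" "b mod q = b' mod q" for a b a' b' x y q :: int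
    using that by (metis mod_add_eq mod_mult_left_eq)
  show "act2 p (a, b, c, d) v = act2 p (a', b', c', d') v" for v
    using assms by (cases v) (auto simp: act2_def intro!: *)
qed

lemma act2_one: "v \<in> plane p \<Longrightarrow> act2 p (1, 0, 0, 1) v = v"
  by (cases v) (simp add: act2_def plane_def)

text \<open>The action of \<open>SL(2, p)\<close> on the plane is transported to the points of the Houghton group by an
arbitrary injection \<open>\<iota>\<close>; all other points are fixed.\<close>

locale sl2_in_houghton =
  fixes n p :: nat and \<iota> :: "int \<times> int \<Rightarrow> point"
  assumes n: "2 \<le> n" and prime_p: "prime p"
    and inj: "inj_on \<iota> (plane p)" and into: "\<iota> ` plane p \<subseteq> houghton_points n"
begin

definition perm :: "matrix2 \<Rightarrow> point \<Rightarrow> point" where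
  "perm M v = (if v \<in> \<iota> ` plane p then \<iota> (act2 p M (inv_into (plane p) \<iota> v)) else v)"

definition elt :: "matrix2 \<Rightarrow> point \<Rightarrow> point" where
  "elt M = restrict (perm M) (houghton_points n)"

definition SL :: "(point \<Rightarrow> point) set" where
  "SL = elt ` {M. det2 M mod int p = 1}"

lemma p_gt_1: "p > 1"
  using prime_p prime_gt_1_nat by blast

lemma perm_\<iota>: "v \<in> plane p \<Longrightarrow> perm M (\<iota> v) = \<iota> (act2 p M v)"
  using inj by (simp add: perm_def)

lemma perm_mult2: "perm M (perm N v) = perm (mult2 M N) v"
proof (cases "v \<in> \<iota> ` plane p")
  case True
  then obtain w where "v = \<iota> w" "w \<in> plane p" by blast
  then show ?thesis
    using p_gt_1 by (simp add: perm_\<iota> act2_plane act2_mult2)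
qed (simp add: perm_def)

definition adjugate :: "matrix2 \<Rightarrow> matrix2" where
  "adjugate M = (case M of (a, b, c, d) \<Rightarrow> (d, - b, - c, a))"

lemma det2_adjugate: "det2 (adjugate M) = det2 M"
  by (cases M) (simp add: det2_def adjugate_def)

lemma perm_one: "perm (1, 0, 0, 1) v = v"
  by (cases "v \<in> \<iota> ` plane p") (auto simp: perm_\<iota> act2_one, simp add: perm_def)

lemma perm_cong:
  assumes "a mod int p = a' mod int p" "b mod int p = b' mod int p"
    "c mod int p = c' mod int p" "d mod int p = d' mod int p"
  shows "perm (a, b, c, d) = perm (a', b', c', d')"
  using act2_cong[OF assms] by (intro ext) (simp add: perm_def)

lemma perm_adjugate:
  assumes "det2 M mod int p = 1"
  shows "perm (mult2 (adjugate M) M) v = v" "perm (mult2 M (adjugate M)) v = v"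
proof -
  obtain a b c d where M: "M = (a, b, c, d)" by (cases M)
  have "perm (mult2 (adjugate M) M) = perm (1, 0, 0, 1)"
    "perm (mult2 M (adjugate M)) = perm (1, 0, 0, 1)"
    unfolding M mult2_def adjugate_def prod.case using assms p_gt_1
    by (intro perm_cong; simp add: det2_def M algebra_simps)+
  then show "perm (mult2 (adjugate M) M) v = v" "perm (mult2 M (adjugate M)) v = v"
    by (simp_all add: perm_one)
qed

lemma perm_permutes:
  assumes "det2 M mod int p = 1"
  shows "perm M permutes \<iota> ` plane p"
proof (rule bij_imp_permutes)
  have closed: "perm N (\<iota> v) \<in> \<iota> ` plane p" if "v \<in> plane p" for N v
    using that p_gt_1 by (simp add: perm_\<iota> act2_plane)
  show "bij_betw (perm M) (\<iota> ` plane p) (\<iota> ` plane p)"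
    by (rule bij_betw_byWitness[where f' = "perm (adjugate M)"])
       (simp_all add: closed image_subset_iff perm_mult2 perm_adjugate[OF assms])
qed (simp add: perm_def)

lemma finite_plane: "finite (plane p)"
  by (simp add: plane_def)

lemma elt_houghton: "det2 M mod int p = 1 \<Longrightarrow> elt M \<in> carrier (houghton n)"
  unfolding elt_def using n perm_permutes finite_plane into
  by (intro finitely_supported_in_houghton[where S = "\<iota> ` plane p"]) auto

lemma elt_mult:
  assumes "det2 M mod int p = 1" "det2 N mod int p = 1"
  shows "elt M \<otimes>\<^bsub>houghton n\<^esub> elt N = elt (mult2 M N)"
  unfolding elt_def
  by (subst houghton_mult_restrict[OF assms[THEN perm_permutes] into into])
     (simp add: o_def perm_mult2)

lemma elt_cong:
  assumes "a mod int p = a' mod int p" "b mod int p = b' mod int p"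
    "c mod int p = c' mod int p" "d mod int p = d' mod int p"
  shows "elt (a, b, c, d) = elt (a', b', c', d')"
  using perm_cong[OF assms] by (simp add: elt_def)

lemma det2_mult2_mod:
  assumes "det2 M mod int p = 1" "det2 N mod int p = 1"
  shows "det2 (mult2 M N) mod int p = 1"
  using assms p_gt_1 by (metis det2_mult2 mod_mult_eq mult_1 mod_mod_trivial)

lemma subgroup_SL: "subgroup SL (houghton n)"
proof (rule group.subgroupI[OF group_houghton])
  show "SL \<subseteq> carrier (houghton n)"
    using elt_houghton by (auto simp: SL_def)
  have "elt (1, 0, 0, 1) \<in> SL"
    unfolding SL_def using p_gt_1 by (intro imageI) (simp add: det2_def)
  then show "SL \<noteq> {}"
    by auto
next
  fix f g assume "f \<in> SL" "g \<in> SL"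
  then show "f \<otimes>\<^bsub>houghton n\<^esub> g \<in> SL"
    using det2_mult2_mod by (auto simp: SL_def elt_mult)
next
  fix f assume "f \<in> SL"
  then obtain M where M: "f = elt M" "det2 M mod int p = 1"
    by (auto simp: SL_def)
  have "elt (adjugate M) \<otimes>\<^bsub>houghton n\<^esub> elt M = \<one>\<^bsub>houghton n\<^esub>"
    using M perm_adjugate(1)[OF M(2)]
    by (simp add: elt_mult det2_adjugate) (auto simp: elt_def houghton_one restrict_def)
  then have "inv\<^bsub>houghton n\<^esub> f = elt (adjugate M)"
    using M by (simp add: group.inv_equality[OF group_houghton] elt_houghton det2_adjugate)
  then show "inv\<^bsub>houghton n\<^esub> f \<in> SL"
    using M by (auto simp: SL_def det2_adjugate)
qed

lemma finite_SL: "finite SL"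
proof (rule finite_subset)
  let ?P = "{0..<int p}"
  show "SL \<subseteq> elt ` (?P \<times> ?P \<times> ?P \<times> ?P)"
  proof
    fix f assume "f \<in> SL"
    then obtain a b c d where "f = elt (a, b, c, d)"
      by (auto simp: SL_def)
    also have "\<dots> = elt (a mod int p, b mod int p, c mod int p, d mod int p)"
      by (rule elt_cong) simp_all
    finally show "f \<in> elt ` (?P \<times> ?P \<times> ?P \<times> ?P)"
      using p_gt_1 by auto
  qed
qed simp

definition U :: "int \<Rightarrow> point \<Rightarrow> point" where "U a = elt (1, a, 0, 1)"
definition L :: "int \<Rightarrow> point \<Rightarrow> point" where "L a = elt (1, 0, a, 1)"

text \<open>The group grows with \<open>p\<close>, because the unipotents \<open>U a\<close> differ in their action on
the vector \<open>(0, 1)\<close>.\<close>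

lemma card_SL: "p \<le> card SL"
proof -
  have "inj_on U {0..<int p}"
  proof (rule inj_onI)
    fix a b assume ab: "a \<in> {0..<int p}" "b \<in> {0..<int p}" "U a = U b"
    have pl: "(0, 1) \<in> plane p"
      using p_gt_1 by (simp add: plane_def)
    then have "U x (\<iota> (0, 1)) = \<iota> (x mod int p, 1)" for x
      using into p_gt_1 by (auto simp: U_def elt_def perm_\<iota> act2_def)
    with ab have "\<iota> (a mod int p, 1) = \<iota> (b mod int p, 1)"
      by metis
    then have "(a mod int p, 1::int) = (b mod int p, 1)"
      using p_gt_1 by (intro inj_onD[OF inj]) (auto simp: plane_def)
    with ab show "a = b"
      by simp
  qed
  then have "card (U ` {0..<int p}) = p"
    by (simp add: card_image)
  moreover have "U ` {0..<int p} \<subseteq> SL"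
    using p_gt_1 by (auto simp: U_def SL_def det2_def)
  ultimately show ?thesis
    using card_mono[OF finite_SL] by metis
qed

abbreviation K :: "(point \<Rightarrow> point) monoid" where
  "K \<equiv> (houghton n)\<lparr>carrier := SL\<rparr>"

lemma group_K: "group K"
  using subgroup.subgroup_is_group[OF subgroup_SL group_houghton] .

lemma inverse_mod_p:
  assumes "\<not> int p dvd a"
  obtains b where "(a * b) mod int p = 1"
proof -
  have "prime (int p)"
    using prime_p by simp
  then have "coprime a (int p)"
    using assms prime_imp_coprime coprime_commute by metis
  then obtain b c where "b * a + c * int p = 1"
    by (metis bezout_int coprime_iff_gcd_eq_1)
  then have "a * b = 1 + (- c) * int p"
    by (simp add: algebra_simps)
  then have "(a * b) mod int p = 1 mod int p"
    by (simp only: mod_mult_self1)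
  then show ?thesis
    using p_gt_1 by (intro that) simp
qed

definition inv_mod :: "int \<Rightarrow> int" where
  "inv_mod a = (SOME b. (a * b) mod int p = 1)"

lemma inv_mod: "\<not> int p dvd a \<Longrightarrow> (a * inv_mod a) mod int p = 1"
  unfolding inv_mod_def using inverse_mod_p by (metis (mono_tags, lifting) someI)

lemma mod_mult_one: "x mod int p = 1 \<Longrightarrow> (y * x) mod int p = y mod int p"
  by (metis mod_mult_right_eq mult.right_neutral)

lemma det_unipotent: "det2 (1, a, 0, 1) mod int p = 1" "det2 (1, 0, a, 1) mod int p = 1"
  using p_gt_1 by (auto simp: det2_def)

lemma one_parameter_torusI:
  assumes det: "\<And>a. det2 (m a) mod int p = 1"
    and add: "\<And>a b. mult2 (m a) (m b) = m (a + b)"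
    and mod: "\<And>a. elt (m (a mod int p)) = elt (m a)"
    and det_t: "\<And>s s'. det2 (t s s') = s * s'"
    and t: "\<And>s s' a. (s * s') mod int p = 1 \<Longrightarrow> elt (mult2 (t s s') (m a)) = elt (mult2 (m (s\<^sup>2 * a)) (t s s'))"
  shows "one_parameter_torus K p ((p - 1) div 2) (\<lambda>a. elt (m a)) (\<lambda>s. elt (t (int s) (inv_mod (int s))))"
proof (intro one_parameter_torus.intro group_K one_parameter_torus_axioms.intro)
  show "finite (carrier K)" using finite_SL by simp
  show "2 * ((p - 1) div 2) < p" using p_gt_1 by linarith
  show "elt (m a) \<in> carrier K" for a using det by (simp add: SL_def)
  show "elt (m (a + b)) = elt (m a) \<otimes>\<^bsub>K\<^esub> elt (m b)" for a b
    by (simp add: elt_mult det add)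
  show "elt (m (a mod int p)) = elt (m a)" for a by (rule mod)
  fix s assume s: "s \<in> {1..(p - 1) div 2}"
  then have "0 < s" "s < p"
    using p_gt_1 by auto
  then have "\<not> int p dvd int s"
    by (simp add: nat_dvd_not_less)
  then have s': "(int s * inv_mod (int s)) mod int p = 1"
    by (rule inv_mod)
  then have det_s: "det2 (t (int s) (inv_mod (int s))) mod int p = 1"
    by (simp add: det_t)
  then show "elt (t (int s) (inv_mod (int s))) \<in> carrier K"
    by (auto simp: SL_def)
  show "elt (t (int s) (inv_mod (int s))) \<otimes>\<^bsub>K\<^esub> elt (m a)
      = elt (m ((int s)\<^sup>2 * a)) \<otimes>\<^bsub>K\<^esub> elt (t (int s) (inv_mod (int s)))" for a
    using t[OF s'] by (simp add: elt_mult det det_s)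
qed (use prime_p in simp)

lemma one_parameter_torus_U:
  "one_parameter_torus K p ((p - 1) div 2) U (\<lambda>s. elt (int s, 0, 0, inv_mod (int s)))"
  unfolding U_def
proof (rule one_parameter_torusI)
  show "elt (mult2 (s, 0, 0, s') (1, a, 0, 1)) = elt (mult2 (1, s\<^sup>2 * a, 0, 1) (s, 0, 0, s'))"
    if "(s * s') mod int p = 1" for s s' a
    using mod_mult_one[OF that, of "s * a"] unfolding mult2_def prod.case
    by (intro elt_cong) (simp_all add: power2_eq_square mult_ac)
  show "elt (1, a mod int p, 0, 1) = elt (1, a, 0, 1)" for a
    by (rule elt_cong) simp_all
qed (use p_gt_1 in \<open>simp_all add: mult2_def det2_def add.commute\<close>)

text \<open>The lower unipotents are normalised by the same diagonal matrices. The inverse of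
\<open>diag(s, 1 / s)\<close> is assigned to \<open>s\<close> here, so that it multiplies the parameter by
the square of \<open>s\<close> again.\<close>

lemma one_parameter_torus_L:
  "one_parameter_torus K p ((p - 1) div 2) L (\<lambda>s. elt (inv_mod (int s), 0, 0, int s))"
  unfolding L_def
proof (rule one_parameter_torusI)
  show "elt (mult2 (s', 0, 0, s) (1, 0, a, 1)) = elt (mult2 (1, 0, s\<^sup>2 * a, 1) (s', 0, 0, s))"
    if "(s * s') mod int p = 1" for s s' a
    using mod_mult_one[OF that, of "s * a"] unfolding mult2_def prod.case
    by (intro elt_cong) (simp_all add: power2_eq_square mult_ac)
  show "elt (1, 0, a mod int p, 1) = elt (1, 0, a, 1)" for a
    by (rule elt_cong) simp_all
qed (use p_gt_1 in \<open>simp_all add: mult2_def det2_def add.commute\<close>)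

text \<open>A matrix whose lower left entry is a unit is a product \<open>U b\<close>, \<open>L c\<close>,
\<open>U d\<close>. One more lower unipotent makes this entry a unit, since the entries of a column cannot
both be divisible by \<open>p\<close>.\<close>

lemma four_unipotents:
  assumes "f \<in> SL"
  obtains a b c d where "f = L a \<otimes>\<^bsub>K\<^esub> U b \<otimes>\<^bsub>K\<^esub> L c \<otimes>\<^bsub>K\<^esub> U d"
proof -
  let ?q = "int p"
  have prod: "L a \<otimes>\<^bsub>K\<^esub> U b \<otimes>\<^bsub>K\<^esub> L c \<otimes>\<^bsub>K\<^esub> U d
      = elt (1 + b * c, (1 + b * c) * d + b, a + (a * b + 1) * c, (a + (a * b + 1) * c) * d + (a * b + 1))" for a b c d
  proof -
    have "L a \<otimes>\<^bsub>K\<^esub> U b = elt (1, b, a, a * b + 1)" "det2 (1, b, a, a * b + 1) mod ?q = 1"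
      using p_gt_1 by (simp_all add: L_def U_def elt_mult det_unipotent mult2_def det2_def)
    moreover have "elt (1, b, a, a * b + 1) \<otimes>\<^bsub>K\<^esub> L c = elt (1 + b * c, b, a + (a * b + 1) * c, a * b + 1)"
      "det2 (1 + b * c, b, a + (a * b + 1) * c, a * b + 1) mod ?q = 1"
      using p_gt_1 calculation(2) by (simp_all add: L_def elt_mult det_unipotent mult2_def)
        (simp add: det2_def algebra_simps)
    ultimately show ?thesis
      by (simp add: U_def elt_mult det_unipotent mult2_def)
  qed
  from assms obtain w x y z where f: "f = elt (w, x, y, z)" and det: "(w * z - x * y) mod ?q = 1"
    by (auto simp: SL_def det2_def)
  \<comment> \<open>The choice of \<open>a\<close> makes \<open>y - a w\<close>, the lower left entry of \<open>L (- a) f\<close>, a unit.\<close>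
  define a where "a = (if ?q dvd y then -1 else 0 :: int)"
  define c where "c = y - a * w"
  have "\<not> ?q dvd c"
  proof
    assume "?q dvd c"
    then have "?q dvd y \<and> ?q dvd w"
      by (cases "?q dvd y") (auto simp: c_def a_def dvd_add_right_iff)
    then have "?q dvd w * z - x * y"
      by (auto intro: dvd_diff)
    with det show False
      by simp
  qed
  then obtain e where e: "(c * e) mod ?q = 1"
    using inverse_mod_p by blast
  have cong: "?q dvd c * e - 1"
    using e p_gt_1 by (simp flip: mod_eq_dvd_iff)
  have dcong: "?q dvd w * z - x * y - 1"
    using det p_gt_1 by (simp flip: mod_eq_dvd_iff)
  \<comment> \<open>Now \<open>L (- a) f\<close> has the entries \<open>w\<close>, \<open>x\<close>, \<open>c\<close> and \<open>z - a x\<close>, and \<open>e\<close> inverts \<open>c\<close>.\<close>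
  define b where "b = (w - 1) * e"
  define d where "d = (z - a * x - 1) * e"
  have bc: "?q dvd 1 + b * c - w"
  proof -
    have "1 + b * c - w = (w - 1) * (c * e - 1)"
      by (simp add: b_def algebra_simps)
    then show ?thesis
      using cong by simp
  qed
  have cd: "?q dvd c * d - (z - a * x - 1)"
  proof -
    have "c * d - (z - a * x - 1) = (z - a * x - 1) * (c * e - 1)"
      by (simp add: d_def algebra_simps)
    then show ?thesis
      using cong by simp
  qed
  \<comment> \<open>As \<open>c\<close> is a unit, the upper right entry is determined by the others and the determinant.\<close>
  have 1: "?q dvd (1 + b * c) * d + b - x"
  proof -
    have "c * ((1 + b * c) * d + b - x) = (1 + b * c - w) * (c * d) + w * (c * d - (z - a * x - 1))
        + (w * z - x * y - 1) + (1 + b * c - w)"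
      by (simp add: c_def algebra_simps)
    then have "?q dvd c * ((1 + b * c) * d + b - x)"
      using bc cd dcong by (simp only: dvd_add dvd_mult dvd_mult2)
    moreover have "prime ?q"
      using prime_p by simp
    ultimately show ?thesis
      using \<open>\<not> ?q dvd c\<close> by (simp add: prime_dvd_mult_iff)
  qed
  have 2: "?q dvd a + (a * b + 1) * c - y"
  proof -
    have "a + (a * b + 1) * c - y = a * (1 + b * c - w)"
      by (simp add: c_def algebra_simps)
    then show ?thesis
      using bc by simp
  qed
  have 3: "?q dvd (a + (a * b + 1) * c) * d + (a * b + 1) - z"
  proof -
    have "(a + (a * b + 1) * c) * d + (a * b + 1) - z
        = a * ((1 + b * c) * d + b - x) + (c * d - (z - a * x - 1))"
      by (simp add: algebra_simps)
    then show ?thesis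
      using 1 cd by (simp only: dvd_add dvd_mult)
  qed
  have "f = L a \<otimes>\<^bsub>K\<^esub> U b \<otimes>\<^bsub>K\<^esub> L c \<otimes>\<^bsub>K\<^esub> U d"
    unfolding prod f using bc 1 2 3 by (intro elt_cong) (simp_all add: mod_eq_dvd_iff dvd_diff_commute)
  then show thesis
    by (rule that)
qed

end

lemma infinite_houghton_points:
  assumes "2 \<le> n"
  shows "infinite (houghton_points n)"
proof (cases "n = 2")
  case True
  then show ?thesis
    by (simp add: houghton_points_def finite_image_iff inj_on_def)
next
  case False
  have "inj (Ray 1)"
    by (simp add: inj_on_def)
  then have "infinite (Ray 1 ` {1..})"
    by (metis finite_imageD infinite_Ici inj_on_subset subset_UNIV)
  moreover have "Ray 1 ` {1..} \<subseteq> houghton_points n"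
    using False assms by (auto simp: houghton_points_def)
  ultimately show ?thesis
    using infinite_super by blast
qed

lemma obtain_sl2_in_houghton:
  assumes "2 \<le> n" "prime p"
  obtains \<iota> where "sl2_in_houghton n p \<iota>"
proof -
  obtain T where T: "T \<subseteq> houghton_points n" "finite T" "card T = card (plane p)"
    using infinite_arbitrarily_large[OF infinite_houghton_points[OF assms(1)]] by metis
  moreover have "finite (plane p)"
    by (simp add: plane_def)
  ultimately obtain \<iota> where "bij_betw \<iota> (plane p) T"
    using finite_same_card_bij by metis
  then have "sl2_in_houghton n p \<iota>"
    using assms T by (auto simp: sl2_in_houghton_def bij_betw_def)
  then show thesis
    by (rule that)
qed

lemma infinite_houghton:
  assumes "2 \<le> n"
  shows "infinite (carrier (houghton n))"
proof
  assume fin: "finite (carrier (houghton n))"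
  obtain p where p: "prime p" "p > card (carrier (houghton n))"
    using bigger_prime by blast
  then obtain \<iota> where "sl2_in_houghton n p \<iota>"
    using obtain_sl2_in_houghton assms by blast
  then interpret sl2_in_houghton n p \<iota> .
  have "p \<le> card (carrier (houghton n))"
    using card_SL card_mono[OF fin subgroup.subset[OF subgroup_SL]] by linarith
  with p show False by simp
qed

text \<open>The bound \<open>k\<close> is fixed first, then \<open>p\<close> such that \<open>SL(2, p)\<close> has enough
elements for \<open>2 k\<close> blocks and such that \<open>D = (p - 1) / 2\<close> exceeds
\<open>256 (2 k)\<^sup>4\<close>. The order of the whole group enters only through its restriction to this
subgroup.\<close>

lemma utww_houghton:
  assumes n: "2 \<le> n"
  shows "utww (houghton n) = \<infinity>"
proof -
  have "\<exists>g\<in>carrier (houghton n). enat k \<le> translation_stww (houghton n) r g"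
    if r: "linear_order_on (carrier (houghton n)) r" and k: "2 \<le> k" for r k
  proof -
    obtain p where p: "prime p" "p > 512 * (2 * k) ^ 4 + 2 * k + 2"
      using bigger_prime by blast
    then obtain \<iota> where "sl2_in_houghton n p \<iota>"
      using obtain_sl2_in_houghton n by blast
    then interpret sl2_in_houghton n p \<iota> .
    have "2 * k \<le> card SL"
      using p(2) card_SL by linarith
    then obtain I :: "nat \<Rightarrow> (point \<Rightarrow> point) set" and s where I:
      "\<And>i. i < 2 * k \<Longrightarrow> I i \<subseteq> SL" "\<And>i. i < 2 * k \<Longrightarrow> card (I i) = s"
      "0 < s" "card SL \<le> 2 * (2 * k) * s"
      "\<And>\<sigma>. (\<And>i j. i < 2 * k \<Longrightarrow> j < 2 * k \<Longrightarrow> \<exists>x\<in>I i. \<sigma> x \<in> I j)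
         \<Longrightarrow> enat k \<le> stww_mat (finite_mat r SL r SL (perm_mat \<sigma>))"
      using stww_mat_grid[OF r finite_SL subgroup.subset[OF subgroup_SL] k] by metis
    have "\<exists>g\<in>carrier K. \<forall>i<2 * k. \<forall>j<2 * k. \<exists>x\<in>I i. x \<otimes>\<^bsub>K\<^esub> g \<in> I j"
    proof (rule group.translate_meets_all[OF group_K one_parameter_torus_U one_parameter_torus_L])
      show "\<exists>a b c d. f = L a \<otimes>\<^bsub>K\<^esub> U b \<otimes>\<^bsub>K\<^esub> L c \<otimes>\<^bsub>K\<^esub> U d" if "f \<in> carrier K" for f
      proof -
        have "f \<in> SL"
          using that by simp
        then show ?thesis
          using four_unipotents by metis
      qed
      show "256 * (2 * k) ^ 4 < (p - 1) div 2"
        using p(2) by linarith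
    qed (use I in auto)
    then obtain g where g: "g \<in> SL" "\<forall>i<2 * k. \<forall>j<2 * k. \<exists>x\<in>I i. right_translation (houghton n) g x \<in> I j"
      by (auto simp: right_translation_def)
    have "enat k \<le> stww_mat (finite_mat r SL r SL (perm_mat (right_translation (houghton n) g)))"
      using I(5) g(2) by blast
    also have "\<dots> \<le> translation_stww (houghton n) r g"
      unfolding translation_stww_def stww_def
      using infinite_houghton[OF n] finite_SL subgroup.subset[OF subgroup_SL] g(1)
      by (auto intro!: SUP_upper2[of "(SL, SL)"])
    finally show ?thesis
      using g(1) subgroup.subset[OF subgroup_SL] by blast
  qed
  then have "enat k \<le> (SUP g\<in>carrier (houghton n). translation_stww (houghton n) r g)"
    if "linear_order_on (carrier (houghton n)) r" "2 \<le> k" for r k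
    using that by (meson SUP_upper2)
  then have large: "enat k \<le> utww (houghton n)" if "2 \<le> k" for k
    unfolding utww_def using that by (intro INF_greatest) auto
  have "utww (houghton n) \<noteq> enat m" for m
    using large[of "m + 2"] by auto
  then show ?thesis
    by (metis not_enat_eq)
qed


section \<open>Contraction along a chain of interval partitions\<close>

text \<open>A partition of \<open>{0..<m}\<close> into intervals is given by its set of cuts, where the cut
\<open>c\<close> separates \<open>c - 1\<close> from \<open>c\<close>; then \<open>block D i\<close> is
the number of the interval that contains \<open>i\<close>. An identification removes one cut, and any order of
removing the cuts is a contraction sequence.\<close>

definition block :: "nat set \<Rightarrow> nat \<Rightarrow> nat" where
  "block D i = card {c \<in> D. c \<le> i}"

text \<open>The term of a contraction sequence in which the rows and the columns have been merged along the remaining cuts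
\<open>D\<close> and \<open>E\<close>.\<close>

definition contracted :: "nat mat \<Rightarrow> nat set \<Rightarrow> nat set \<Rightarrow> nat mat" where
  "contracted A D E = mat (Suc (card D)) (Suc (card E)) (\<lambda>(k, l).
     if \<exists>i<dim_row A. \<exists>j<dim_col A. block D i = k \<and> block E j = l \<and> A $$ (i, j) = 1 then 1 else 0)"

lemma contracted_transpose: "contracted (transpose_mat A) E D = transpose_mat (contracted A D E)"
proof -
  have cell: "(\<exists>i<dim_col A. \<exists>j<dim_row A. block E i = k \<and> block D j = l \<and> transpose_mat A $$ (i, j) = 1)
      \<longleftrightarrow> (\<exists>i<dim_row A. \<exists>j<dim_col A. block D i = l \<and> block E j = k \<and> A $$ (i, j) = 1)" for k l
  proof -
    have "(\<exists>i<dim_col A. \<exists>j<dim_row A. block E i = k \<and> block D j = l \<and> transpose_mat A $$ (i, j) = 1)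
        \<longleftrightarrow> (\<exists>i<dim_col A. \<exists>j<dim_row A. block D j = l \<and> block E i = k \<and> A $$ (j, i) = 1)"
      by (rule ex_cong1, rule conj_cong[OF refl], rule ex_cong1, rule conj_cong[OF refl]) auto
    also have "\<dots> \<longleftrightarrow> (\<exists>i<dim_row A. \<exists>j<dim_col A. block D i = l \<and> block E j = k \<and> A $$ (i, j) = 1)"
      by blast
    finally show ?thesis .
  qed
  show ?thesis
    by (rule eq_matI) (simp_all only: contracted_def index_transpose_mat cell, simp_all)
qed

lemma block_full: "i < m \<Longrightarrow> block {1..<m} i = i"
proof -
  assume "i < m"
  then have "{c \<in> {1..<m}. c \<le> i} = {1..i}" by auto
  then show ?thesis by (simp add: block_def)
qed

lemma contracted_full:
  assumes "0 < dim_row A" "0 < dim_col A"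
    and "\<And>i j. i < dim_row A \<Longrightarrow> j < dim_col A \<Longrightarrow> A $$ (i, j) \<le> 1"
  shows "contracted A {1..<dim_row A} {1..<dim_col A} = A"
proof (rule eq_matI)
  fix i j assume ij: "i < dim_row A" "j < dim_col A"
  then have "(\<exists>i'<dim_row A. \<exists>j'<dim_col A. block {1..<dim_row A} i' = i \<and> block {1..<dim_col A} j' = j \<and> A $$ (i', j') = 1)
      \<longleftrightarrow> A $$ (i, j) = 1"
    using block_full by metis
  with ij assms(3)[OF ij] show "contracted A {1..<dim_row A} {1..<dim_col A} $$ (i, j) = A $$ (i, j)"
    by (auto simp: contracted_def)
qed (use assms in \<open>auto simp: contracted_def\<close>)

lemma block_le_iff:
  assumes "finite D" "c \<in> D"
  shows "block D i \<le> block D c - 1 \<longleftrightarrow> i < c" and "0 < block D c"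
proof -
  have pos: "0 < block D c"
    using assms by (auto simp: block_def card_gt_0_iff)
  then show "0 < block D c" .
  show "block D i \<le> block D c - 1 \<longleftrightarrow> i < c"
  proof
    assume "i < c"
    then have "c \<in> {x \<in> D. x \<le> c}" "c \<notin> {x \<in> D. x \<le> i}" "{x \<in> D. x \<le> i} \<subseteq> {x \<in> D. x \<le> c}"
      using assms by auto
    then have "{x \<in> D. x \<le> i} \<subset> {x \<in> D. x \<le> c}"
      by (metis psubsetI)
    then have "block D i < block D c"
      unfolding block_def using assms by (intro psubset_card_mono) auto
    then show "block D i \<le> block D c - 1"
      by simp
  next
    assume le: "block D i \<le> block D c - 1"
    show "i < c"
    proof (rule ccontr)
      assume "\<not> i < c"
      then have "block D c \<le> block D i"
        unfolding block_def using assms by (intro card_mono) auto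
      with le pos show False by simp
    qed
  qed
qed

lemma block_remove:
  assumes "finite D" "c \<in> D"
  shows "block (D - {c}) i = (if block D i \<le> block D c - 1 then block D i else block D i - 1)"
proof (cases "i < c")
  case True
  then have "{x \<in> D - {c}. x \<le> i} = {x \<in> D. x \<le> i}"
    by auto
  with True show ?thesis
    using block_le_iff[OF assms] by (simp add: block_def)
next
  case False
  then have "{x \<in> D - {c}. x \<le> i} = {x \<in> D. x \<le> i} - {c}" "c \<in> {x \<in> D. x \<le> i}"
    using assms by auto
  then have "block (D - {c}) i = block D i - 1"
    by (simp add: block_def)
  with False show ?thesis
    using block_le_iff[OF assms] by simp
qed

lemma contracted_remove_row_cut:
  assumes D: "finite D" "c \<in> D"
  shows "identification (contracted A D E) (contracted A (D - {c}) E)"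
proof -
  define q where "q = block D c - 1"
  let ?B = "contracted A D E" and ?B' = "contracted A (D - {c}) E"
  define hit where "hit D k l \<longleftrightarrow>
    (\<exists>i<dim_row A. \<exists>j<dim_col A. block D i = k \<and> block E j = l \<and> A $$ (i, j) = 1)" for D k l
  have "block D c \<le> card D"
    unfolding block_def using D by (intro card_mono) auto
  then have q: "Suc q \<le> card D" "card D = Suc (card (D - {c}))"
    using block_le_iff(2)[OF D] D by (auto simp: q_def card_Diff_singleton card_gt_0_iff)
  have remove: "block (D - {c}) i = (if block D i \<le> q then block D i else block D i - 1)" for i
    unfolding q_def by (rule block_remove[OF D])
  have hit_less: "hit (D - {c}) k l \<longleftrightarrow> hit D k l" if "k < q" for k l
  proof -
    have "block (D - {c}) i = k \<longleftrightarrow> block D i = k" for i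
      using remove[of i] that by auto
    then show ?thesis
      by (simp add: hit_def)
  qed
  have hit_eq: "hit (D - {c}) q l \<longleftrightarrow> hit D q l \<or> hit D (Suc q) l" for l
  proof -
    have "block (D - {c}) i = q \<longleftrightarrow> block D i = q \<or> block D i = Suc q" for i
      using remove[of i] by auto
    then show ?thesis
      unfolding hit_def by auto
  qed
  have hit_greater: "hit (D - {c}) k l \<longleftrightarrow> hit D (Suc k) l" if "q < k" for k l
  proof -
    have "block (D - {c}) i = k \<longleftrightarrow> block D i = Suc k" for i
      using remove[of i] that by auto
    then show ?thesis
      by (simp add: hit_def)
  qed
  have entry: "contracted A D' E $$ (k, l) = (if hit D' k l then 1 else 0)"
    if "k \<le> card D'" "l \<le> card E" for D' k l
    using that by (simp add: contracted_def hit_def)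
  have dims: "dim_row (contracted A D' E) = Suc (card D')" "dim_col (contracted A D' E) = Suc (card E)" for D'
    by (simp_all add: contracted_def)
  have "?B' = identify_rows q ?B"
  proof (rule eq_matI)
    fix k l assume "k < dim_row (identify_rows q ?B)" "l < dim_col (identify_rows q ?B)"
    then have kl: "k < card D" "k \<le> card (D - {c})" "l \<le> card E"
      using q(2) by (simp_all add: identify_rows_def dims)
    have rhs: "identify_rows q ?B $$ (k, l) = (if k < q then ?B $$ (k, l)
        else if k = q then max (?B $$ (q, l)) (?B $$ (Suc q, l)) else ?B $$ (Suc k, l))"
      using kl by (simp add: identify_rows_def dims)
    show "?B' $$ (k, l) = identify_rows q ?B $$ (k, l)"
      unfolding rhs using kl q
      by (cases k q rule: linorder_cases) (simp_all add: entry hit_less hit_eq hit_greater)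
  qed (use q in \<open>simp_all add: identify_rows_def dims\<close>)
  moreover have "Suc q < dim_row ?B"
    using q by (simp add: dims)
  ultimately show ?thesis
    unfolding identification_def by metis
qed

lemma identification_transpose:
  assumes "identification A B"
  shows "identification (transpose_mat A) (transpose_mat B)"
proof -
  have "identify_rows j (transpose_mat C) = transpose_mat (identify_cols j C)" for j C
    by (simp add: identify_cols_transpose)
  then show ?thesis
    using assms unfolding identification_def index_transpose_mat
    by (metis identify_cols_transpose transpose_transpose)
qed

lemma contracted_remove_col_cut:
  assumes "finite E" "c \<in> E"
  shows "identification (contracted A D E) (contracted A D (E - {c}))"
  using identification_transpose[OF contracted_remove_row_cut[OF assms, of "transpose_mat A" D]]
  by (simp add: contracted_transpose)

definition narrow :: "nat \<Rightarrow> nat mat \<Rightarrow> bool" where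
  "narrow K A \<longleftrightarrow> (\<forall>i<dim_row A. row_ones A i \<le> K) \<and> (\<forall>j<dim_col A. col_ones A j \<le> K)"

abbreviation narrow_step :: "nat \<Rightarrow> nat mat \<Rightarrow> nat mat \<Rightarrow> bool" where
  "narrow_step K A B \<equiv> identification A B \<and> narrow K B"

lemma stww_mat_le_narrow_steps:
  assumes "(narrow_step K)\<^sup>*\<^sup>* A B" "narrow K A" "B \<in> carrier_mat 1 1"
  shows "stww_mat A \<le> enat K"
proof -
  have "\<exists>As. contraction_sequence A As \<and> (\<forall>C\<in>set As. narrow K C)"
    using assms(1,2)
  proof (induction rule: converse_rtranclp_induct)
    case base
    then have "contraction_sequence B [B] \<and> (\<forall>C\<in>set [B]. narrow K C)"
      using assms(3) by (simp add: contraction_sequence_def)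
    then show ?case ..
  next
    case (step A A')
    then obtain As where As: "contraction_sequence A' As" "\<forall>C\<in>set As. narrow K C"
      by metis
    have "contraction_sequence A (A # As)"
      using step.hyps(1) As(1) by (cases As) (simp_all add: contraction_sequence_def)
    moreover have "\<forall>C\<in>set (A # As). narrow K C"
      using As(2) step.prems by simp
    ultimately show ?case
      by metis
  qed
  then obtain As where As: "contraction_sequence A As" "\<forall>C\<in>set As. narrow K C"
    by blast
  let ?W = "\<Union>A\<in>set As. row_ones A ` {..<dim_row A} \<union> col_ones A ` {..<dim_col A}"
  have "last As \<in> set As" "last As \<in> carrier_mat 1 1"
    using As(1) by (auto simp: contraction_sequence_def)
  then have "row_ones (last As) 0 \<in> ?W"
    by (intro UN_I[of "last As"] UnI1 imageI) auto
  then have "?W \<noteq> {}"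
    by (metis empty_iff)
  moreover have "w \<le> K" if "w \<in> ?W" for w
  proof -
    from that obtain C where "C \<in> set As" "w \<in> row_ones C ` {..<dim_row C} \<union> col_ones C ` {..<dim_col C}"
      by (rule UN_E)
    then show ?thesis
      using As(2) by (auto simp: narrow_def)
  qed
  moreover have "finite ?W"
    by auto
  ultimately have "width As \<le> K"
    unfolding width_def by (intro Max.boundedI)
  then have "enat (width As) \<le> enat K"
    by simp
  with As(1) show ?thesis
    unfolding stww_mat_def by (intro INF_lower2[of As]) auto
qed

text \<open>This bounds the number of ones in the rows of \<open>contracted A D E\<close>; its columns are treated by
transposing.\<close>

definition thin :: "nat \<Rightarrow> nat mat \<Rightarrow> nat set \<Rightarrow> nat set \<Rightarrow> bool" where
  "thin K A D E \<longleftrightarrow> (\<forall>i0<dim_row A.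
     card (block E ` {j. j < dim_col A \<and> (\<exists>i<dim_row A. block D i = block D i0 \<and> A $$ (i, j) = 1)}) \<le> K)"

lemma block_eq_mono:
  assumes "finite D" "D' \<subseteq> D" "block D i = block D j"
  shows "block D' i = block D' j"
proof -
  have *: "block D' i = block D' j" if "i \<le> j" "block D i = block D j" for i j
  proof -
    have "{c \<in> D. c \<le> i} = {c \<in> D. c \<le> j}"
      using that assms(1) by (intro card_subset_eq) (auto simp: block_def)
    moreover have "{c \<in> D'. c \<le> k} = D' \<inter> {c \<in> D. c \<le> k}" for k
      using assms(2) by auto
    ultimately show ?thesis
      by (simp only: block_def)
  qed
  show ?thesis
  proof (cases "i \<le> j")
    case True
    then show ?thesis using assms(3) by (rule *)
  next
    case False
    then have "j \<le> i" by simp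
    then show ?thesis using assms(3)[symmetric] by (rule *[symmetric])
  qed
qed

lemma card_image_le_if_determined:
  assumes "finite S" "\<And>x y. x \<in> S \<Longrightarrow> y \<in> S \<Longrightarrow> f x = f y \<Longrightarrow> g x = g y"
  shows "card (g ` S) \<le> card (f ` S)"
proof -
  have "g ` S = (\<lambda>v. g (inv_into S f v)) ` f ` S"
  proof -
    have "g (inv_into S f (f x)) = g x" if "x \<in> S" for x
      using that assms(2)[of "inv_into S f (f x)" x] by (simp add: f_inv_into_f inv_into_into)
    then show ?thesis
      by (simp add: image_image)
  qed
  then show ?thesis
    using assms(1) by (simp add: card_image_le)
qed

text \<open>Refining the rows and coarsening the columns preserves thinness. Therefore a bound for coarse rows against
fine columns, and one for coarse columns against fine rows, controls all matrices that occur between a fine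
and a coarse pair of partitions.\<close>

lemma thin_mono:
  assumes "thin K A D E" "finite D'" "D \<subseteq> D'" "finite E" "E' \<subseteq> E"
  shows "thin K A D' E'"
  unfolding thin_def
proof (intro allI impI)
  fix i0 assume i0: "i0 < dim_row A"
  let ?S = "\<lambda>D. {j. j < dim_col A \<and> (\<exists>i<dim_row A. block D i = block D i0 \<and> A $$ (i, j) = 1)}"
  have "?S D' \<subseteq> ?S D"
  proof
    fix j assume "j \<in> ?S D'"
    then obtain i where "j < dim_col A" "i < dim_row A" "block D' i = block D' i0" "A $$ (i, j) = 1"
      by auto
    moreover from this have "block D i = block D i0"
      by (intro block_eq_mono[OF assms(2,3)])
    ultimately show "j \<in> ?S D"
      by auto
  qed
  then have "card (block E' ` ?S D') \<le> card (block E' ` ?S D)"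
    by (intro card_mono image_mono) auto
  also have "\<dots> \<le> card (block E ` ?S D)"
    by (rule card_image_le_if_determined) (simp, rule block_eq_mono[OF assms(4,5)])
  also have "\<dots> \<le> K"
    using assms(1) i0 by (simp add: thin_def)
  finally show "card (block E' ` ?S D') \<le> K" .
qed

lemma row_ones_contracted:
  assumes "thin K A D E" "k < dim_row (contracted A D E)"
  shows "row_ones (contracted A D E) k \<le> K"
proof -
  let ?ones = "{l. l < dim_col (contracted A D E) \<and> contracted A D E $$ (k, l) = 1}"
  have entry: "\<exists>i<dim_row A. \<exists>j<dim_col A. block D i = k \<and> block E j = l \<and> A $$ (i, j) = 1"
    if "l < dim_col (contracted A D E)" "contracted A D E $$ (k, l) = 1" for l
  proof (rule ccontr)
    assume "\<not> ?thesis"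
    then have "contracted A D E $$ (k, l) = 0"
      using that(1) assms(2) by (simp add: contracted_def)
    with that(2) show False
      by simp
  qed
  show ?thesis
  proof (cases "\<exists>i0<dim_row A. block D i0 = k")
    case True
    then obtain i0 where i0: "i0 < dim_row A" "block D i0 = k"
      by blast
    let ?hit = "block E ` {j. j < dim_col A \<and> (\<exists>i<dim_row A. block D i = block D i0 \<and> A $$ (i, j) = 1)}"
    have "?ones \<subseteq> ?hit"
    proof
      fix l assume "l \<in> ?ones"
      then obtain i j where "i < dim_row A" "j < dim_col A" "block D i = k" "block E j = l" "A $$ (i, j) = 1"
        using entry[of l] by auto
      then show "l \<in> ?hit"
        by (intro image_eqI[of _ _ j]) (auto simp: i0(2))
    qed
    then have "row_ones (contracted A D E) k
        \<le> card ?hit"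
      unfolding row_ones_def by (rule card_mono[rotated]) simp
    also have "\<dots> \<le> K"
      using assms(1) i0(1) unfolding thin_def by (elim allE[of _ i0] impE)
    finally show ?thesis .
  next
    case False
    have "?ones = {}"
    proof (rule equals0I)
      fix l assume "l \<in> ?ones"
      then obtain i where "i < dim_row A" "block D i = k"
        using entry[of l] by auto
      with False show False by blast
    qed
    then show ?thesis
      by (simp only: row_ones_def card.empty)
  qed
qed

lemma narrow_contracted:
  assumes "thin K A D E" "thin K (transpose_mat A) E D"
  shows "narrow K (contracted A D E)"
proof -
  have "col_ones (contracted A D E) j \<le> K" if "j < dim_col (contracted A D E)" for j
  proof -
    have "row_ones (contracted (transpose_mat A) E D) j \<le> K"
      using assms(2) that by (intro row_ones_contracted) (auto simp: contracted_transpose)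
    with that show ?thesis
      by (simp add: contracted_transpose row_ones_transpose)
  qed
  then show ?thesis
    using row_ones_contracted[OF assms(1)] by (simp add: narrow_def)
qed

text \<open>The cuts can be removed in any order, and by \<open>thin_mono\<close> the width stays bounded throughout.\<close>

lemma contract_cuts:
  assumes fin: "finite D" "finite E" and sub: "D' \<subseteq> D" "E' \<subseteq> E"
    and thin: "thin K A D' E" "thin K (transpose_mat A) E' D"
  shows "(narrow_step K)\<^sup>*\<^sup>* (contracted A D E) (contracted A D' E')"
  using assms
proof (induction "card (D - D') + card (E - E')" arbitrary: D E)
  case 0
  then have "D = D'" "E = E'"
    by auto
  then show ?case by simp
next
  case (Suc k)
  have narrow: "narrow K (contracted A X Y)" if "D' \<subseteq> X" "X \<subseteq> D" "E' \<subseteq> Y" "Y \<subseteq> E" for X Y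
  proof (rule narrow_contracted)
    have "finite X" "finite Y"
      using finite_subset[OF that(2) Suc.prems(1)] finite_subset[OF that(4) Suc.prems(2)] .
    then show "thin K A X Y" "thin K (transpose_mat A) Y X"
      using that Suc.prems by (auto intro: thin_mono)
  qed
  consider c where "c \<in> D" "c \<notin> D'" | c where "c \<in> E" "c \<notin> E'"
    using Suc.hyps(2) by (metis Diff_eq_empty_iff add_is_0 card.empty nat.distinct(1) subsetI)
  then show ?case
  proof cases
    case 1
    have "D - {c} - D' = (D - D') - {c}" "c \<in> D - D'"
      using 1 by auto
    then have "k = card (D - {c} - D') + card (E - E')"
      using Suc.hyps(2) Suc.prems(1) card_Suc_Diff1[of "D - D'" c] by simp
    moreover have "thin K (transpose_mat A) E' (D - {c})"
      by (rule thin_mono[OF Suc.prems(6)]) (use Suc.prems finite_subset in auto)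
    ultimately have "(narrow_step K)\<^sup>*\<^sup>* (contracted A (D - {c}) E) (contracted A D' E')"
      using Suc.prems 1 by (intro Suc.hyps(1)) auto
    moreover have "narrow_step K (contracted A D E) (contracted A (D - {c}) E)"
      using contracted_remove_row_cut[OF Suc.prems(1) 1(1)] narrow[of "D - {c}" E] 1 Suc.prems by auto
    ultimately show ?thesis
      by (rule converse_rtranclp_into_rtranclp[rotated])
  next
    case 2
    have "E - {c} - E' = (E - E') - {c}" "c \<in> E - E'"
      using 2 by auto
    then have "k = card (D - D') + card (E - {c} - E')"
      using Suc.hyps(2) Suc.prems(2) card_Suc_Diff1[of "E - E'" c] by simp
    moreover have "thin K A D' (E - {c})"
      by (rule thin_mono[OF Suc.prems(5)]) (use Suc.prems finite_subset in auto)
    ultimately have "(narrow_step K)\<^sup>*\<^sup>* (contracted A D (E - {c})) (contracted A D' E')"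
      using Suc.prems 2 by (intro Suc.hyps(1)) auto
    moreover have "narrow_step K (contracted A D E) (contracted A D (E - {c}))"
      using contracted_remove_col_cut[OF Suc.prems(2) 2(1)] narrow[of D "E - {c}"] 2 Suc.prems by auto
    ultimately show ?thesis
      by (rule converse_rtranclp_into_rtranclp[rotated])
  qed
qed

text \<open>Interval partitions are described by labels: two elements lie in the same part if their labels agree.
Convexity says that the parts are intervals of the list.\<close>

definition label_cuts :: "('a \<Rightarrow> 'l) \<Rightarrow> 'a list \<Rightarrow> nat set" where
  "label_cuts f xs = {c \<in> {1..<length xs}. f (xs ! (c - 1)) \<noteq> f (xs ! c)}"

definition convex_labels :: "('a \<Rightarrow> 'l) \<Rightarrow> 'a list \<Rightarrow> bool" where
  "convex_labels f xs \<longleftrightarrow> (\<forall>i j k. i < j \<longrightarrow> j < k \<longrightarrow> k < length xs \<longrightarrow> f (xs ! i) = f (xs ! k) \<longrightarrow> f (xs ! j) = f (xs ! k))"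

lemma finite_label_cuts: "finite (label_cuts f xs)"
  by (simp add: label_cuts_def)

lemma block_label_cuts_less:
  assumes conv: "convex_labels f xs" and ij: "i < j" "j < length xs"
  shows "block (label_cuts f xs) i = block (label_cuts f xs) j \<longleftrightarrow> f (xs ! i) = f (xs ! j)"
proof
  let ?D = "label_cuts f xs"
  assume "block ?D i = block ?D j"
  then have cuts: "{c \<in> ?D. c \<le> i} = {c \<in> ?D. c \<le> j}"
    using ij finite_label_cuts[of f xs] by (intro card_subset_eq) (auto simp: block_def)
  have no: "f (xs ! (c - 1)) = f (xs ! c)" if "i < c" "c \<le> j" for c
  proof (rule ccontr)
    assume "f (xs ! (c - 1)) \<noteq> f (xs ! c)"
    then have "c \<in> {c \<in> ?D. c \<le> j}"
      using that ij by (simp add: label_cuts_def)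
    then have "c \<in> {c \<in> ?D. c \<le> i}"
      by (simp only: cuts)
    with that(1) show False
      by simp
  qed
  have "f (xs ! i) = f (xs ! k)" if "i \<le> k" "k \<le> j" for k
    using that
  proof (induction k rule: dec_induct)
    case (step k)
    then show ?case
      using no[of "Suc k"] by simp
  qed simp
  then show "f (xs ! i) = f (xs ! j)"
    using ij by simp
next
  let ?D = "label_cuts f xs"
  assume eq: "f (xs ! i) = f (xs ! j)"
  have const: "f (xs ! k) = f (xs ! j)" if "i \<le> k" "k \<le> j" for k
    using conv eq that ij unfolding convex_labels_def by (metis le_neq_implies_less)
  have "c \<le> i" if "c \<in> ?D" "c \<le> j" for c
  proof (rule ccontr)
    assume "\<not> c \<le> i"
    then have "f (xs ! (c - 1)) = f (xs ! c)"
      using const[of "c - 1"] const[of c] that(2) by simp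
    with that show False
      by (simp add: label_cuts_def)
  qed
  then have "{c \<in> ?D. c \<le> i} = {c \<in> ?D. c \<le> j}"
    using ij by auto
  then show "block ?D i = block ?D j"
    by (simp add: block_def)
qed

lemma block_label_cuts:
  assumes "convex_labels f xs" "i < length xs" "j < length xs"
  shows "block (label_cuts f xs) i = block (label_cuts f xs) j \<longleftrightarrow> f (xs ! i) = f (xs ! j)"
proof (cases i j rule: linorder_cases)
  case less
  then show ?thesis using assms(3) by (rule block_label_cuts_less[OF assms(1)])
next
  case greater
  then have "block (label_cuts f xs) j = block (label_cuts f xs) i \<longleftrightarrow> f (xs ! j) = f (xs ! i)"
    using assms(2) by (rule block_label_cuts_less[OF assms(1)])
  then show ?thesis by (simp only: eq_commute)
qed simp

text \<open>Thinness in terms of labels. It asks for a small set of candidates instead of bounding the number of labels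
that occur, since such a set can be read off from the class of \<open>x0\<close>.\<close>

definition few_labels ::
    "nat \<Rightarrow> 'a list \<Rightarrow> 'b list \<Rightarrow> ('a \<Rightarrow> 'b \<Rightarrow> nat) \<Rightarrow> ('a \<Rightarrow> 'l) \<Rightarrow> ('b \<Rightarrow> 'm) \<Rightarrow> bool" where
  "few_labels K xs ys M f g \<longleftrightarrow> (\<forall>x0\<in>set xs. \<exists>S. finite S \<and> card S \<le> K \<and>
     (\<forall>x\<in>set xs. \<forall>y\<in>set ys. f x = f x0 \<longrightarrow> M x y = 1 \<longrightarrow> g y \<in> S))"

lemma thin_label_cuts:
  assumes f: "convex_labels f xs" and g: "convex_labels g ys"
    and few: "few_labels K xs ys M f g"
    and dim: "dim_row A = length xs" "dim_col A = length ys"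
    and A: "\<And>i j. i < length xs \<Longrightarrow> j < length ys \<Longrightarrow> A $$ (i, j) = M (xs ! i) (ys ! j)"
  shows "thin K A (label_cuts f xs) (label_cuts g ys)"
  unfolding thin_def dim
proof (intro allI impI)
  fix i0 assume i0: "i0 < length xs"
  let ?J = "{j. j < length ys \<and> (\<exists>i<length xs. block (label_cuts f xs) i = block (label_cuts f xs) i0 \<and> A $$ (i, j) = 1)}"
  obtain S where S: "finite S" "card S \<le> K"
    "\<And>x y. x \<in> set xs \<Longrightarrow> y \<in> set ys \<Longrightarrow> f x = f (xs ! i0) \<Longrightarrow> M x y = 1 \<Longrightarrow> g y \<in> S"
    using few[unfolded few_labels_def, rule_format, of "xs ! i0"] i0 by auto
  have "card (block (label_cuts g ys) ` ?J) \<le> card ((\<lambda>j. g (ys ! j)) ` ?J)"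
    using block_label_cuts[OF g] by (intro card_image_le_if_determined) auto
  also have "\<dots> \<le> card S"
  proof (rule card_mono[OF S(1)], rule image_subsetI)
    fix j assume "j \<in> ?J"
    then obtain i where "i < length xs" "j < length ys"
      "block (label_cuts f xs) i = block (label_cuts f xs) i0" "A $$ (i, j) = 1"
      by auto
    then show "g (ys ! j) \<in> S"
      using S(3)[of "xs ! i" "ys ! j"] block_label_cuts[OF f _ i0, of i] A[of i j] by simp
  qed
  also have "\<dots> \<le> K"
    by (rule S(2))
  finally show "card (block (label_cuts g ys) ` ?J) \<le> K" .
qed

definition coarser :: "'a list \<Rightarrow> ('a \<Rightarrow> 'l) \<Rightarrow> ('a \<Rightarrow> 'l) \<Rightarrow> bool" where
  "coarser xs f f' \<longleftrightarrow> (\<forall>x\<in>set xs. \<forall>x'\<in>set xs. f x = f x' \<longrightarrow> f' x = f' x')"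

text \<open>A step may merge many parts at once, as long as the new rows see few of the old columns and the new columns
few of the old rows; this is what \<open>contract_cuts\<close> needs to interpolate single identifications.\<close>

definition coarsening_step ::
    "nat \<Rightarrow> 'a list \<Rightarrow> 'b list \<Rightarrow> ('a \<Rightarrow> 'b \<Rightarrow> nat) \<Rightarrow> ('a \<Rightarrow> 'l) \<times> ('b \<Rightarrow> 'l) \<Rightarrow> ('a \<Rightarrow> 'l) \<times> ('b \<Rightarrow> 'l) \<Rightarrow> bool" where
  "coarsening_step K xs ys M p p' \<longleftrightarrow>
     convex_labels (fst p') xs \<and> convex_labels (snd p') ys \<and>
     coarser xs (fst p) (fst p') \<and> coarser ys (snd p) (snd p') \<and>
     few_labels K xs ys M (fst p') (snd p) \<and> few_labels K ys xs (\<lambda>y x. M x y) (snd p') (fst p)"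

lemma label_cuts_coarser:
  assumes "coarser xs f f'"
  shows "label_cuts f' xs \<subseteq> label_cuts f xs"
proof
  fix c assume "c \<in> label_cuts f' xs"
  then have c: "c \<in> {1..<length xs}" "f' (xs ! (c - 1)) \<noteq> f' (xs ! c)"
    by (simp_all add: label_cuts_def)
  then have "xs ! (c - 1) \<in> set xs" "xs ! c \<in> set xs"
    by (auto intro!: nth_mem)
  then have "f (xs ! (c - 1)) \<noteq> f (xs ! c)"
    using c(2) assms unfolding coarser_def by metis
  with c(1) show "c \<in> label_cuts f xs"
    by (simp add: label_cuts_def)
qed

lemma label_cuts_inj:
  assumes "inj_on f (set xs)" "distinct xs"
  shows "label_cuts f xs = {1..<length xs}"
proof -
  have "f (xs ! (c - 1)) \<noteq> f (xs ! c)" if "c \<in> {1..<length xs}" for c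
  proof
    assume "f (xs ! (c - 1)) = f (xs ! c)"
    then have "xs ! (c - 1) = xs ! c"
      using that by (intro inj_onD[OF assms(1)]) auto
    then have "c - 1 = c"
      using that assms(2) by (subst (asm) nth_eq_iff_index_eq) auto
    moreover have "1 \<le> c"
      using that by simp
    ultimately show False by linarith
  qed
  then show ?thesis
    by (auto simp: label_cuts_def)
qed

lemma label_cuts_const:
  assumes "\<And>x x'. x \<in> set xs \<Longrightarrow> x' \<in> set xs \<Longrightarrow> f x = f x'"
  shows "label_cuts f xs = {}"
proof -
  have "f (xs ! (c - 1)) = f (xs ! c)" if "c \<in> {1..<length xs}" for c
    using that by (intro assms nth_mem) auto
  then show ?thesis
    by (auto simp: label_cuts_def)
qed

lemma coarsening_narrow_steps:
  assumes steps: "(coarsening_step K xs ys M)\<^sup>*\<^sup>* p p'"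
    and conv: "convex_labels (fst p) xs" "convex_labels (snd p) ys"
    and dim: "dim_row A = length xs" "dim_col A = length ys"
    and A: "\<And>i j. i < length xs \<Longrightarrow> j < length ys \<Longrightarrow> A $$ (i, j) = M (xs ! i) (ys ! j)"
  shows "(narrow_step K)\<^sup>*\<^sup>* (contracted A (label_cuts (fst p) xs) (label_cuts (snd p) ys))
           (contracted A (label_cuts (fst p') xs) (label_cuts (snd p') ys))"
  using steps conv
proof (induction rule: converse_rtranclp_induct)
  case base
  show ?case by (rule rtranclp.rtrancl_refl)
next
  case (step p q)
  note s = step.hyps(1)[unfolded coarsening_step_def]
  have "(narrow_step K)\<^sup>*\<^sup>* (contracted A (label_cuts (fst p) xs) (label_cuts (snd p) ys))
           (contracted A (label_cuts (fst q) xs) (label_cuts (snd q) ys))"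
  proof (rule contract_cuts[OF finite_label_cuts finite_label_cuts])
    show "label_cuts (fst q) xs \<subseteq> label_cuts (fst p) xs" "label_cuts (snd q) ys \<subseteq> label_cuts (snd p) ys"
      using s by (simp_all only: label_cuts_coarser)
    show "thin K A (label_cuts (fst q) xs) (label_cuts (snd p) ys)"
      using s step.prems(2) dim A by (intro thin_label_cuts[where M = M]) simp_all
    show "thin K (transpose_mat A) (label_cuts (snd q) ys) (label_cuts (fst p) xs)"
      using s step.prems(1) dim A by (intro thin_label_cuts[where M = "\<lambda>y x. M x y"]) simp_all
  qed
  moreover have "(narrow_step K)\<^sup>*\<^sup>* (contracted A (label_cuts (fst q) xs) (label_cuts (snd q) ys))
      (contracted A (label_cuts (fst p') xs) (label_cuts (snd p') ys))"
    using s by (intro step.IH) simp_all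
  ultimately show ?case
    by (rule rtranclp_trans)
qed

text \<open>A chain of coarsening steps from singletons to a single part bounds the strict twin-width. The hypothesis
\<open>start\<close>, a step that changes nothing, bounds the width of the initial matrix.\<close>

theorem stww_mat_le_coarsening:
  fixes f :: "'a \<Rightarrow> 'l" and g :: "'b \<Rightarrow> 'l"
  assumes r: "linear_order_on X r" "finite R" "R \<subseteq> X" "R \<noteq> {}"
    and c: "linear_order_on Y c" "finite C" "C \<subseteq> Y" "C \<noteq> {}"
    and M: "\<And>x y. M x y \<le> 1"
    and steps: "(coarsening_step K (ordered_list r R) (ordered_list c C) M)\<^sup>*\<^sup>* (f, g) (f', g')"
    and start: "coarsening_step K (ordered_list r R) (ordered_list c C) M (f, g) (f, g)"
    and inj: "inj_on f R" "inj_on g C"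
    and const: "\<And>x x'. x \<in> R \<Longrightarrow> x' \<in> R \<Longrightarrow> f' x = f' x'" "\<And>y y'. y \<in> C \<Longrightarrow> y' \<in> C \<Longrightarrow> g' y = g' y'"
  shows "stww_mat (finite_mat r R c C M) \<le> enat K"
proof -
  let ?A = "finite_mat r R c C M"
  define xs where "xs = ordered_list r R"
  define ys where "ys = ordered_list c C"
  have xs: "set xs = R" "distinct xs" "length xs = card R"
    unfolding xs_def by (rule ordered_list[OF r(1-3)])+
  have ys: "set ys = C" "distinct ys" "length ys = card C"
    unfolding ys_def by (rule ordered_list[OF c(1-3)])+
  have dim: "dim_row ?A = length xs" "dim_col ?A = length ys"
    by (simp_all add: finite_mat_def xs ys)
  have A: "?A $$ (i, j) = M (xs ! i) (ys ! j)" if "i < length xs" "j < length ys" for i j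
    using that by (simp add: finite_mat_def xs_def[symmetric] ys_def[symmetric] xs(3) ys(3))
  have s: "convex_labels f xs" "convex_labels g ys" "few_labels K xs ys M f g" "few_labels K ys xs (\<lambda>y x. M x y) g f"
    using start unfolding coarsening_step_def xs_def ys_def by simp_all
  have cuts_f: "label_cuts f xs = {1..<length xs}"
    using inj(1) xs(1,2) by (intro label_cuts_inj) simp_all
  have cuts_g: "label_cuts g ys = {1..<length ys}"
    using inj(2) ys(1,2) by (intro label_cuts_inj) simp_all
  have full: "contracted ?A (label_cuts f xs) (label_cuts g ys) = ?A"
    unfolding cuts_f cuts_g dim[symmetric]
  proof (rule contracted_full)
    show "0 < dim_row ?A" "0 < dim_col ?A"
      using r c by (simp_all add: finite_mat_def card_gt_0_iff)
    show "?A $$ (i, j) \<le> 1" if "i < dim_row ?A" "j < dim_col ?A" for i j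
      using that A[of i j] M by (simp only: dim)
  qed
  have "(narrow_step K)\<^sup>*\<^sup>* (contracted ?A (label_cuts f xs) (label_cuts g ys))
      (contracted ?A (label_cuts f' xs) (label_cuts g' ys))"
    using coarsening_narrow_steps[OF steps[folded xs_def ys_def] _ _ dim A] s(1,2)
    unfolding fst_conv snd_conv .
  then have "(narrow_step K)\<^sup>*\<^sup>* ?A (contracted ?A (label_cuts f' xs) (label_cuts g' ys))"
    unfolding full .
  moreover have "narrow K ?A"
  proof -
    have "thin K ?A (label_cuts f xs) (label_cuts g ys)"
      by (rule thin_label_cuts[OF s(1,2,3) dim A])
    moreover have "thin K (transpose_mat ?A) (label_cuts g ys) (label_cuts f xs)"
      by (rule thin_label_cuts[OF s(2,1,4)]) (simp_all add: dim A)
    ultimately have "narrow K (contracted ?A (label_cuts f xs) (label_cuts g ys))"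
      by (rule narrow_contracted)
    then show ?thesis
      by (simp only: full)
  qed
  moreover have "contracted ?A (label_cuts f' xs) (label_cuts g' ys) \<in> carrier_mat 1 1"
  proof -
    have "label_cuts f' xs = {}" "label_cuts g' ys = {}"
      using const xs(1) ys(1) by (auto intro!: label_cuts_const)
    then show ?thesis
      by (simp add: contracted_def)
  qed
  ultimately show ?thesis
    by (rule stww_mat_le_narrow_steps)
qed


section \<open>Maps of words that are almost monotone on letters\<close>

definition lex_less :: "(nat \<Rightarrow> real) \<Rightarrow> (nat \<Rightarrow> real) \<Rightarrow> bool" where
  "lex_less f g \<longleftrightarrow> (\<exists>p. (\<forall>q<p. f q = g q) \<and> f p < g p)"

lemma lex_less_irrefl: "\<not> lex_less f f"
  by (simp add: lex_less_def)

lemma lex_less_trans: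
  assumes "lex_less f g" "lex_less g h"
  shows "lex_less f h"
proof -
  obtain p where p: "\<And>q. q < p \<Longrightarrow> f q = g q" "f p < g p"
    using assms(1) unfolding lex_less_def by metis
  obtain p' where p': "\<And>q. q < p' \<Longrightarrow> g q = h q" "g p' < h p'"
    using assms(2) unfolding lex_less_def by metis
  have "f q = h q" if "q < min p p'" for q
    using that p(1)[of q] p'(1)[of q] by simp
  moreover have "f (min p p') < h (min p p')"
    using p p'(1)[of p] p'(2) p(1)[of p'] by (cases p p' rule: linorder_cases) simp_all
  ultimately show ?thesis
    unfolding lex_less_def by (intro exI[of _ "min p p'"]) simp
qed

lemma lex_less_total:
  assumes "f \<noteq> g"
  shows "lex_less f g \<or> lex_less g f"
proof -
  have "\<exists>p. f p \<noteq> g p"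
    using assms by auto
  define p where "p = (LEAST p. f p \<noteq> g p)"
  have "f p \<noteq> g p"
    unfolding p_def using \<open>\<exists>p. f p \<noteq> g p\<close> by (rule LeastI_ex)
  moreover have "f q = g q" if "q < p" for q
    using not_less_Least[of q "\<lambda>p. f p \<noteq> g p"] that unfolding p_def by simp
  ultimately show ?thesis
    unfolding lex_less_def by (cases "f p < g p") (auto intro!: exI[of _ p])
qed

text \<open>A word between two words with a common prefix of length \<open>d\<close> has the same prefix, and its next
letter lies between theirs. So words that agree on a prefix, and whose next letters lie in an interval, form
an interval of the lexicographic order.\<close>

lemma lex_less_between:
  assumes "lex_less f g" "lex_less g h" "\<And>q. q < d \<Longrightarrow> f q = h q"
  shows "\<And>q. q < d \<Longrightarrow> g q = f q" and "f d \<le> g d" and "g d \<le> h d"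
proof -
  obtain p where p: "\<And>q. q < p \<Longrightarrow> f q = g q" "f p < g p"
    using assms(1) unfolding lex_less_def by metis
  obtain p' where p': "\<And>q. q < p' \<Longrightarrow> g q = h q" "g p' < h p'"
    using assms(2) unfolding lex_less_def by metis
  have dp: "d \<le> p"
  proof (rule ccontr)
    assume "\<not> d \<le> p"
    then show False
      using p(2) p'(1)[of p] p'(2) p(1)[of p'] assms(3)[of p] assms(3)[of p']
      by (cases p p' rule: linorder_cases) simp_all
  qed
  then show eq: "g q = f q" if "q < d" for q
    using p(1)[of q] that by simp
  have dp': "d \<le> p'"
  proof (rule ccontr)
    assume "\<not> d \<le> p'"
    then show False
      using p'(2) eq[of p'] assms(3)[of p'] by simp
  qed
  show "f d \<le> g d"
    using dp p(1)[of d] p(2) by (cases "d = p") simp_all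
  show "g d \<le> h d"
    using dp' p'(1)[of d] p'(2) by (cases "d = p'") simp_all
qed

definition word_order :: "'a set \<Rightarrow> ('a \<Rightarrow> nat \<Rightarrow> real) \<Rightarrow> 'a rel" where
  "word_order X W = {(x, y). x \<in> X \<and> y \<in> X \<and> (x = y \<or> lex_less (W x) (W y))}"

lemma word_orderD: "(x, y) \<in> word_order X W \<Longrightarrow> x \<noteq> y \<Longrightarrow> lex_less (W x) (W y)"
  by (simp add: word_order_def)

lemma linear_order_word_order:
  assumes "inj_on W X"
  shows "linear_order_on X (word_order X W)"
  unfolding linear_order_on_def partial_order_on_def preorder_on_def
proof (intro conjI)
  show "refl_on X (word_order X W)"
    by (auto simp: refl_on_def word_order_def)
  show "trans (word_order X W)"
    by (auto simp: trans_def word_order_def dest: lex_less_trans)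
  show "antisym (word_order X W)"
    using lex_less_trans lex_less_irrefl unfolding antisym_def word_order_def by blast
  show "total_on X (word_order X W)"
    using assms lex_less_total unfolding total_on_def word_order_def inj_on_def by blast
qed (auto simp: word_order_def)

text \<open>Words with the same label agree on the first \<open>d\<close> letters, and their letters number
\<open>d\<close> are equal or both belong to the set \<open>I\<close> of letters that have been merged. The
value \<open>0\<close> beyond the prefix is a dummy that makes labels comparable as functions.\<close>

definition letter_label :: "('a \<Rightarrow> nat \<Rightarrow> real) \<Rightarrow> nat \<Rightarrow> real set \<Rightarrow> 'a \<Rightarrow> (nat \<Rightarrow> real) \<times> real option" where
  "letter_label W d I x = (\<lambda>p. if p < d then W x p else 0, if W x d \<in> I then None else Some (W x d))"

lemma letter_label_eq_iff:
  "letter_label W d I x = letter_label W d I y \<longleftrightarrow>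
     (\<forall>p<d. W x p = W y p) \<and> (W x d \<in> I \<and> W y d \<in> I \<or> W x d \<notin> I \<and> W y d \<notin> I \<and> W x d = W y d)"
  by (auto simp: letter_label_def fun_eq_iff)

definition lower :: "real set \<Rightarrow> bool" where
  "lower I \<longleftrightarrow> (\<forall>a b. a \<le> b \<longrightarrow> b \<in> I \<longrightarrow> a \<in> I)"

lemma convex_letter_label:
  assumes inj: "inj_on W X" and R: "finite R" "R \<subseteq> X" and I: "lower I"
  shows "convex_labels (letter_label W d I) (ordered_list (word_order X W) R)"
  unfolding convex_labels_def
proof (intro allI impI)
  let ?xs = "ordered_list (word_order X W) R"
  have sorted: "sorted_wrt (\<lambda>x y. (x, y) \<in> word_order X W \<and> x \<noteq> y) ?xs"
    by (rule ordered_list(2)[OF linear_order_word_order[OF inj] R])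
  have less: "lex_less (W (?xs ! i)) (W (?xs ! j))" if "i < j" "j < length ?xs" for i j
    using sorted_wrt_nth_less[OF sorted that] word_orderD by metis
  fix i j k
  assume ijk: "i < j" "j < k" "k < length ?xs"
    and eq: "letter_label W d I (?xs ! i) = letter_label W d I (?xs ! k)"
  let ?f = "W (?xs ! i)" and ?g = "W (?xs ! j)" and ?h = "W (?xs ! k)"
  have prefix: "?f q = ?h q" if "q < d" for q
    using eq that by (simp add: letter_label_eq_iff)
  have "lex_less ?f ?g" "lex_less ?g ?h"
    using less ijk by simp_all
  note between = lex_less_between[of ?f ?g ?h d, OF this prefix]
  have pre: "\<forall>p<d. ?g p = ?h p"
    using between(1) prefix by simp
  have "?f d \<in> I \<and> ?h d \<in> I \<or> ?f d \<notin> I \<and> ?h d \<notin> I \<and> ?f d = ?h d"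
    using eq by (simp add: letter_label_eq_iff)
  then have "?g d \<in> I \<and> ?h d \<in> I \<or> ?g d \<notin> I \<and> ?h d \<notin> I \<and> ?g d = ?h d"
  proof
    assume "?f d \<in> I \<and> ?h d \<in> I"
    then show ?thesis
      using I between(3) unfolding lower_def by metis
  next
    assume "?f d \<notin> I \<and> ?h d \<notin> I \<and> ?f d = ?h d"
    moreover from this have "?g d = ?h d"
      using between(2,3) by simp
    ultimately show ?thesis
      by simp
  qed
  with pre show "letter_label W d I (?xs ! j) = letter_label W d I (?xs ! k)"
    by (simp add: letter_label_eq_iff)
qed

lemma coarser_letter_label:
  assumes "I \<subseteq> I'"
  shows "coarser xs (letter_label W d I) (letter_label W d I')"
  using assms unfolding coarser_def letter_label_eq_iff by (metis subsetD)

lemma coarser_next_letter: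
  "coarser xs (letter_label W (Suc d) UNIV) (letter_label W d {})"
  unfolding coarser_def letter_label_eq_iff by simp

lemma few_labels_next_letter:
  assumes "\<And>x y p. x \<in> set xs \<Longrightarrow> y \<in> set ys \<Longrightarrow> M x y = 1 \<Longrightarrow> W y p = \<tau> (W x p)"
  shows "few_labels (Suc k) xs ys M (letter_label W d {}) (letter_label W (Suc d) UNIV)"
  unfolding few_labels_def
proof (intro ballI exI conjI impI)
  fix x0 x y assume "x \<in> set xs" "y \<in> set ys" "letter_label W d {} x = letter_label W d {} x0" "M x y = 1"
  then have "W y p = \<tau> (W x0 p)" if "p < Suc d" for p
    using assms[of x y p] that by (auto simp: letter_label_eq_iff less_Suc_eq)
  then show "letter_label W (Suc d) UNIV y \<in> {(\<lambda>p. if p < Suc d then \<tau> (W x0 p) else 0, None)}"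
    by (auto simp: letter_label_def)
qed simp_all

lemma few_labels_same_prefix:
  assumes "\<And>x y p. x \<in> set xs \<Longrightarrow> y \<in> set ys \<Longrightarrow> M x y = 1 \<Longrightarrow> W y p = \<tau> (W x p)"
  shows "few_labels (Suc k) xs ys M (letter_label W d UNIV) (letter_label W d UNIV)"
  unfolding few_labels_def
proof (intro ballI exI conjI impI)
  fix x0 x y assume "x \<in> set xs" "y \<in> set ys" "letter_label W d UNIV x = letter_label W d UNIV x0" "M x y = 1"
  then have "W y p = \<tau> (W x0 p)" if "p < d" for p
    using assms[of x y p] that by (simp add: letter_label_eq_iff)
  then show "letter_label W d UNIV y \<in> {(\<lambda>p. if p < d then \<tau> (W x0 p) else 0, None)}"
    by (auto simp: letter_label_def)
qed simp_all

text \<open>The prefix of \<open>y\<close> is determined by the class of \<open>x\<close>, so only the letter number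
\<open>d\<close> matters. An unmerged letter of \<open>x\<close> determines that of \<open>y\<close>. For
merged letters, \<open>y\<close> has a merged letter too, or the letter \<open>t\<close> that is being merged,
or one of the exceptional letters in \<open>G\<close>, which makes \<open>card G + 2\<close> labels.\<close>

lemma few_labels_letter_label:
  assumes \<tau>: "\<And>x y p. x \<in> set xs \<Longrightarrow> y \<in> set ys \<Longrightarrow> M x y = 1 \<Longrightarrow> W y p = \<tau> (W x p)"
    and G: "finite G" "card G \<le> k"
    and exceptions: "\<And>x y. x \<in> set xs \<Longrightarrow> y \<in> set ys \<Longrightarrow> M x y = 1 \<Longrightarrow> W x d \<in> I' \<Longrightarrow> W y d \<in> J \<or> W y d = t \<or> W y d \<in> G"
  shows "few_labels (k + 2) xs ys M (letter_label W d I') (letter_label W d J)"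
  unfolding few_labels_def
proof
  fix x0 assume x0: "x0 \<in> set xs"
  let ?pre = "\<lambda>p. if p < d then \<tau> (W x0 p) else 0"
  \<comment> \<open>The possible second components of the labels of the columns.\<close>
  define T where "T = (if W x0 d \<in> I' then insert None (insert (Some t) (Some ` G))
      else {if \<tau> (W x0 d) \<in> J then None else Some (\<tau> (W x0 d))})"
  have "finite T"
    using G by (simp add: T_def)
  moreover have "card T \<le> k + 2"
  proof -
    have "card (insert None (insert (Some t) (Some ` G))) \<le> Suc (Suc (card (Some ` G)))"
      using card_insert_le_m1[of "Suc (Suc (card (Some ` G)))"] G
      by (simp add: card_insert_if)
    also have "\<dots> \<le> k + 2"
      using G card_image_le[of G Some] by simp
    finally show ?thesis
      by (simp add: T_def)
  qed
  moreover have "letter_label W d J y \<in> Pair ?pre ` T"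
    if "x \<in> set xs" "y \<in> set ys" "letter_label W d I' x = letter_label W d I' x0" "M x y = 1" for x y
  proof -
    have W: "W y p = \<tau> (W x p)" for p
      using \<tau> that by simp
    have pre: "(\<lambda>p. if p < d then W y p else 0) = ?pre"
      using that(3) by (auto simp: W letter_label_eq_iff)
    have "(if W y d \<in> J then None else Some (W y d)) \<in> T"
    proof (cases "W x0 d \<in> I'")
      case True
      then have "W x d \<in> I'"
        using that(3) by (simp add: letter_label_eq_iff)
      then show ?thesis
        using exceptions[OF that(1,2,4)] True by (auto simp: T_def)
    next
      case False
      then have "W x d = W x0 d"
        using that(3) by (simp add: letter_label_eq_iff)
      then show ?thesis
        using False by (simp add: T_def W)
    qed
    then show ?thesis
      unfolding letter_label_def pre by (rule imageI)
  qed
  moreover have "finite (Pair ?pre ` T)" "card (Pair ?pre ` T) \<le> card T"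
    using \<open>finite T\<close> by (simp_all add: card_image_le)
  ultimately show "\<exists>S. finite S \<and> card S \<le> k + 2 \<and> (\<forall>x\<in>set xs. \<forall>y\<in>set ys.
      letter_label W d I' x = letter_label W d I' x0 \<longrightarrow> M x y = 1 \<longrightarrow> letter_label W d J y \<in> S)"
    by (intro exI[of _ "Pair ?pre ` T"]) auto
qed

text \<open>The map \<open>\<sigma>\<close> applies \<open>\<phi>\<close> to every letter, and \<open>\<phi>\<close> is
increasing outside the finite set \<open>F\<close> of exceptional letters of the alphabet \<open>V\<close>.\<close>

locale almost_monotone_words =
  fixes X :: "'a set" and W :: "'a \<Rightarrow> nat \<Rightarrow> real" and \<sigma> :: "'a \<Rightarrow> 'a"
    and \<phi> :: "real \<Rightarrow> real" and F V :: "real set"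
  assumes inj_W: "inj_on W X"
    and letters: "x \<in> X \<Longrightarrow> W x p \<in> V"
    and inj_\<phi>: "inj_on \<phi> V"
    and finite_F: "finite F"
    and monotone: "a \<in> V - F \<Longrightarrow> b \<in> V - F \<Longrightarrow> a < b \<Longrightarrow> \<phi> a < \<phi> b"
    and \<sigma>: "x \<in> X \<Longrightarrow> W (\<sigma> x) p = \<phi> (W x p)"
begin

lemma linear_order: "linear_order_on X (word_order X W)"
  using inj_W by (rule linear_order_word_order)

end

locale almost_monotone_submatrix = almost_monotone_words +
  fixes R C :: "'a set"
  assumes R: "finite R" "R \<subseteq> X" "R \<noteq> {}" and C: "finite C" "C \<subseteq> X" "C \<noteq> {}"
begin

abbreviation M :: "'a \<Rightarrow> 'a \<Rightarrow> nat" where "M \<equiv> perm_mat \<sigma>"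

definition xs :: "'a list" where "xs = ordered_list (word_order X W) R"
definition ys :: "'a list" where "ys = ordered_list (word_order X W) C"
definition \<psi> :: "real \<Rightarrow> real" where "\<psi> = inv_into V \<phi>"

lemma set_xs: "set xs = R" and set_ys: "set ys = C"
  unfolding xs_def ys_def using ordered_list(1)[OF linear_order] R C by auto

lemma convex_xs_ys:
  assumes "lower I"
  shows "convex_labels (letter_label W d I) xs" "convex_labels (letter_label W d I) ys"
  unfolding xs_def ys_def using convex_letter_label[OF inj_W _ _ assms] R C by auto

lemma forward:
  assumes "x \<in> set xs" "y \<in> set ys" "M x y = 1"
  shows "W y p = \<phi> (W x p)"
proof -
  have "\<sigma> x = y"
    using assms(3) by (simp add: perm_mat_def split: if_splits)
  moreover have "x \<in> X"
    using assms(1) R set_xs by auto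
  ultimately show ?thesis
    using \<sigma>[of x p] by simp
qed

lemma backward:
  assumes "y \<in> set ys" "x \<in> set xs" "M x y = 1"
  shows "W x p = \<psi> (W y p)"
proof -
  have "W x p \<in> V"
    using assms R set_xs by (intro letters) auto
  then have "\<psi> (\<phi> (W x p)) = W x p"
    unfolding \<psi>_def by (rule inv_into_f_f[OF inj_\<phi>])
  then show ?thesis
    using forward[OF assms(2,1,3)] by simp
qed

lemma lower_trivial: "lower UNIV" "lower {}"
  by (simp_all add: lower_def)

abbreviation coarsen (infix "\<leadsto>" 50) where
  "coarsen \<equiv> coarsening_step (card F + 2) xs ys M"

abbreviation labels :: "nat \<Rightarrow> real set \<Rightarrow> real set \<Rightarrow> ('a \<Rightarrow> (nat \<Rightarrow> real) \<times> real option) \<times> ('a \<Rightarrow> (nat \<Rightarrow> real) \<times> real option)" where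
  "labels d I J \<equiv> (letter_label W d I, letter_label W d J)"

text \<open>One stage of the sweep. The hypotheses \<open>row\<close> and \<open>col\<close> say that rows and columns are
merged in step, except for the single letter \<open>t\<close> and the exceptional letters.\<close>

lemma coarsen_letter:
  assumes lower: "lower I'" "lower J'" and sub: "I \<subseteq> I'" "J \<subseteq> J'"
    and row: "\<And>x y. x \<in> set xs \<Longrightarrow> y \<in> set ys \<Longrightarrow> M x y = 1 \<Longrightarrow> W x d \<in> I' \<Longrightarrow> W x d \<notin> F \<Longrightarrow> W y d \<notin> J \<Longrightarrow> W y d = t"
    and col: "\<And>x y. x \<in> set xs \<Longrightarrow> y \<in> set ys \<Longrightarrow> M x y = 1 \<Longrightarrow> W y d \<in> J' \<Longrightarrow> W x d \<notin> F \<Longrightarrow> W x d \<notin> I \<Longrightarrow> W y d = t"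
  shows "labels d I J \<leadsto> labels d I' J'"
  unfolding coarsening_step_def fst_conv snd_conv
proof (intro conjI)
  show "few_labels (card F + 2) xs ys M (letter_label W d I') (letter_label W d J)"
  proof (rule few_labels_letter_label[where G = "\<phi> ` F" and t = t and \<tau> = \<phi>])
    show "W y d \<in> J \<or> W y d = t \<or> W y d \<in> \<phi> ` F"
      if "x \<in> set xs" "y \<in> set ys" "M x y = 1" "W x d \<in> I'" for x y
      using row[OF that] forward[OF that(1-3), of d] by (cases "W x d \<in> F") auto
    show "card (\<phi> ` F) \<le> card F"
      using finite_F by (rule card_image_le)
  qed (use forward finite_F in simp_all)
  show "few_labels (card F + 2) ys xs (\<lambda>y x. M x y) (letter_label W d J') (letter_label W d I)"
  proof (rule few_labels_letter_label[where G = F and t = "\<psi> t" and \<tau> = \<psi>])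
    show "W x d \<in> I \<or> W x d = \<psi> t \<or> W x d \<in> F"
      if "y \<in> set ys" "x \<in> set xs" "M x y = 1" "W y d \<in> J'" for y x
      using col[OF that(2,1,3,4)] backward[OF that(1-3), of d] by (cases "W x d \<in> F") auto
  qed (use backward finite_F in simp_all)
qed (use lower sub in \<open>simp_all add: convex_xs_ys coarser_letter_label\<close>)

text \<open>The sweep advances through the letters of the columns. After \<open>i\<close> stages the columns whose letter
is at most one of the first \<open>i\<close> letters are merged; on the side of the rows, all letters up to a
non-exceptional letter that \<open>\<phi>\<close> sends to a merged one. The downward closure keeps the merged
rows an interval although \<open>F\<close> is excluded.\<close>

definition column_letters :: "nat \<Rightarrow> real list" where
  "column_letters d = sorted_list_of_set ((\<lambda>y. W y d) ` C)"

definition swept_cols :: "nat \<Rightarrow> nat \<Rightarrow> real set" where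
  "swept_cols d i = {b. \<exists>k<i. b \<le> column_letters d ! k}"

definition swept_rows :: "nat \<Rightarrow> nat \<Rightarrow> real set" where
  "swept_rows d i = {a. \<exists>a'\<in>V - F. a \<le> a' \<and> \<phi> a' \<in> swept_cols d i}"

lemma column_letters: "set (column_letters d) = (\<lambda>y. W y d) ` C" "sorted_wrt (<) (column_letters d)"
  using C by (simp_all add: column_letters_def)

lemma lower_swept: "lower (swept_cols d i)" "lower (swept_rows d i)"
  unfolding lower_def swept_rows_def swept_cols_def by (auto intro: order_trans)

lemma swept_mono: "swept_cols d i \<subseteq> swept_cols d (Suc i)" "swept_rows d i \<subseteq> swept_rows d (Suc i)"
  unfolding swept_rows_def swept_cols_def by (auto intro: less_SucI)

text \<open>Away from the exceptional letters the two sides of the sweep correspond exactly, by monotonicity.\<close>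

lemma swept_rows_iff:
  assumes "a \<in> V" "a \<notin> F"
  shows "a \<in> swept_rows d i \<longleftrightarrow> \<phi> a \<in> swept_cols d i"
proof
  assume "a \<in> swept_rows d i"
  then obtain a' where a': "a' \<in> V - F" "a \<le> a'" "\<phi> a' \<in> swept_cols d i"
    by (auto simp: swept_rows_def)
  then have "\<phi> a \<le> \<phi> a'"
    using monotone[of a a'] assms by (cases "a = a'") (simp_all add: less_imp_le)
  with a'(3) lower_swept(1)[of d i] show "\<phi> a \<in> swept_cols d i"
    unfolding lower_def by metis
qed (use assms in \<open>auto simp: swept_rows_def\<close>)

lemma newly_swept:
  assumes "b \<in> swept_cols d (Suc i)" "b \<notin> swept_cols d i" "b \<in> (\<lambda>y. W y d) ` C"
  shows "b = column_letters d ! i"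
proof -
  obtain m where m: "m < length (column_letters d)" "b = column_letters d ! m"
    using assms(3) column_letters(1)[of d] by (metis in_set_conv_nth)
  have "\<not> m < i"
    using assms(2) m(2) by (auto simp: swept_cols_def)
  moreover have "\<not> i < m"
  proof
    assume "i < m"
    then have "column_letters d ! i < b"
      using sorted_wrt_nth_less[OF column_letters(2), of i m d] m by simp
    with assms(1,2) show False
      by (auto simp: swept_cols_def less_Suc_eq)
  qed
  ultimately show ?thesis
    using m(2) by simp
qed

lemma matched_letters:
  assumes "x \<in> set xs" "y \<in> set ys" "M x y = 1"
  shows "W x d \<in> V" "W y d \<in> (\<lambda>y. W y d) ` C" "W y d = \<phi> (W x d)"
proof -
  show "W x d \<in> V"
    using assms(1) R set_xs by (intro letters) auto
  show "W y d \<in> (\<lambda>y. W y d) ` C"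
    using assms(2) set_ys by auto
  show "W y d = \<phi> (W x d)"
    using assms by (rule forward)
qed

lemma coarsen_sweep: "labels d (swept_rows d i) (swept_cols d i) \<leadsto> labels d (swept_rows d (Suc i)) (swept_cols d (Suc i))"
proof (rule coarsen_letter[OF lower_swept(2,1) swept_mono(2,1), where t = "column_letters d ! i"])
  fix x y assume xy: "x \<in> set xs" "y \<in> set ys" "M x y = 1" "W x d \<notin> F"
  note m = matched_letters[OF xy(1-3), of d]
  show "W y d = column_letters d ! i" if "W x d \<in> swept_rows d (Suc i)" "W y d \<notin> swept_cols d i"
  proof (rule newly_swept[OF _ that(2) m(2)])
    show "W y d \<in> swept_cols d (Suc i)"
      using that(1) swept_rows_iff[OF m(1) xy(4)] m(3) by simp
  qed
  show "W y d = column_letters d ! i" if "W y d \<in> swept_cols d (Suc i)" "W x d \<notin> swept_rows d i"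
  proof (rule newly_swept[OF that(1) _ m(2)])
    show "W y d \<notin> swept_cols d i"
      using that(2) swept_rows_iff[OF m(1) xy(4)] m(3) by simp
  qed
qed

lemma coarsen_sweeps: "coarsen\<^sup>*\<^sup>* (labels d {} {}) (labels d (swept_rows d i) (swept_cols d i))"
proof (induction i)
  case 0
  have "swept_rows d 0 = {}" "swept_cols d 0 = {}"
    by (simp_all add: swept_rows_def swept_cols_def)
  then show ?case
    by simp
next
  case (Suc i)
  then show ?case
    using coarsen_sweep by (rule rtranclp.rtrancl_into_rtrancl)
qed

text \<open>When all letters of the columns are merged, the remaining unmerged letters of matched rows are exceptional,
and everything is merged at once. The letter \<open>t = 0\<close> is a dummy.\<close>

lemma coarsen_finish:
  "labels d (swept_rows d (length (column_letters d))) (swept_cols d (length (column_letters d))) \<leadsto> labels d UNIV UNIV"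
proof (rule coarsen_letter[OF lower_trivial(1,1), where t = 0])
  let ?n = "length (column_letters d)"
  fix x y assume xy: "x \<in> set xs" "y \<in> set ys" "M x y = 1" "W x d \<notin> F"
  note m = matched_letters[OF xy(1-3), of d]
  obtain k where "k < ?n" "W y d = column_letters d ! k"
    using m(2) column_letters(1)[of d] by (metis in_set_conv_nth)
  then have swept: "W y d \<in> swept_cols d ?n"
    by (auto simp: swept_cols_def)
  show "W y d = 0" if "W y d \<notin> swept_cols d ?n"
    using that swept by simp
  show "W y d = 0" if "W x d \<notin> swept_rows d ?n"
    using that swept swept_rows_iff[OF m(1) xy(4)] m(3) by simp
qed simp_all

text \<open>Both labellings define the same classes, words with equal prefixes of length \<open>d + 1\<close>; this step
only rewrites the labels.\<close>

lemma coarsen_next_letter: "labels (Suc d) UNIV UNIV \<leadsto> labels d {} {}"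
  unfolding coarsening_step_def fst_conv snd_conv
proof (intro conjI)
  show "few_labels (card F + 2) xs ys M (letter_label W d {}) (letter_label W (Suc d) UNIV)"
    using few_labels_next_letter[of xs ys M W \<phi> "Suc (card F)" d] forward by simp
  show "few_labels (card F + 2) ys xs (\<lambda>y x. M x y) (letter_label W d {}) (letter_label W (Suc d) UNIV)"
    using few_labels_next_letter[of ys xs "\<lambda>y x. M x y" W \<psi> "Suc (card F)" d] backward by simp
qed (simp_all add: convex_xs_ys lower_trivial coarser_next_letter)

lemma coarsen_all_letters: "coarsen\<^sup>*\<^sup>* (labels d UNIV UNIV) (labels 0 UNIV UNIV)"
proof (induction d)
  case 0
  show ?case by simp
next
  case (Suc d)
  have "coarsen\<^sup>*\<^sup>* (labels (Suc d) UNIV UNIV) (labels d UNIV UNIV)"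
    using converse_rtranclp_into_rtranclp[OF coarsen_next_letter coarsen_sweeps] coarsen_finish
    by (rule rtranclp.rtrancl_into_rtrancl)
  then show ?case
    using Suc by (rule rtranclp_trans)
qed

lemma coarsen_start: "labels d UNIV UNIV \<leadsto> labels d UNIV UNIV"
  unfolding coarsening_step_def fst_conv snd_conv
proof (intro conjI)
  show "few_labels (card F + 2) xs ys M (letter_label W d UNIV) (letter_label W d UNIV)"
    using few_labels_same_prefix[of xs ys M W \<phi> "Suc (card F)" d] forward by simp
  show "few_labels (card F + 2) ys xs (\<lambda>y x. M x y) (letter_label W d UNIV) (letter_label W d UNIV)"
    using few_labels_same_prefix[of ys xs "\<lambda>y x. M x y" W \<psi> "Suc (card F)" d] backward by simp
qed (simp_all add: convex_xs_ys lower_trivial coarser_letter_label)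

text \<open>Finitely many words are distinguished by finitely many letters, so the contraction can start at a finite
depth.\<close>

lemma distinguishing_prefix:
  obtains N where "inj_on (letter_label W N UNIV) (R \<union> C)"
proof -
  define P where "P = {q \<in> (R \<union> C) \<times> (R \<union> C). fst q \<noteq> snd q}"
  define D where "D q = (SOME p. W (fst q) p \<noteq> W (snd q) p)" for q
  have D: "W (fst q) (D q) \<noteq> W (snd q) (D q)" if "q \<in> P" for q
  proof -
    have "fst q \<in> X" "snd q \<in> X" "fst q \<noteq> snd q"
      using that R(2) C(2) by (auto simp: P_def)
    then have "W (fst q) \<noteq> W (snd q)"
      using inj_W by (simp add: inj_on_eq_iff)
    then have "\<exists>p. W (fst q) p \<noteq> W (snd q) p"
      by auto
    then show ?thesis
      unfolding D_def by (rule someI_ex)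
  qed
  have "finite P"
    using R C by (simp add: P_def)
  then have bound: "D q \<le> Max (D ` P)" if "q \<in> P" for q
    using that by simp
  have "inj_on (letter_label W (Suc (Max (D ` P))) UNIV) (R \<union> C)"
  proof (rule inj_onI, rule ccontr)
    fix x x' assume x: "x \<in> R \<union> C" "x' \<in> R \<union> C"
      "letter_label W (Suc (Max (D ` P))) UNIV x = letter_label W (Suc (Max (D ` P))) UNIV x'" "x \<noteq> x'"
    then have "(x, x') \<in> P"
      by (simp add: P_def)
    then have "W x (D (x, x')) \<noteq> W x' (D (x, x'))" "D (x, x') < Suc (Max (D ` P))"
      using D[of "(x, x')"] bound[of "(x, x')"] by (simp_all add: less_Suc_eq_le)
    with x(3) show False
      by (simp add: letter_label_eq_iff)
  qed
  then show thesis
    by (rule that)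
qed

lemma stww_mat_submatrix:
  "stww_mat (finite_mat (word_order X W) R (word_order X W) C M) \<le> enat (card F + 2)"
proof -
  obtain N where N: "inj_on (letter_label W N UNIV) (R \<union> C)"
    by (rule distinguishing_prefix)
  show ?thesis
  proof (rule stww_mat_le_coarsening[OF linear_order R linear_order C])
    show "(coarsening_step (card F + 2) (ordered_list (word_order X W) R) (ordered_list (word_order X W) C) M)\<^sup>*\<^sup>*
        (labels N UNIV UNIV) (labels 0 UNIV UNIV)"
      using coarsen_all_letters[of N] unfolding xs_def ys_def .
    show "coarsening_step (card F + 2) (ordered_list (word_order X W) R) (ordered_list (word_order X W) C) M
        (labels N UNIV UNIV) (labels N UNIV UNIV)"
      using coarsen_start[of N] unfolding xs_def ys_def .
    show "inj_on (letter_label W N UNIV) R" "inj_on (letter_label W N UNIV) C"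
      using N by (simp_all add: inj_on_Un)
    show "M x y \<le> 1" for x y
      by (simp add: perm_mat_def)
    show "letter_label W 0 UNIV x = letter_label W 0 UNIV x'" for x x'
      by (simp add: letter_label_eq_iff)
    show "letter_label W 0 UNIV x = letter_label W 0 UNIV x'" for x x'
      by (simp add: letter_label_eq_iff)
  qed
qed

end

theorem (in almost_monotone_words) stww_mat_le:
  assumes "finite R" "R \<subseteq> X" "R \<noteq> {}" "finite C" "C \<subseteq> X" "C \<noteq> {}"
  shows "stww_mat (finite_mat (word_order X W) R (word_order X W) C (perm_mat \<sigma>)) \<le> enat (card F + 2)"
proof -
  interpret almost_monotone_submatrix X W \<sigma> \<phi> F V R C
    using assms by unfold_locales
  show ?thesis
    by (rule stww_mat_submatrix)
qed


section \<open>Houghton groups have finite twin-width\<close>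

text \<open>The points are embedded into the real line: \<open>Ray i m\<close> lies in \<open>{i - 1..<i}\<close>, so
the rays follow each other, and each of them is traversed outwards.\<close>

definition position :: "point \<Rightarrow> real" where
  "position v = (case v of Line l \<Rightarrow> of_int l | Centre \<Rightarrow> 0 | Ray i m \<Rightarrow> of_nat i - 1 / (of_nat m + 1))"

lemma position_Ray: "position (Ray i m) < position (Ray j k) \<longleftrightarrow> i < j \<or> i = j \<and> m < k"
proof -
  have bounds: "real i - 1 \<le> position (Ray i m)" "position (Ray i m) < real i" for i m
    by (simp_all add: position_def)
  show ?thesis
  proof (cases i j rule: linorder_cases)
    case less
    then have "real i \<le> real j - 1"
      by simp
    then show ?thesis
      using less bounds(2)[of i m] bounds(1)[of j k] by simp
  next
    case equal
    moreover have "1 / (real k + 1) < 1 / (real m + 1) \<longleftrightarrow> m < k"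
      by (simp add: field_simps)
    ultimately show ?thesis
      by (simp add: position_def)
  next
    case greater
    then have "real j \<le> real i - 1"
      by simp
    then show ?thesis
      using greater bounds(2)[of j k] bounds(1)[of i m] by simp
  qed
qed

lemma position_Ray_Centre: "1 \<le> i \<Longrightarrow> 1 \<le> m \<Longrightarrow> 0 < position (Ray i m)"
proof -
  assume im: "1 \<le> i" "1 \<le> m"
  then have "1 / (real m + 1) < 1"
    by simp
  moreover have "1 \<le> real i"
    using im by simp
  ultimately have "1 / (real m + 1) < real i"
    by linarith
  then show "0 < position (Ray i m)"
    by (simp add: position_def)
qed

lemma houghton_points_cases:
  assumes "v \<in> houghton_points n" "n \<noteq> 2"
  obtains "v = Centre" | i m where "v = Ray i m" "1 \<le> i" "1 \<le> m"
  using assms by (auto simp: houghton_points_def)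

lemma inj_position: "inj_on position (houghton_points n)"
proof (cases "n = 2")
  case True
  then show ?thesis
    by (auto simp: inj_on_def houghton_points_def position_def)
next
  case False
  show ?thesis
  proof (rule inj_onI)
    fix v w assume v: "v \<in> houghton_points n" and w: "w \<in> houghton_points n"
      and eq: "position v = position w"
    have Centre: "position Centre = 0"
      by (simp add: position_def)
    show "v = w"
    proof (cases rule: houghton_points_cases[OF v False]; cases rule: houghton_points_cases[OF w False])
      fix i m j k assume vw: "v = Ray i m" "w = Ray j k"
      then show ?thesis
        using eq position_Ray[of i m j k] position_Ray[of j k i m] by auto
    next
      fix i m assume "v = Centre" "w = Ray i m" "1 \<le> i" "1 \<le> m"
      then show ?thesis
        using eq Centre position_Ray_Centre[of i m] by simp
    next
      fix i m assume "v = Ray i m" "1 \<le> i" "1 \<le> m" "w = Centre"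
      then show ?thesis
        using eq Centre position_Ray_Centre[of i m] by simp
    qed simp
  qed
qed

definition almost_monotone :: "point set \<Rightarrow> (point \<Rightarrow> point) \<Rightarrow> bool" where
  "almost_monotone V f \<longleftrightarrow> (\<exists>F. finite F \<and>
     (\<forall>v\<in>V - F. \<forall>w\<in>V - F. position v < position w \<longrightarrow> position (f v) < position (f w)))"

lemma almost_monotone_compose:
  assumes f: "f \<in> Bij V" "almost_monotone V f" and g: "g \<in> Bij V" "almost_monotone V g"
  shows "almost_monotone V (compose V f g)"
proof -
  obtain F where F: "finite F"
    "\<And>v w. v \<in> V - F \<Longrightarrow> w \<in> V - F \<Longrightarrow> position v < position w \<Longrightarrow> position (f v) < position (f w)"
    using f(2) unfolding almost_monotone_def by metis
  obtain E where E: "finite E"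
    "\<And>v w. v \<in> V - E \<Longrightarrow> w \<in> V - E \<Longrightarrow> position v < position w \<Longrightarrow> position (g v) < position (g w)"
    using g(2) unfolding almost_monotone_def by metis
  have gV: "inj_on g V" "\<And>v. v \<in> V \<Longrightarrow> g v \<in> V"
    using g(1) by (auto simp: Bij_def bij_betw_def)
  let ?F = "E \<union> {v \<in> V. g v \<in> F}"
  have "finite {v \<in> V. g v \<in> F}"
  proof (rule finite_imageD)
    show "finite (g ` {v \<in> V. g v \<in> F})"
      by (rule finite_subset[OF _ F(1)]) auto
    show "inj_on g {v \<in> V. g v \<in> F}"
      using gV(1) by (rule inj_on_subset) auto
  qed
  then have "finite ?F"
    using E(1) by simp
  moreover have "\<forall>v\<in>V - ?F. \<forall>w\<in>V - ?F. position v < position w \<longrightarrow>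
      position (compose V f g v) < position (compose V f g w)"
  proof (intro ballI impI)
    fix v w assume v: "v \<in> V - ?F" and w: "w \<in> V - ?F" and less: "position v < position w"
    have "position (g v) < position (g w)"
      using v w less by (intro E(2)) auto
    then have "position (f (g v)) < position (f (g w))"
      using v w gV(2) by (intro F(2)) auto
    then show "position (compose V f g v) < position (compose V f g w)"
      using v w by (simp add: compose_def)
  qed
  ultimately show ?thesis
    unfolding almost_monotone_def by (intro exI[of _ ?F] conjI)
qed

lemma almost_monotone_inverse:
  assumes inj: "inj_on position V" and f: "f \<in> Bij V" "almost_monotone V f"
  shows "almost_monotone V (\<lambda>x\<in>V. inv_into V f x)"
proof -
  obtain F where F: "finite F"
    "\<And>v w. v \<in> V - F \<Longrightarrow> w \<in> V - F \<Longrightarrow> position v < position w \<Longrightarrow> position (f v) < position (f w)"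
    using f(2) unfolding almost_monotone_def by metis
  have bij: "bij_betw f V V"
    using f(1) by (simp add: Bij_def)
  let ?g = "inv_into V f"
  have g: "?g v \<in> V" "f (?g v) = v" if "v \<in> V" for v
    using that bij by (auto simp: bij_betw_def inv_into_into f_inv_into_f)
  have "position (?g v) < position (?g w)"
    if v: "v \<in> V - f ` F" and w: "w \<in> V - f ` F" and less: "position v < position w" for v w
  proof (rule ccontr)
    assume "\<not> position (?g v) < position (?g w)"
    moreover have "position (?g v) \<noteq> position (?g w)"
    proof
      assume "position (?g v) = position (?g w)"
      then have "?g v = ?g w"
        using inj_onD[OF inj] g(1) v w by auto
      then have "v = w"
        using g(2) v w by (metis DiffD1)
      with less show False by simp
    qed
    ultimately have "position (?g w) < position (?g v)"
      by simp
    moreover have "?g v \<notin> F" "?g w \<notin> F"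
      using g(2) v w by (metis DiffD1 DiffD2 imageI)+
    ultimately have "position w < position v"
      using F(2)[of "?g w" "?g v"] g v w by simp
    with less show False by simp
  qed
  then have "\<forall>v\<in>V - f ` F. \<forall>w\<in>V - f ` F. position v < position w \<longrightarrow>
      position ((\<lambda>x\<in>V. ?g x) v) < position ((\<lambda>x\<in>V. ?g x) w)"
    by simp
  with F(1) show ?thesis
    unfolding almost_monotone_def by (intro exI[of _ "f ` F"]) simp
qed

text \<open>For \<open>n \<ge> 3\<close>, the shift along ray \<open>1\<close> and ray \<open>k\<close> keeps every
point on its ray and preserves the order along it, except for the centre and the first point of ray
\<open>k\<close>, which change their ray.\<close>

lemma almost_monotone_generator:
  assumes "f \<in> houghton_generators n"
  shows "almost_monotone (houghton_points n) f"
proof (cases "n = 2")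
  case True
  have "f = restrict line_shift (houghton_points n) \<or> f \<in> finitely_supported_perms (houghton_points n)"
    using assms True by (simp add: houghton_generators_def)
  then show ?thesis
  proof
    assume f: "f = restrict line_shift (houghton_points n)"
    have "position (f v) < position (f w)"
      if "v \<in> houghton_points n" "w \<in> houghton_points n" "position v < position w" for v w
      using that True unfolding f by (auto simp: houghton_points_def line_shift_def position_def)
    then show ?thesis
      unfolding almost_monotone_def by (intro exI[of _ "{}"]) simp
  next
    assume "f \<in> finitely_supported_perms (houghton_points n)"
    then have "finite {x \<in> houghton_points n. f x \<noteq> x}"
      by (simp add: finitely_supported_perms_def)
    then show ?thesis
      unfolding almost_monotone_def by (intro exI[of _ "{x \<in> houghton_points n. f x \<noteq> x}"]) simp
  qed
next
  case False
  then obtain k where k: "2 \<le> k" "k \<le> n" and f: "f = restrict (ray_shift k) (houghton_points n)"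
    using assms by (auto simp: houghton_generators_def)
  have "position (f v) < position (f w)"
    if vw: "v \<in> houghton_points n - {Centre, Ray k 1}" "w \<in> houghton_points n - {Centre, Ray k 1}"
      and less: "position v < position w" for v w
  proof -
    have mem: "v \<in> houghton_points n" "w \<in> houghton_points n" and
      nc: "v \<noteq> Centre" "w \<noteq> Centre" "v \<noteq> Ray k 1" "w \<noteq> Ray k 1"
      using vw by auto
    obtain i m where v: "v = Ray i m" "1 \<le> m" "i = k \<Longrightarrow> 2 \<le> m"
    proof (cases rule: houghton_points_cases[OF mem(1) False])
      case (2 i m)
      moreover from this have "i = k \<Longrightarrow> 2 \<le> m"
        using nc(3) by (cases "m = 1") simp_all
      ultimately show ?thesis
        by (intro that)
    qed (use nc in simp)
    obtain j l where w: "w = Ray j l" "1 \<le> l" "j = k \<Longrightarrow> 2 \<le> l"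
    proof (cases rule: houghton_points_cases[OF mem(2) False])
      case (2 j l)
      moreover from this have "j = k \<Longrightarrow> 2 \<le> l"
        using nc(4) by (cases "l = 1") simp_all
      ultimately show ?thesis
        by (intro that)
    qed (use nc in simp)
    have fv: "f v = Ray i (if i = 1 then m + 1 else if i = k then m - 1 else m)"
      using mem(1) v(3) k(1) unfolding f v(1) by (auto simp: ray_shift_def)
    have fw: "f w = Ray j (if j = 1 then l + 1 else if j = k then l - 1 else l)"
      using mem(2) w(3) k(1) unfolding f w(1) by (auto simp: ray_shift_def)
    have "i < j \<or> i = j \<and> m < l"
      using less unfolding v(1) w(1) position_Ray .
    then show ?thesis
      unfolding fv fw position_Ray using v(2,3) w(2,3) by auto
  qed
  then show ?thesis
    unfolding almost_monotone_def by (intro exI[of _ "{Centre, Ray k 1}"]) simp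
qed

lemma almost_monotone_houghton:
  assumes "f \<in> carrier (houghton n)"
  shows "almost_monotone (houghton_points n) f"
proof -
  let ?V = "houghton_points n" and ?B = "BijGroup (houghton_points n)"
  have mem: "h \<in> Bij ?V" if "h \<in> generate ?B (carrier ?B \<inter> houghton_generators n)" for h
    using that group.generate_incl[OF group_BijGroup, of "carrier ?B \<inter> houghton_generators n" ?V]
    by (auto simp: BijGroup_simps)
  have "f \<in> generate ?B (carrier ?B \<inter> houghton_generators n)"
    using assms by (simp add: houghton_def carrier_subgroup_generated)
  then show ?thesis
  proof (induction rule: generate.induct)
    case one
    have "almost_monotone ?V (\<lambda>x\<in>?V. x)"
      unfolding almost_monotone_def by (intro exI[of _ "{}"]) simp
    moreover have "\<one>\<^bsub>?B\<^esub> = (\<lambda>x\<in>?V. x)"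
      by (simp add: BijGroup_def)
    ultimately show ?case
      by (simp only:)
  next
    case (incl h)
    then show ?case
      by (intro almost_monotone_generator) simp
  next
    case (inv h)
    then have "h \<in> Bij ?V" "almost_monotone ?V h"
      by (auto intro: almost_monotone_generator simp: BijGroup_simps)
    then show ?case
      using almost_monotone_inverse[OF inj_position] by (simp only: inv_BijGroup)
  next
    case (eng h1 h2)
    then show ?case
      using almost_monotone_compose mem by (simp add: BijGroup_simps)
  qed
qed

lemma countable_houghton_points: "countable (houghton_points n)"
proof (rule countable_subset)
  show "houghton_points n \<subseteq> range Line \<union> {Centre} \<union> range (\<lambda>(i, m). Ray i m)"
    by (auto simp: houghton_points_def)
qed auto

text \<open>The word of \<open>x\<close> lists preimages rather than images, because \<open>(x g)\<close> inverse is
\<open>g\<close> inverse after \<open>x\<close> inverse: in this way right translation acts on the letters and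
not on their places.\<close>

definition word :: "nat \<Rightarrow> (point \<Rightarrow> point) \<Rightarrow> nat \<Rightarrow> real" where
  "word n x p = position (inv_into (houghton_points n) x (from_nat_into (houghton_points n) p))"

lemma inj_word:
  assumes n: "2 \<le> n"
  shows "inj_on (word n) (carrier (houghton n))"
proof (rule inj_onI)
  let ?V = "houghton_points n"
  fix x y assume x: "x \<in> carrier (houghton n)" and y: "y \<in> carrier (houghton n)" and eq: "word n x = word n y"
  have B: "bij_betw x ?V ?V" "bij_betw y ?V ?V" "x \<in> extensional ?V" "y \<in> extensional ?V"
    using houghton_carrier_Bij[OF x] houghton_carrier_Bij[OF y] by (simp_all add: Bij_def)
  have into: "inv_into ?V x v \<in> ?V" "inv_into ?V y v \<in> ?V" if "v \<in> ?V" for v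
    using that B(1,2) by (auto simp: bij_betw_def inv_into_into)
  have inv_eq: "inv_into ?V x v = inv_into ?V y v" if v: "v \<in> ?V" for v
  proof -
    obtain p where p: "from_nat_into ?V p = v"
      using from_nat_into_surj[OF countable_houghton_points v] by metis
    have "position (inv_into ?V x v) = position (inv_into ?V y v)"
      using fun_cong[OF eq, of p] by (simp add: word_def p)
    then show ?thesis
      using inj_onD[OF inj_position] into[OF v] by metis
  qed
  show "x = y"
  proof (rule extensionalityI[OF B(3,4)])
    fix v assume v: "v \<in> ?V"
    then have xv: "x v \<in> ?V"
      using B(1) by (auto simp: bij_betw_def)
    have "inv_into ?V y (x v) = v"
      using inv_eq[OF xv] v B(1) by (simp add: bij_betw_def)
    then show "x v = y v"
      using xv B(2) f_inv_into_f[of "x v" y ?V] by (simp add: bij_betw_def)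
  qed
qed

text \<open>On letters, \<open>\<phi>\<close> is the inverse of \<open>g\<close> transported to the real line by
\<open>position\<close>.\<close>

lemma almost_monotone_words_houghton:
  assumes n: "2 \<le> n" and g: "g \<in> carrier (houghton n)"
  obtains \<phi> F where "almost_monotone_words (carrier (houghton n)) (word n)
    (right_translation (houghton n) g) \<phi> F (position ` houghton_points n)"
proof -
  let ?V = "houghton_points n" and ?X = "carrier (houghton n)"
  have gB: "g \<in> Bij ?V" "bij_betw g ?V ?V"
    using houghton_carrier_Bij[OF g] by (simp_all add: Bij_def)
  let ?h = "\<lambda>v\<in>?V. inv_into ?V g v"
  have "almost_monotone ?V ?h"
    using almost_monotone_inverse[OF inj_position gB(1) almost_monotone_houghton[OF g]] .
  then obtain F where F: "finite F"
    "\<And>v w. v \<in> ?V - F \<Longrightarrow> w \<in> ?V - F \<Longrightarrow> position v < position w \<Longrightarrow> position (?h v) < position (?h w)"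
    unfolding almost_monotone_def by metis
  have hV: "?h v \<in> ?V" if "v \<in> ?V" for v
    using that gB(2) by (auto simp: bij_betw_def inv_into_into)
  have inj_h: "inj_on ?h ?V"
    using gB(2) bij_betw_inv_into[OF gB(2)] by (simp add: bij_betw_def inj_on_def)
  define \<phi> where "\<phi> a = position (?h (inv_into ?V position a))" for a
  have \<phi>: "\<phi> (position v) = position (?h v)" if "v \<in> ?V" for v
    using that inj_position by (simp add: \<phi>_def)
  have "almost_monotone_words ?X (word n) (right_translation (houghton n) g) \<phi> (position ` F) (position ` ?V)"
  proof
    show "inj_on (word n) ?X"
      using n by (rule inj_word)
    show "finite (position ` F)"
      using F(1) by simp
    show "inj_on \<phi> (position ` ?V)"
    proof (rule inj_onI)
      fix a b assume "a \<in> position ` ?V" "b \<in> position ` ?V" "\<phi> a = \<phi> b"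
      then obtain v w where vw: "a = position v" "b = position w" "v \<in> ?V" "w \<in> ?V" "position (?h v) = position (?h w)"
        using \<phi> by auto
      then have "?h v = ?h w"
        using inj_onD[OF inj_position vw(5)] hV by blast
      then show "a = b"
        using inj_onD[OF inj_h] vw by metis
    qed
    show "\<phi> a < \<phi> b" if ab: "a \<in> position ` ?V - position ` F" "b \<in> position ` ?V - position ` F" "a < b" for a b
    proof -
      obtain v w where "a = position v" "b = position w" "v \<in> ?V - F" "w \<in> ?V - F"
        using ab by auto
      then show ?thesis
        using F(2)[of v w] ab(3) \<phi> by simp
    qed
  next
    fix x p assume x: "x \<in> ?X"
    let ?v = "from_nat_into ?V p"
    have xB: "x \<in> Bij ?V" "bij_betw x ?V ?V"
      using houghton_carrier_Bij[OF x] by (simp_all add: Bij_def)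
    have "?V \<noteq> {}"
      using infinite_houghton_points[OF n] by auto
    then have v: "?v \<in> ?V"
      by (rule from_nat_into)
    then have xv: "inv_into ?V x ?v \<in> ?V" "x (inv_into ?V x ?v) = ?v"
      using xB(2) by (auto simp: bij_betw_def inv_into_into f_inv_into_f)
    then show "word n x p \<in> position ` ?V"
      by (simp add: word_def)
    have gxv: "inv_into ?V g (inv_into ?V x ?v) \<in> ?V" "g (inv_into ?V g (inv_into ?V x ?v)) = inv_into ?V x ?v"
      using xv(1) gB(2) by (auto simp: bij_betw_def inv_into_into f_inv_into_f)
    have "bij_betw (compose ?V x g) ?V ?V"
      using compose_Bij[OF xB(1) gB(1)] by (simp add: Bij_def)
    moreover have "compose ?V x g (inv_into ?V g (inv_into ?V x ?v)) = ?v"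
      using gxv xv by (simp add: compose_def)
    ultimately have "inv_into ?V (compose ?V x g) ?v = inv_into ?V g (inv_into ?V x ?v)"
      using gxv(1) by (metis bij_betw_def inv_into_f_f)
    then show "word n (right_translation (houghton n) g x) p = \<phi> (word n x p)"
      using xv(1) by (simp add: word_def right_translation_def houghton_mult[OF xB(1) gB(1)] \<phi>)
  qed
  then show thesis
    by (rule that)
qed

lemma finite_twin_width_houghton:
  assumes n: "2 \<le> n"
  shows "finite_twin_width (houghton n)"
proof -
  let ?X = "carrier (houghton n)"
  let ?r = "word_order ?X (word n)"
  have "translation_stww (houghton n) ?r g < \<infinity>" if "g \<in> ?X" for g
  proof -
    obtain \<phi> F where words: "almost_monotone_words ?X (word n)
        (right_translation (houghton n) g) \<phi> F (position ` houghton_points n)"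
      using almost_monotone_words_houghton[OF n \<open>g \<in> ?X\<close>] .
    have "translation_stww (houghton n) ?r g \<le> enat (card F + 2)"
    proof -
      have "stww_mat (finite_mat ?r R ?r C (perm_mat (right_translation (houghton n) g))) \<le> enat (card F + 2)"
        if "(R, C) \<in> {(R', C'). finite R' \<and> R' \<noteq> {} \<and> R' \<subseteq> ?X \<and> finite C' \<and> C' \<noteq> {} \<and> C' \<subseteq> ?X}" for R C
        using that by (intro almost_monotone_words.stww_mat_le[OF words]) simp_all
      then have "(SUP (R, C)\<in>{(R', C'). finite R' \<and> R' \<noteq> {} \<and> R' \<subseteq> ?X \<and> finite C' \<and> C' \<noteq> {} \<and> C' \<subseteq> ?X}.
          stww_mat (finite_mat ?r R ?r C (perm_mat (right_translation (houghton n) g)))) \<le> enat (card F + 2)"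
        by (intro SUP_least) (clarsimp simp del: plus_enat_simps)
      then show ?thesis
        unfolding translation_stww_def stww_def using infinite_houghton[OF n] by (simp only: simp_thms if_False)
    qed
    also have "\<dots> < \<infinity>"
      by simp
    finally show ?thesis .
  qed
  then show ?thesis
    unfolding finite_twin_width_def
    using linear_order_word_order[OF inj_word[OF n]] by blast
qed

theorem theorem2:
  fixes n :: nat
  assumes "n \<ge> 2"
  shows "finite_twin_width (houghton n) \<and> utww (houghton n) = \<infinity>"
  using finite_twin_width_houghton[OF assms] utww_houghton[OF assms] ..

end
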